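(* Let $2\le r<m\le n$ and $k\ge r$, and write $k=\lambda r+\mu$ with $\lambda\ge1$ and $0\le\mu<r$. For $0\le s\le\lambda-1$ let $c_s$ be the codimension of $\mathcal Z^{m-1,n-1}_{r-1,k-rs}$ in $\mathbf A^{(m-1)(n-1)(k-rs)}$; let $c_\lambda=0$ if $\mu=0$, and let $c_\lambda$ be the codimension of $\mathcal Z^{m,n}_{r,\mu}$ in $\mathbf A^{mn\mu}$ if $\mu>0$. Then the codimension of $\mathcal Z^{m,n}_{r,k}$ in $\mathbf A^{mnk}$ equals $$\min_{0\le s\le\lambda}\big(c_s+s\,mn\big).$$
   Context: Let $F$ be an algebraically closed field. For integers $1\le r\le m\le n$ and $k\ge 1$, let $S=F[x^{(l)}_{i,j}:1\le i\le m,\ 1\le j\le n,\ 0\le l\le k-1]$, the coordinate ring of $\mathbf A^{mnk}_F$, and let $X(t)$ be the $m\times n$ matrix over $S[t]/(t^k)$ with $(i,j)$ entry $x_{i,j}(t)=\sum_{l=0}^{k-1}x^{(l)}_{i,j}t^l$. $\mathcal I^{m,n}_{r,k}\subseteq S$ is the ideal generated by the coefficients of $t^l$, $0\le l\le k-1$, of all $r\times r$ minors of $X(t)$, and $\mathcal Z^{m,n}_{r,k}\subseteq\mathbf A^{mnk}_F$ is its zero set (same definition for other index values). The codimension of a (possibly reducible) variety is the minimum of the codimensions of its irreducible components. *)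

theory Defs
  imports "HOL-Combinatorics.Permutations" "HOL-Computational_Algebra.Polynomial"
          "HOL-Library.Extended_Nat"
begin

definition alg_closed :: "'a::field itself \<Rightarrow> bool" where
  "alg_closed _ \<longleftrightarrow> (\<forall>p :: 'a poly. degree p > 0 \<longrightarrow> (\<exists>x. poly p x = 0))"

text \<open>Affine space with coordinates indexed by a finite set I: points are functions
  vanishing outside I.\<close>
definition aff :: "'v set \<Rightarrow> ('v \<Rightarrow> 'a::field) set" where
  "aff I = {x. \<forall>v. v \<notin> I \<longrightarrow> x v = 0}"

inductive_set polyfun :: "(('v \<Rightarrow> 'a::field) \<Rightarrow> 'a) set" where
  pf_const: "(\<lambda>x. c) \<in> polyfun"
| pf_var: "(\<lambda>x. x v) \<in> polyfun"
| pf_add: "f \<in> polyfun \<Longrightarrow> g \<in> polyfun \<Longrightarrow> (\<lambda>x. f x + g x) \<in> polyfun"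
| pf_mult: "f \<in> polyfun \<Longrightarrow> g \<in> polyfun \<Longrightarrow> (\<lambda>x. f x * g x) \<in> polyfun"

definition zar_closed :: "'v set \<Rightarrow> ('v \<Rightarrow> 'a::field) set \<Rightarrow> bool" where
  "zar_closed I Z \<longleftrightarrow>
     (\<exists>S \<subseteq> polyfun. Z = {x \<in> aff I. \<forall>f\<in>S. f x = 0})"

definition zar_irreducible :: "'v set \<Rightarrow> ('v \<Rightarrow> 'a::field) set \<Rightarrow> bool" where
  "zar_irreducible I V \<longleftrightarrow> zar_closed I V \<and> V \<noteq> {} \<and>
     (\<forall>A B. zar_closed I A \<longrightarrow> zar_closed I B \<longrightarrow> V = A \<union> B \<longrightarrow> V = A \<or> V = B)"

definition irr_components :: "'v set \<Rightarrow> ('v \<Rightarrow> 'a::field) set \<Rightarrow> ('v \<Rightarrow> 'a) set set" where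
  "irr_components I Z = {V. V \<subseteq> Z \<and> zar_irreducible I V \<and>
      (\<forall>W. zar_irreducible I W \<longrightarrow> V \<subseteq> W \<longrightarrow> W \<subseteq> Z \<longrightarrow> W = V)}"

definition codim_irr :: "'v set \<Rightarrow> ('v \<Rightarrow> 'a::field) set \<Rightarrow> enat" where
  "codim_irr I V = (SUP c \<in> {c. \<exists>ch :: nat \<Rightarrow> ('v \<Rightarrow> 'a) set. ch 0 = V \<and>
        (\<forall>i\<le>c. zar_irreducible I (ch i)) \<and> (\<forall>i<c. ch i \<subset> ch (Suc i))}. enat c)"

definition codim :: "'v set \<Rightarrow> ('v \<Rightarrow> 'a::field) set \<Rightarrow> enat" where
  "codim I Z = (INF V \<in> irr_components I Z. codim_irr I V)"

definition jet_index :: "nat \<Rightarrow> nat \<Rightarrow> nat \<Rightarrow> (nat \<times> nat \<times> nat) set" where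
  "jet_index m n k = {1..m} \<times> {1..n} \<times> {0..<k}"

definition jet_entry :: "(nat \<times> nat \<times> nat \<Rightarrow> 'a::field) \<Rightarrow> nat \<Rightarrow> nat \<Rightarrow> nat \<Rightarrow> 'a poly" where
  "jet_entry x k i j = (\<Sum>l<k. monom (x (i, j, l)) l)"

definition jet_minor :: "(nat \<times> nat \<times> nat \<Rightarrow> 'a::field) \<Rightarrow> nat \<Rightarrow> nat \<Rightarrow> nat set \<Rightarrow> nat set \<Rightarrow> 'a poly" where
  "jet_minor x k r R C =
     (let rs = sorted_list_of_set R; cs = sorted_list_of_set C in
      \<Sum>p | p permutes {0..<r}. of_int (sign p) * (\<Prod>i<r. jet_entry x k (rs ! i) (cs ! p i)))"

text \<open>Z^{m,n}_{r,k}: the points where the coefficients of t^l, l < k, of all r x r minors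
  of X(t) vanish (truncation mod t^k commutes with taking determinants).\<close>
definition jetZ :: "nat \<Rightarrow> nat \<Rightarrow> nat \<Rightarrow> nat \<Rightarrow> (nat \<times> nat \<times> nat \<Rightarrow> 'a::field) set" where
  "jetZ m n r k = {x \<in> aff (jet_index m n k).
      \<forall>R C. R \<subseteq> {1..m} \<longrightarrow> C \<subseteq> {1..n} \<longrightarrow> card R = r \<longrightarrow> card C = r \<longrightarrow>
        (\<forall>l<k. coeff (jet_minor x k r R C) l = 0)}"

definition codimZ :: "'a::field itself \<Rightarrow> nat \<Rightarrow> nat \<Rightarrow> nat \<Rightarrow> nat \<Rightarrow> enat" where
  "codimZ _ m n r k = codim (jet_index m n k) (jetZ m n r k :: (nat \<times> nat \<times> nat \<Rightarrow> 'a) set)"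

end

(* The variety is stratified by the order s of the matrix X(t). If X = t^s Y with a unit entry of Y,
   pivoting on this entry turns the vanishing of the r-minors of Y modulo t^(k-rs) into the vanishing
   of the (r-1)-minors of an (m-1) x (n-1) matrix, and all other coordinates of Y are free; if t^lam
   divides X, what remains is the same condition on Y modulo t^mu.

   Dimension is handled without irreducible decompositions: codim Z <= c holds iff some irreducible
   subset V of Z, not necessarily closed, carries d algebraically independent polynomial functions
   with dim A <= d + c, where A is the ambient affine space. Chains of irreducible closed sets are
   bounded from above because every proper inclusion adds an independent function, and long chains
   are built from cylinders over the coordinate projections of V. Irreducible components are only
   needed through Zorn's lemma. *)
theory Submission
  imports Defs "Jordan_Normal_Form.Determinant" "HOL-Library.Function_Algebras"
    "HOL-Computational_Algebra.Formal_Power_Series"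
begin

text \<open>Strata are only locally closed, and their images under pivoting need not be closed, so
  an argument confined to closed sets would have to take closures at every step. Irreducibility is
  therefore primality of the ideal of functions vanishing on a set, closed or not. A stratum is
  compared with its image under pivoting by recovering \<open>x\<close> from its image and the free
  coordinates, with powers of the pivot coefficient as the only denominators. In one direction the
  free coordinates are adjoined to independent functions on the image. The other direction, a bound
  on the dimension upstairs, is where one would use transcendence degrees; here the recovery
  formulas become algebraic relations on the graph of the map, and the chain bound is applied to the
  graph. An irreducible set selects its own stratum and pivot: the first order in which some
  coefficient does not vanish identically on it. Codimensions are handled through their finite upper
  bounds, which turns the minimum over \<open>s\<close> into an existence statement. Algebraic
  closedness enters as infinitude of the field, which makes affine spaces irreducible.\<close>

text \<open>Over a finite field the product of all \<open>X - a\<close>, plus one, would be a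
  nonconstant polynomial taking only the value 1.\<close>

lemma alg_closed_infinite:
  assumes "alg_closed (F :: 'a::field itself)"
  shows "infinite (UNIV :: 'a set)"
proof
  assume fin: "finite (UNIV :: 'a set)"
  define p :: "'a poly" where "p = (\<Prod>a\<in>UNIV. [:- a, 1:]) + 1"
  have ev: "poly p x = 1" for x
    using fin by (auto simp: p_def poly_prod)
  have "\<exists>x. poly p x = 0" if "degree p > 0"
    using assms that unfolding alg_closed_def by blast
  with ev have "degree p = 0" by auto
  moreover have "degree (\<Prod>a\<in>(UNIV::'a set). [:- a, 1:]) = card (UNIV :: 'a set)"
    by (subst degree_prod_eq_sum_degree) auto
  moreover have "card (UNIV :: 'a set) > 0"
    using fin by (simp add: card_gt_0_iff)
  ultimately show False
    unfolding p_def by (metis degree_1 degree_add_eq_left less_irrefl)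
qed

section \<open>Polynomial functions\<close>

lemma polyfun_minus: "f \<in> polyfun \<Longrightarrow> g \<in> polyfun \<Longrightarrow> (\<lambda>x. f x - g x) \<in> polyfun"
  using pf_add[of f "\<lambda>x. (- 1) * g x"] pf_mult[OF pf_const[of "- 1"]] by auto

lemma polyfun_sum:
  "(\<And>i. i \<in> A \<Longrightarrow> f i \<in> polyfun) \<Longrightarrow> (\<lambda>x. \<Sum>i\<in>A. f i x) \<in> polyfun"
  by (induction A rule: infinite_finite_induct) (auto intro: polyfun.intros)

lemma polyfun_prod:
  "(\<And>i. i \<in> A \<Longrightarrow> f i \<in> polyfun) \<Longrightarrow> (\<lambda>x. \<Prod>i\<in>A. f i x) \<in> polyfun"
  by (induction A rule: infinite_finite_induct) (auto intro: polyfun.intros)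

lemma polyfun_power: "f \<in> polyfun \<Longrightarrow> (\<lambda>x. f x ^ n) \<in> polyfun"
  by (induction n) (auto intro: polyfun.intros)

lemma polyfun_subst:
  assumes "P \<in> polyfun" and "\<And>i. (\<lambda>x. \<phi> x i) \<in> polyfun"
  shows "(\<lambda>x. P (\<phi> x)) \<in> polyfun"
  using assms by (induction P rule: polyfun.induct) (auto intro: polyfun.intros)

lemma polyfun_if: "f \<in> polyfun \<Longrightarrow> g \<in> polyfun \<Longrightarrow> (\<lambda>x. if b then f x else g x) \<in> polyfun"
  by (cases b) auto

text \<open>\<open>polyfun\<close> consists of functions, so there are no coefficients to read off.
  This supplies an expansion in one variable \<open>v\<close> whose coefficient functions do not see
  \<open>v\<close>; the arguments on algebraic relations work with it.\<close>

lemma polyfun_expand: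
  assumes "P \<in> (polyfun :: (('v \<Rightarrow> 'a::field) \<Rightarrow> 'a) set)"
  shows "\<exists>n p. (\<forall>k. p k \<in> polyfun) \<and> (\<forall>k x z. p k (x(v := z)) = p k x) \<and>
           (\<forall>x. P x = (\<Sum>k\<le>n. p k x * x v ^ k))"
  using assms
proof (induction P rule: polyfun.induct)
  case (pf_const c)
  show ?case
    by (rule exI[of _ 0], rule exI[of _ "\<lambda>k x. c"]) (auto intro: polyfun.intros)
next
  case (pf_var w)
  show ?case
  proof (cases "w = v")
    case True
    show ?thesis
      by (rule exI[of _ 1], rule exI[of _ "\<lambda>k x. if k = 1 then 1 else 0"])
        (auto simp: True intro: polyfun.intros)
  next
    case False
    show ?thesis
      by (rule exI[of _ 0], rule exI[of _ "\<lambda>k x. x w"]) (auto simp: False intro: polyfun.intros)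
  qed
next
  case (pf_add f g)
  then obtain n p n' p' where
    p: "\<forall>k. p k \<in> polyfun" "\<forall>k x z. p k (x(v := z)) = p k x" "\<forall>x. f x = (\<Sum>k\<le>n. p k x * x v ^ k)"
    and p': "\<forall>k. p' k \<in> polyfun" "\<forall>k x z. p' k (x(v := z)) = p' k x" "\<forall>x. g x = (\<Sum>k\<le>n'. p' k x * x v ^ k)"
    by blast
  have eq1: "(\<Sum>k\<le>n. p k x * x v ^ k) = (\<Sum>k\<le>max n n'. (if k \<le> n then p k x else 0) * x v ^ k)" for x
    by (rule sum.mono_neutral_cong_left) auto
  have eq2: "(\<Sum>k\<le>n'. p' k x * x v ^ k) = (\<Sum>k\<le>max n n'. (if k \<le> n' then p' k x else 0) * x v ^ k)" for x
    by (rule sum.mono_neutral_cong_left) auto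
  show ?case
    apply (rule exI[of _ "max n n'"],
        rule exI[of _ "\<lambda>k x. (if k \<le> n then p k x else 0) + (if k \<le> n' then p' k x else 0)"])
    using p p' by (auto intro!: polyfun.intros polyfun_if simp: eq1 eq2 sum.distrib distrib_right)
next
  case (pf_mult f g)
  then obtain n p n' p' where
    p: "\<forall>k. p k \<in> polyfun" "\<forall>k x z. p k (x(v := z)) = p k x" "\<forall>x. f x = (\<Sum>k\<le>n. p k x * x v ^ k)"
    and p': "\<forall>k. p' k \<in> polyfun" "\<forall>k x z. p' k (x(v := z)) = p' k x" "\<forall>x. g x = (\<Sum>k\<le>n'. p' k x * x v ^ k)"
    by blast
  define q where "q = (\<lambda>k x. \<Sum>(i,j)\<in>{(i,j). i \<le> n \<and> j \<le> n' \<and> i + j = k}. p i x * p' j x)"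
  have "q k \<in> polyfun" for k
    unfolding q_def case_prod_unfold using p p' by (intro polyfun_sum polyfun.intros) auto
  moreover have "q k (x(v := z)) = q k x" for k x z
    using p p' by (auto simp: q_def intro!: sum.cong)
  moreover have "f x * g x = (\<Sum>k\<le>n+n'. q k x * x v ^ k)" for x
  proof -
    have "f x * g x = (\<Sum>(i,j)\<in>{..n} \<times> {..n'}. (p i x * p' j x) * x v ^ (i + j))"
      by (simp only: spec[OF p(3)] spec[OF p'(3)] sum_product sum.cartesian_product)
        (auto simp: power_add mult_ac intro!: sum.cong)
    also have "\<dots> = (\<Sum>k\<le>n+n'. \<Sum>z\<in>{z \<in> {..n} \<times> {..n'}. (\<lambda>(i,j). i + j) z = k}.
        (\<lambda>(i,j). (p i x * p' j x) * x v ^ (i + j)) z)"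
      by (rule sum.group[symmetric]) auto
    also have "\<dots> = (\<Sum>k\<le>n+n'. q k x * x v ^ k)"
      unfolding q_def sum_distrib_right by (intro sum.cong) (auto simp: case_prod_unfold)
    finally show ?thesis .
  qed
  ultimately show ?case by blast
qed

lemma ex_poly_nonzero:
  fixes c :: "nat \<Rightarrow> 'a::field"
  assumes "infinite (UNIV :: 'a set)" "c k \<noteq> 0" "k \<le> n"
  shows "\<exists>z. (\<Sum>i\<le>n. c i * z ^ i) \<noteq> 0"
proof (rule ccontr)
  assume H: "\<nexists>z. (\<Sum>i\<le>n. c i * z ^ i) \<noteq> 0"
  define p where "p = (\<Sum>i\<le>n. monom (c i) i)"
  have "poly p z = 0" for z
    using H by (simp add: p_def poly_sum poly_monom)
  then have "p = 0"
    using poly_roots_finite[of p] assms(1) by (auto simp: UNIV_def[symmetric])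
  moreover have "coeff p k = c k"
    using assms(3) by (simp add: p_def coeff_sum if_distrib cong: if_cong)
  ultimately show False using assms(2) by simp
qed

section \<open>Irreducible sets\<close>

definition vanishes :: "('v \<Rightarrow> 'a) set \<Rightarrow> (('v \<Rightarrow> 'a::field) \<Rightarrow> 'a) \<Rightarrow> bool" where
  "vanishes V f \<longleftrightarrow> (\<forall>x\<in>V. f x = 0)"

text \<open>Primality of the ideal of polynomial functions vanishing on \<open>V\<close>. Neither an
  ambient index set nor closedness is involved, so that images and open parts of a set qualify as
  well.\<close>

definition irred :: "('v \<Rightarrow> 'a::field) set \<Rightarrow> bool" where
  "irred V \<longleftrightarrow> V \<noteq> {} \<and> (\<forall>f\<in>polyfun. \<forall>g\<in>polyfun.
     vanishes V (\<lambda>x. f x * g x) \<longrightarrow> vanishes V f \<or> vanishes V g)"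

definition zcl :: "'v set \<Rightarrow> ('v \<Rightarrow> 'a::field) set \<Rightarrow> ('v \<Rightarrow> 'a) set" where
  "zcl I V = {x \<in> aff I. \<forall>f\<in>polyfun. vanishes V f \<longrightarrow> f x = 0}"

lemma irredD:
  "irred V \<Longrightarrow> f \<in> polyfun \<Longrightarrow> g \<in> polyfun \<Longrightarrow> vanishes V (\<lambda>x. f x * g x) \<Longrightarrow>
     vanishes V f \<or> vanishes V g"
  unfolding irred_def by blast

lemma irred_power:
  assumes "irred V" "f \<in> polyfun" "vanishes V (\<lambda>x. f x ^ n)"
  shows "vanishes V f"
  using assms(3)
proof (induction n)
  case 0
  then show ?case using assms(1) by (auto simp: vanishes_def irred_def)
next
  case (Suc n)
  then show ?case using irredD[OF assms(1,2) polyfun_power[OF assms(2), of n]] by auto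
qed

lemma zcl_superset: "V \<subseteq> aff I \<Longrightarrow> V \<subseteq> zcl I V"
  unfolding zcl_def vanishes_def by auto

lemma vanishes_zcl: "f \<in> polyfun \<Longrightarrow> V \<subseteq> aff I \<Longrightarrow> vanishes (zcl I V) f \<longleftrightarrow> vanishes V f"
  using zcl_superset[of V I] unfolding zcl_def vanishes_def by auto

lemma zar_closed_zcl: "zar_closed I (zcl I V)"
  unfolding zar_closed_def zcl_def
  by (rule exI[of _ "{f \<in> polyfun. vanishes V f}"]) auto

lemma zar_closed_sub: "zar_closed I V \<Longrightarrow> V \<subseteq> aff I"
  unfolding zar_closed_def by auto

lemma zcl_least: "zar_closed I Z \<Longrightarrow> V \<subseteq> Z \<Longrightarrow> zcl I V \<subseteq> Z"
  unfolding zar_closed_def zcl_def vanishes_def by blast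

lemma zcl_closed: "zar_closed I Z \<Longrightarrow> zcl I Z = Z"
  using zcl_least[of I Z Z] zcl_superset[of Z I] zar_closed_sub[of I Z] by auto

lemma irred_zcl: "(V :: ('a \<Rightarrow> 'b::field) set) \<subseteq> aff I \<Longrightarrow> irred (zcl I V) \<longleftrightarrow> irred V"
proof -
  assume V: "V \<subseteq> aff I"
  have "V = {} \<longleftrightarrow> zcl I V = {}"
  proof
    assume "V = {}"
    then have "vanishes V (\<lambda>x. 1)" by (simp add: vanishes_def)
    then have "(1 :: 'b) = 0" if "x \<in> zcl I V" for x
      using that pf_const[of "1 :: 'b"] unfolding zcl_def by blast
    then show "zcl I V = {}" by auto
  qed (use zcl_superset[OF V] in blast)
  then show ?thesis
    unfolding irred_def by (simp add: vanishes_zcl[OF _ V] pf_mult cong: ball_cong)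
qed

text \<open>One direction cuts \<open>V\<close> by the zero sets of \<open>f\<close> and
  \<open>g\<close>; the other picks functions that vanish on \<open>A\<close> and on
  \<open>B\<close> but not on \<open>V\<close>, and whose product vanishes on
  \<open>V\<close>.\<close>

lemma zar_irreducible_iff: "zar_irreducible I V \<longleftrightarrow> zar_closed I V \<and> irred V"
proof
  assume ir: "zar_irreducible I V"
  then have cl: "zar_closed I V" and ne: "V \<noteq> {}"
    and un: "\<And>A B. zar_closed I A \<Longrightarrow> zar_closed I B \<Longrightarrow> V = A \<union> B \<Longrightarrow> V = A \<or> V = B"
    unfolding zar_irreducible_def by auto
  have "vanishes V f \<or> vanishes V g"
    if fg: "f \<in> polyfun" "g \<in> polyfun" "vanishes V (\<lambda>x. f x * g x)" for f g
  proof -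
    obtain S where S: "S \<subseteq> polyfun" "V = {x \<in> aff I. \<forall>f\<in>S. f x = 0}"
      using cl unfolding zar_closed_def by blast
    have "zar_closed I {x \<in> V. h x = 0}" if "h \<in> polyfun" for h
      unfolding zar_closed_def by (rule exI[of _ "insert h S"]) (use S that in auto)
    moreover have "V = {x \<in> V. f x = 0} \<union> {x \<in> V. g x = 0}"
      using fg(3) by (auto simp: vanishes_def)
    ultimately have "V = {x \<in> V. f x = 0} \<or> V = {x \<in> V. g x = 0}"
      using un fg by blast
    then show ?thesis by (auto simp: vanishes_def)
  qed
  with cl ne show "zar_closed I V \<and> irred V" unfolding irred_def by blast
next
  assume H: "zar_closed I V \<and> irred V"
  have "V = A \<or> V = B" if AB: "zar_closed I A" "zar_closed I B" "V = A \<union> B" for A B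
  proof (rule ccontr)
    assume "\<not> (V = A \<or> V = B)"
    then obtain x y where x: "x \<in> V" "x \<notin> A" and y: "y \<in> V" "y \<notin> B" using AB by blast
    have VI: "V \<subseteq> aff I" using H zar_closed_sub by blast
    obtain f where f: "f \<in> polyfun" "vanishes A f" "f x \<noteq> 0"
      using x VI AB(1) unfolding zar_closed_def vanishes_def by blast
    obtain g where g: "g \<in> polyfun" "vanishes B g" "g y \<noteq> 0"
      using y VI AB(2) unfolding zar_closed_def vanishes_def by blast
    have "vanishes V (\<lambda>x. f x * g x)"
      using f g AB(3) by (auto simp: vanishes_def)
    then have "vanishes V f \<or> vanishes V g" using irredD H f g by blast
    then show False using f g x y by (auto simp: vanishes_def)
  qed
  then show "zar_irreducible I V"
    using H unfolding zar_irreducible_def irred_def by blast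
qed

lemma irred_image:
  fixes \<phi> :: "('v \<Rightarrow> 'a::field) \<Rightarrow> 'w \<Rightarrow> 'a"
  assumes "irred V" "\<And>i. (\<lambda>x. \<phi> x i) \<in> polyfun"
  shows "irred (\<phi> ` V)"
  unfolding irred_def
proof (intro conjI ballI impI)
  show "\<phi> ` V \<noteq> {}" using assms(1) by (auto simp: irred_def)
  fix f g :: "('w \<Rightarrow> 'a) \<Rightarrow> 'a"
  assume "f \<in> polyfun" "g \<in> polyfun" "vanishes (\<phi> ` V) (\<lambda>x. f x * g x)"
  then show "vanishes (\<phi> ` V) f \<or> vanishes (\<phi> ` V) g"
    using irredD[OF assms(1) polyfun_subst[OF _ assms(2)] polyfun_subst[OF _ assms(2)], of f g]
    by (auto simp: vanishes_def)
qed

text \<open>A function that vanishes where \<open>q\<close> is nonzero vanishes on all of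
  \<open>V\<close> after multiplication by \<open>q\<close>, so primality leaves the vanishing ideal
  unchanged.\<close>

lemma irred_open:
  assumes "irred V" "q \<in> polyfun" "\<not> vanishes V q"
  shows "irred {x \<in> V. q x \<noteq> 0}"
    and "f \<in> polyfun \<Longrightarrow> vanishes {x \<in> V. q x \<noteq> 0} f \<longleftrightarrow> vanishes V f"
proof -
  have *: "vanishes {x \<in> V. q x \<noteq> 0} f \<longleftrightarrow> vanishes V f" if "f \<in> polyfun" for f
  proof
    assume "vanishes {x \<in> V. q x \<noteq> 0} f"
    then have "vanishes V (\<lambda>x. q x * f x)" by (auto simp: vanishes_def)
    then show "vanishes V f" using irredD[OF assms(1,2) that] assms(3) by blast
  qed (auto simp: vanishes_def)
  then show "f \<in> polyfun \<Longrightarrow> vanishes {x \<in> V. q x \<noteq> 0} f \<longleftrightarrow> vanishes V f" .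
  show "irred {x \<in> V. q x \<noteq> 0}"
    unfolding irred_def using * assms
    by (auto simp: pf_mult irred_def) (auto simp: vanishes_def)
qed

text \<open>If \<open>f\<close> is nonzero at one point and \<open>g\<close> at another,
  irreducibility of \<open>W\<close> moves both second coordinates to a common \<open>w\<close>, and
  irreducibility of \<open>V\<close> then does the same with the first coordinates.\<close>

lemma irred_prod:
  fixes V :: "('v \<Rightarrow> 'a::field) set" and W :: "('w \<Rightarrow> 'a) set"
  assumes "irred V" "irred W"
  shows "irred ((\<lambda>(x, y). case_sum x y) ` (V \<times> W))"
  unfolding irred_def
proof (intro conjI ballI impI)
  show "(\<lambda>(x, y). case_sum x y) ` (V \<times> W) \<noteq> {}"
    using assms by (auto simp: irred_def)
  fix f g :: "('v + 'w \<Rightarrow> 'a) \<Rightarrow> 'a"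
  assume fg: "f \<in> polyfun" "g \<in> polyfun"
    and v: "vanishes ((\<lambda>(x, y). case_sum x y) ` (V \<times> W)) (\<lambda>x. f x * g x)"
  have p1: "(\<lambda>x. h (case_sum x y)) \<in> polyfun"
    if "h \<in> polyfun" for h :: "('v + 'w \<Rightarrow> 'a) \<Rightarrow> 'a" and y
    by (rule polyfun_subst[OF that, of "\<lambda>x. case_sum x y"], case_tac i)
      (simp_all add: polyfun.intros)
  have p2: "(\<lambda>y. h (case_sum x y)) \<in> polyfun"
    if "h \<in> polyfun" for h :: "('v + 'w \<Rightarrow> 'a) \<Rightarrow> 'a" and x
    by (rule polyfun_subst[OF that, of "\<lambda>y. case_sum x y"], case_tac i)
      (simp_all add: polyfun.intros)
  show "vanishes ((\<lambda>(x, y). case_sum x y) ` (V \<times> W)) f \<or> vanishes ((\<lambda>(x, y). case_sum x y) ` (V \<times> W)) g"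
  proof (rule ccontr)
    assume "\<not> ?thesis"
    then obtain x y x' y' where n: "x \<in> V" "y \<in> W" "f (case_sum x y) \<noteq> 0"
      "x' \<in> V" "y' \<in> W" "g (case_sum x' y') \<noteq> 0"
      by (fastforce simp: vanishes_def)
    have "\<not> vanishes W (\<lambda>y. f (case_sum x y) * g (case_sum x' y))"
      using irredD[OF assms(2) p2[OF fg(1)] p2[OF fg(2)]] n by (auto simp: vanishes_def)
    then obtain w where w: "w \<in> W" "f (case_sum x w) \<noteq> 0" "g (case_sum x' w) \<noteq> 0"
      by (auto simp: vanishes_def)
    have "\<not> vanishes V (\<lambda>x. f (case_sum x w) * g (case_sum x w))"
      using irredD[OF assms(1) p1[OF fg(1)] p1[OF fg(2)]] n w by (auto simp: vanishes_def)
    then show False using v w by (auto simp: vanishes_def)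
  qed
qed

text \<open>On the line through a point where \<open>f\<close> is nonzero and a point where
  \<open>g\<close> is nonzero, both become nonzero polynomials in one variable, whose product cannot
  vanish at infinitely many parameters.\<close>

lemma irred_aff:
  fixes I :: "'v set"
  assumes "infinite (UNIV :: 'a::field set)"
  shows "irred (aff I :: ('v \<Rightarrow> 'a) set)"
  unfolding irred_def
proof (intro conjI ballI impI)
  show "aff I \<noteq> ({} :: ('v \<Rightarrow> 'a) set)" by (auto simp: aff_def intro: exI[of _ "\<lambda>_. 0"])
  fix f g :: "('v \<Rightarrow> 'a) \<Rightarrow> 'a"
  assume fg: "f \<in> polyfun" "g \<in> polyfun" and v: "vanishes (aff I) (\<lambda>x. f x * g x)"
  show "vanishes (aff I) f \<or> vanishes (aff I) g"
  proof (rule ccontr)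
    assume "\<not> ?thesis"
    then obtain x y where x: "x \<in> aff I" "f x \<noteq> 0" and y: "y \<in> aff I" "g y \<noteq> 0"
      by (auto simp: vanishes_def)
    \<comment> \<open>The parameter of the line is coordinate 0 of a function on \<open>nat\<close>,
      so that \<open>polyfun_subst\<close> applies; evaluation at constant functions then makes it a
      single scalar.\<close>
    define L :: "(nat \<Rightarrow> 'a) \<Rightarrow> 'v \<Rightarrow> 'a" where "L = (\<lambda>z v. (1 - z 0) * x v + z 0 * y v)"
    have L: "(\<lambda>z. L z v) \<in> polyfun" for v
      unfolding L_def by (intro polyfun.intros polyfun_minus)
    have one_var: "\<exists>n c. \<forall>z. h (\<lambda>_. z) = (\<Sum>i\<le>n. c i * z ^ i)" if h: "h \<in> polyfun" 
      for h :: "(nat \<Rightarrow> 'a) \<Rightarrow> 'a"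
      using h
    proof (induction h rule: polyfun.induct)
      case (pf_const c)
      show ?case by (rule exI[of _ 0], rule exI[of _ "\<lambda>_. c"]) simp
    next
      case (pf_var v)
      show ?case by (rule exI[of _ 1], rule exI[of _ "\<lambda>k. if k = 1 then 1 else 0"]) simp
    next
      case (pf_add f g)
      then obtain n c n' c' where *: "\<forall>z. f (\<lambda>_. z) = (\<Sum>i\<le>n. c i * z ^ i)"
        "\<forall>z. g (\<lambda>_. z) = (\<Sum>i\<le>n'. c' i * z ^ i)" by blast
      define p where "p = (\<Sum>i\<le>n. monom (c i) i) + (\<Sum>i\<le>n'. monom (c' i) i)"
      have "f (\<lambda>_. z) + g (\<lambda>_. z) = poly p z" for z
        using * by (simp add: p_def poly_sum poly_monom)
      then show ?case by (intro exI[of _ "degree p"] exI[of _ "coeff p"]) (simp add: poly_altdef)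
    next
      case (pf_mult f g)
      then obtain n c n' c' where *: "\<forall>z. f (\<lambda>_. z) = (\<Sum>i\<le>n. c i * z ^ i)"
        "\<forall>z. g (\<lambda>_. z) = (\<Sum>i\<le>n'. c' i * z ^ i)" by blast
      define p where "p = (\<Sum>i\<le>n. monom (c i) i) * (\<Sum>i\<le>n'. monom (c' i) i)"
      have "f (\<lambda>_. z) * g (\<lambda>_. z) = poly p z" for z
        using * by (simp add: p_def poly_sum poly_monom)
      then show ?case by (intro exI[of _ "degree p"] exI[of _ "coeff p"]) (simp add: poly_altdef)
    qed
    have pol: "\<exists>p. (\<forall>z. h (L (\<lambda>_. z)) = poly p z)" if h: "h \<in> polyfun" for h
    proof -
      obtain n c where *: "\<forall>z. h (L (\<lambda>_. z)) = (\<Sum>i\<le>n. c i * z ^ i)"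
        using one_var[OF polyfun_subst[where \<phi> = L, OF h L]] by blast
      show ?thesis
        by (rule exI[of _ "\<Sum>i\<le>n. monom (c i) i"]) (use * in \<open>simp add: poly_sum poly_monom\<close>)
    qed
    obtain p where p: "\<And>z. f (L (\<lambda>_. z)) = poly p z" using pol[OF fg(1)] by blast
    obtain q where q: "\<And>z. g (L (\<lambda>_. z)) = poly q z" using pol[OF fg(2)] by blast
    have "L (\<lambda>_. z) \<in> aff I" for z
      using x y by (auto simp: L_def aff_def)
    then have "poly (p * q) z = 0" for z
      using v by (auto simp: vanishes_def p[symmetric] q[symmetric])
    then have "p * q = 0"
      using poly_roots_finite[of "p * q"] assms by (auto simp: UNIV_def[symmetric])
    moreover have "poly p 0 \<noteq> 0" "poly q 1 \<noteq> 0"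
      using x y p[of 0] q[of 1] by (auto simp: L_def)
    ultimately show False by auto
  qed
qed

section \<open>Algebraic independence and codimension\<close>

definition restr :: "'i set \<Rightarrow> ('i \<Rightarrow> 'a::zero) \<Rightarrow> 'i \<Rightarrow> 'a" where
  "restr J y = (\<lambda>j. if j \<in> J then y j else 0)"

text \<open>Algebraic independence of the functions g j restricted to V, expressed as density of
  the image of V in the affine space with coordinates J.\<close>
definition indep :: "'i set \<Rightarrow> ('i \<Rightarrow> ('v \<Rightarrow> 'a) \<Rightarrow> 'a) \<Rightarrow> ('v \<Rightarrow> 'a::field) set \<Rightarrow> bool" where
  "indep J g V \<longleftrightarrow> (\<forall>P\<in>polyfun. vanishes V (\<lambda>x. P (restr J (\<lambda>j. g j x))) \<longrightarrow> vanishes (aff J) P)"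

text \<open>Over an infinite field and for irreducible \<open>V\<close> this says that the function
  field of the closure has transcendence degree at least \<open>d\<close>. Recording lower bounds
  only avoids maxima and makes monotonicity in \<open>V\<close> immediate.\<close>

definition dim_ge :: "('v \<Rightarrow> 'a::field) set \<Rightarrow> nat \<Rightarrow> bool" where
  "dim_ge V d \<longleftrightarrow> (\<exists>g. (\<forall>i. g i \<in> polyfun) \<and> indep {..<d} g V)"

lemma restr_aff: "restr J y \<in> aff J"
  by (simp add: restr_def aff_def)

lemma restr_id: "y \<in> aff J \<Longrightarrow> restr J y = y"
  by (auto simp: restr_def aff_def fun_eq_iff)

lemma polyfun_restr_family:
  "(\<And>j. g j \<in> polyfun) \<Longrightarrow> (\<lambda>x. restr J (\<lambda>j. g j x) i) \<in> polyfun"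
  unfolding restr_def by (intro polyfun_if pf_const)

lemma sum_fun_apply: "(\<Sum>i\<in>A. f i) x = (\<Sum>i\<in>A. f i x)"
  by (induction A rule: infinite_finite_induct) auto

lemma polyfun_restr: "f \<in> polyfun \<Longrightarrow> (\<lambda>x. f (restr J x)) \<in> polyfun"
  by (rule polyfun_subst[of f "restr J"]) (auto intro: polyfun_restr_family pf_var)

lemma indep_mono: "indep J g V \<Longrightarrow> V \<subseteq> W \<Longrightarrow> indep J g W"
  unfolding indep_def vanishes_def by blast

lemma dim_ge_mono: "dim_ge V d \<Longrightarrow> V \<subseteq> W \<Longrightarrow> dim_ge W d"
  unfolding dim_ge_def using indep_mono by blast

lemma dim_geI:
  fixes g :: "'i \<Rightarrow> ('v \<Rightarrow> 'a::field) \<Rightarrow> 'a"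
  assumes "finite J" "\<And>j. g j \<in> polyfun" "indep J g V"
  shows "dim_ge V (card J)"
proof -
  obtain h where h: "bij_betw h {..<card J} J"
    using assms(1) ex_bij_betw_nat_finite[of J] by (auto simp: lessThan_atLeast0)
  define h' where "h' = the_inv_into {..<card J} h"
  have h': "h' j < card J" "h (h' j) = j" if "j \<in> J" for j
    using h that f_the_inv_into_f_bij_betw[OF h] bij_betw_the_inv_into[OF h]
    unfolding h'_def by (auto dest: bij_betwE)
  have h'h: "h' (h i) = i" if "i < card J" for i
    using h that unfolding h'_def by (metis bij_betw_def lessThan_iff the_inv_into_f_f)
  have hJ: "h i \<in> J" if "i < card J" for i using h that by (auto dest: bij_betwE)
  have "indep {..<card J} (\<lambda>i. g (h i)) V"
    unfolding indep_def
  proof (intro ballI impI)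
    fix P :: "(nat \<Rightarrow> 'a) \<Rightarrow> 'a"
    assume P: "P \<in> polyfun" "vanishes V (\<lambda>x. P (restr {..<card J} (\<lambda>i. g (h i) x)))"
    define Q where "Q = (\<lambda>y::'i \<Rightarrow> 'a. P (restr {..<card J} (\<lambda>i. y (h i))))"
    have Q: "Q \<in> polyfun"
      unfolding Q_def
      by (rule polyfun_subst[OF P(1), of "\<lambda>y. restr {..<card J} (\<lambda>i. y (h i))"])
        (intro polyfun_restr_family pf_var)
    have "restr {..<card J} (\<lambda>i. restr J (\<lambda>j. g j x) (h i)) = restr {..<card J} (\<lambda>i. g (h i) x)" for x
      using hJ by (auto simp: restr_def)
    then have "vanishes V (\<lambda>x. Q (restr J (\<lambda>j. g j x)))"
      using P(2) by (simp add: Q_def)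
    then have "vanishes (aff J) Q" using assms(3) Q unfolding indep_def by blast
    show "vanishes (aff {..<card J}) P"
      unfolding vanishes_def
    proof
      fix y :: "nat \<Rightarrow> 'a" assume y: "y \<in> aff {..<card J}"
      have "restr {..<card J} (\<lambda>i. restr J (\<lambda>j. y (h' j)) (h i)) = y"
        using y hJ h'h by (auto simp: restr_def aff_def fun_eq_iff)
      moreover have "Q (restr J (\<lambda>j. y (h' j))) = 0"
        using \<open>vanishes (aff J) Q\<close> restr_aff unfolding vanishes_def by blast
      ultimately show "P y = 0" by (simp add: Q_def)
    qed
  qed
  then show ?thesis
    unfolding dim_ge_def using assms(2) by (intro exI[of _ "\<lambda>i. g (h i)"]) simp
qed

text \<open>In a relation between the g's and f of minimal f-order, cancel the power of f on W and
  restrict to V, where only a relation between the g's is left.\<close>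
lemma dim_ge_Suc:
  fixes V W :: "('v \<Rightarrow> 'a::field) set"
  assumes "dim_ge V d" "V \<subseteq> W" "irred W" "f \<in> polyfun" "vanishes V f" "\<not> vanishes W f"
  shows "dim_ge W (Suc d)"
proof -
  obtain g where g: "\<And>i. g i \<in> polyfun" "indep {..<d} g V"
    using assms(1) unfolding dim_ge_def by blast
  define g' where "g' = g(d := f)"
  have "indep {..<Suc d} g' W"
    unfolding indep_def
  proof (intro ballI impI)
    fix P :: "(nat \<Rightarrow> 'a) \<Rightarrow> 'a"
    assume P: "P \<in> polyfun" "vanishes W (\<lambda>x. P (restr {..<Suc d} (\<lambda>i. g' i x)))"
    obtain n p where p: "\<And>k. p k \<in> polyfun" "\<And>k x z. p k (x(d := z)) = p k x"
      "\<And>x. P x = (\<Sum>k\<le>n. p k x * x d ^ k)"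
      using polyfun_expand[OF P(1), of d] by blast
    have p_restr: "p k (restr {..<Suc d} y) = p k (restr {..<d} y)" for k y
    proof -
      have "(restr {..<Suc d} y)(d := 0) = restr {..<d} y"
        by (auto simp: restr_def fun_eq_iff)
      then show ?thesis using p(2)[of k "restr {..<Suc d} y" 0] by simp
    qed
    have gg: "restr {..<d} (\<lambda>i. g' i x) = restr {..<d} (\<lambda>i. g i x)" for x
      by (auto simp: g'_def restr_def)
    have all0: "k \<le> n \<longrightarrow> vanishes (aff {..<d}) (p k)" for k
    proof (induction k rule: less_induct)
      case (less k)
      show ?case
      proof
        assume kn: "k \<le> n"
        \<comment> \<open>The relation with its terms below \<open>k\<close> removed by the
          induction hypothesis and one factor \<open>f ^ k\<close> taken out; on \<open>V\<close>
          only its term \<open>j = k\<close> survives.\<close>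
        define R where "R = (\<lambda>x. \<Sum>j\<in>{k..n}. p j (restr {..<d} (\<lambda>i. g i x)) * f x ^ (j - k))"
        have pp: "(\<lambda>x. p j (restr {..<d} (\<lambda>i. g i x))) \<in> polyfun" for j
          by (rule polyfun_subst[OF p(1)]) (intro polyfun_restr_family g)
        have "R \<in> polyfun"
          unfolding R_def by (intro polyfun_sum pf_mult pp polyfun_power assms)
        moreover have "f x ^ k * R x = 0" if "x \<in> W" for x
        proof -
          have "0 = (\<Sum>j\<le>n. p j (restr {..<d} (\<lambda>i. g i x)) * f x ^ j)"
            using P(2) that by (simp add: vanishes_def p(3) p_restr gg) (simp add: restr_def g'_def)
          also have "\<dots> = (\<Sum>j\<in>{k..n}. p j (restr {..<d} (\<lambda>i. g i x)) * f x ^ j)"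
          proof (intro sum.mono_neutral_right ballI)
            fix j assume "j \<in> {..n} - {k..n}"
            then have "p j (restr {..<d} (\<lambda>i. g i x)) = 0"
              using less.IH[of j] kn restr_aff unfolding vanishes_def by fastforce
            then show "p j (restr {..<d} (\<lambda>i. g i x)) * f x ^ j = 0" by simp
          qed auto
          also have "\<dots> = f x ^ k * R x"
            unfolding R_def sum_distrib_left
            by (intro sum.cong) (auto simp: power_add[symmetric] mult.left_commute)
          finally show ?thesis by simp
        qed
        ultimately have "vanishes W R"
          using irredD[OF assms(3) polyfun_power[OF assms(4), of k], of R]
            irred_power[OF assms(3,4), of k] assms(6) by (auto simp: vanishes_def)
        then have "vanishes V R" using assms(2) by (auto simp: vanishes_def)
        moreover have "R x = p k (restr {..<d} (\<lambda>i. g i x))" if "x \<in> V" for x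
        proof -
          have "f x = 0" using assms(5) that by (simp add: vanishes_def)
          then have "R x = (\<Sum>j\<in>{k}. p j (restr {..<d} (\<lambda>i. g i x)) * f x ^ (j - k))"
            unfolding R_def using kn by (intro sum.mono_neutral_right) auto
          then show ?thesis by simp
        qed
        ultimately show "vanishes (aff {..<d}) (p k)"
          using g(2) p(1)[of k] unfolding indep_def by (auto simp: vanishes_def)
      qed
    qed
    show "vanishes (aff {..<Suc d}) P"
      unfolding vanishes_def
    proof
      fix y :: "nat \<Rightarrow> 'a" assume y: "y \<in> aff {..<Suc d}"
      have "p k y = 0" if "k \<le> n" for k
        using p_restr[of k y] restr_id[OF y] all0[of k] that restr_aff[of "{..<d}" y]
        unfolding vanishes_def by simp
      then show "P y = 0" by (simp add: p(3))
    qed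
  qed
  moreover have "g' i \<in> polyfun" for i using g assms by (simp add: g'_def)
  ultimately show ?thesis unfolding dim_ge_def by blast
qed

text \<open>Counting: products of the g's of bounded degree lie in the span of few monomials, while
  composing g with functions separating the points of a grid yields many independent functions.\<close>
lemma dim_ge_le_card:
  fixes W :: "('v \<Rightarrow> 'a::field) set"
  assumes inf: "infinite (UNIV :: 'a set)" and I: "finite I" "W \<subseteq> aff I" and d: "dim_ge W d"
  shows "d \<le> card I"
proof (rule ccontr)
  assume "\<not> d \<le> card I"
  then have dI: "card I < d" by simp
  obtain g where g: "\<And>i. g i \<in> polyfun" "indep {..<d} g W"
    using d unfolding dim_ge_def by blast
  define scale :: "'a \<Rightarrow> (('v \<Rightarrow> 'a) \<Rightarrow> 'a) \<Rightarrow> ('v \<Rightarrow> 'a) \<Rightarrow> 'a" where "scale = (\<lambda>c f x. c * f x)"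
  interpret vs: vector_space scale
    by unfold_locales (auto simp: scale_def fun_eq_iff algebra_simps)
  \<comment> \<open>Functions are set to zero off \<open>aff I\<close>, so that equality of
    functions means equality on \<open>aff I\<close>. Bounding each exponent separately by
    \<open>E\<close> leaves at most \<open>Suc E ^ card I\<close> monomials.\<close>
  define mono :: "('v \<Rightarrow> nat) \<Rightarrow> ('v \<Rightarrow> 'a) \<Rightarrow> 'a" where
    "mono = (\<lambda>\<alpha> x. if x \<in> aff I then \<Prod>v\<in>I. x v ^ \<alpha> v else 0)"
  define M where "M = (\<lambda>E. mono ` (I \<rightarrow>\<^sub>E {..E}))"
  have finM: "finite (M E)" for E
    unfolding M_def by (intro finite_imageI finite_PiE I) auto
  have cardM: "card (M E) \<le> Suc E ^ card I" for E
    unfolding M_def using card_image_le[of "I \<rightarrow>\<^sub>E {..E}" mono] I(1)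
    by (simp add: card_PiE finite_PiE)
  define cut :: "(('v \<Rightarrow> 'a) \<Rightarrow> 'a) \<Rightarrow> ('v \<Rightarrow> 'a) \<Rightarrow> 'a" where
    "cut = (\<lambda>f x. if x \<in> aff I then f x else 0)"
  \<comment> \<open>\<open>bd E f\<close>: on \<open>aff I\<close>, \<open>f\<close> agrees with a
    polynomial of degree at most \<open>E\<close> in each variable.\<close>
  define bd where "bd = (\<lambda>E f. cut f \<in> vs.span (M E))"
  have mono_in: "mono \<alpha> \<in> M E" if "\<And>v. v \<in> I \<Longrightarrow> \<alpha> v \<le> E" for \<alpha> E
  proof -
    have "mono \<alpha> = mono (restrict \<alpha> I)" by (auto simp: mono_def fun_eq_iff intro!: prod.cong)
    moreover have "restrict \<alpha> I \<in> I \<rightarrow>\<^sub>E {..E}" using that by auto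
    ultimately show ?thesis unfolding M_def by blast
  qed
  have bd_mono: "bd E' f" if "bd E f" "E \<le> E'" for E E' f
  proof -
    have "M E \<subseteq> M E'" unfolding M_def using that(2) by (intro image_mono PiE_mono) auto
    then show ?thesis using that(1) vs.span_mono unfolding bd_def by blast
  qed
  have bd_const: "bd 0 (\<lambda>x. c)" for c
  proof -
    have "cut (\<lambda>x. c) = scale c (mono (\<lambda>_. 0))"
      by (auto simp: cut_def scale_def mono_def fun_eq_iff)
    then show ?thesis unfolding bd_def using mono_in[of "\<lambda>_. 0" 0]
      by (auto intro: vs.span_scale vs.span_base)
  qed
  have bd_add: "bd E (\<lambda>x. f x + h x)" if "bd E f" "bd E h" for E f h
  proof -
    have "cut (\<lambda>x. f x + h x) = cut f + cut h" by (auto simp: cut_def)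
    then show ?thesis using that unfolding bd_def by (auto intro: vs.span_add)
  qed
  have mult_span: "(\<lambda>x. a x * b x) \<in> vs.span (M (E + E'))"
    if a: "a \<in> vs.span (M E)" and b: "b \<in> vs.span (M E')" for a b E E'
    using a
  proof (induction rule: vs.span_induct_alt)
    case base
    have "(\<lambda>x. (0 :: ('v \<Rightarrow> 'a) \<Rightarrow> 'a) x * b x) = 0" by auto
    then show ?case using vs.span_zero by metis
  next
    case (step c m y)
    obtain \<alpha> where \<alpha>: "m = mono \<alpha>" "\<And>v. v \<in> I \<Longrightarrow> \<alpha> v \<le> E" using step(1) unfolding M_def by (auto simp: PiE_iff)
    have "(\<lambda>x. m x * b x) \<in> vs.span (M (E + E'))"
      using b
    proof (induction rule: vs.span_induct_alt)
      case base
      have "(\<lambda>x. m x * (0 :: ('v \<Rightarrow> 'a) \<Rightarrow> 'a) x) = 0" by auto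
      then show ?case using vs.span_zero by metis
    next
      case (step c m' y)
      obtain \<beta> where \<beta>: "m' = mono \<beta>" "\<And>v. v \<in> I \<Longrightarrow> \<beta> v \<le> E'" using step(1) unfolding M_def by (auto simp: PiE_iff)
      have "(\<lambda>x. m x * (scale c m' + y) x) = scale c (mono (\<lambda>v. \<alpha> v + \<beta> v)) + (\<lambda>x. m x * y x)"
        by (auto simp: \<alpha> \<beta> mono_def scale_def fun_eq_iff power_add prod.distrib algebra_simps)
      moreover have "mono (\<lambda>v. \<alpha> v + \<beta> v) \<in> M (E + E')"
        using \<alpha> \<beta> by (intro mono_in add_mono) auto
      ultimately show ?case using step(2) by (auto intro: vs.span_add vs.span_scale vs.span_base)
    qed
    moreover have "(\<lambda>x. (scale c m + y) x * b x) = scale c (\<lambda>x. m x * b x) + (\<lambda>x. y x * b x)"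
      by (auto simp: scale_def fun_eq_iff algebra_simps)
    ultimately show ?case using step(2) by (auto intro: vs.span_add vs.span_scale)
  qed
  have bd_mult: "bd (E + E') (\<lambda>x. f x * h x)" if "bd E f" "bd E' h" for E E' f h
  proof -
    have "cut (\<lambda>x. f x * h x) = (\<lambda>x. cut f x * cut h x)" by (auto simp: cut_def)
    then show ?thesis using that mult_span unfolding bd_def by auto
  qed
  have bd_prod: "bd (card A * E) (\<lambda>x. \<Prod>i\<in>A. f i x)"
    if "finite A" "\<And>i. i \<in> A \<Longrightarrow> bd E (f i)" for A :: "(nat \<times> 'a) set" and f E
    using that
  proof (induction A rule: finite_induct)
    case empty
    then show ?case using bd_const[of 1] by simp
  next
    case (insert i A)
    then show ?case using bd_mult[of E "f i" "card A * E" "\<lambda>x. \<Prod>i\<in>A. f i x"] by simp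
  qed
  have bd_ex: "\<exists>E. bd E f" if "f \<in> polyfun" for f
    using that
  proof (induction f rule: polyfun.induct)
    case (pf_const c)
    then show ?case using bd_const by blast
  next
    case (pf_var v)
    show ?case
    proof (cases "v \<in> I")
      case True
      have "(\<Prod>u\<in>I. x u ^ (if u = v then 1 else 0)) = x v" for x :: "'v \<Rightarrow> 'a"
      proof -
        have "(\<Prod>u\<in>I. x u ^ (if u = v then 1 else 0)) = (\<Prod>u\<in>I. if u = v then x u else 1)"
          by (intro prod.cong) auto
        then show ?thesis using True I(1) by simp
      qed
      then have "cut (\<lambda>x. x v) = mono (\<lambda>u. if u = v then 1 else 0)"
        by (auto simp: cut_def mono_def fun_eq_iff)
      then have "bd 1 (\<lambda>x. x v)" unfolding bd_def using mono_in[of "\<lambda>u. if u = v then 1 else 0" 1]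
        by (auto intro: vs.span_base)
      then show ?thesis by blast
    next
      case False
      then have "cut (\<lambda>x. x v) = cut (\<lambda>x. 0)" by (auto simp: cut_def aff_def fun_eq_iff)
      then have "bd 0 (\<lambda>x. x v)" using bd_const[of 0] by (simp add: bd_def)
      then show ?thesis by blast
    qed
  next
    case (pf_add f h)
    then obtain E E' where "bd E f" "bd E' h" by blast
    then have "bd (max E E') f" "bd (max E E') h" using bd_mono by auto
    then show ?case using bd_add by blast
  next
    case (pf_mult f h)
    then show ?case using bd_mult by blast
  qed
  have "\<forall>i. \<exists>E. bd E (g i)" using bd_ex g(1) by blast
  then obtain Eg where Eg: "\<And>i. bd (Eg i) (g i)" by metis
  define e where "e = (\<Sum>i<d. Eg i)"
  have e: "bd e (g i)" if "i < d" for i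
    using bd_mono[OF Eg[of i]] that unfolding e_def
    by (meson finite_lessThan lessThan_iff member_le_sum zero_le)
  have key: "D ^ d \<le> Suc (d * (D * e)) ^ card I" for D
  proof -
    obtain A :: "'a set" where A: "finite A" "card A = D"
      using infinite_arbitrarily_large[OF inf] by blast
    define G where "G = ({..<d} \<rightarrow>\<^sub>E A)"
    have finG: "finite G" unfolding G_def by (intro finite_PiE) (auto simp: A)
    have cardG: "card G = D ^ d" unfolding G_def by (simp add: card_PiE A)
    \<comment> \<open>Numerators of the Lagrange basis on the grid \<open>G\<close>: nonzero at the
      grid point \<open>p\<close>, zero at all others. There are at most \<open>d * D\<close> linear
      factors, whence the degree bound \<open>d * (D * e)\<close> after substitution of
      \<open>g\<close>.\<close>
    define Lg :: "(nat \<Rightarrow> 'a) \<Rightarrow> (nat \<Rightarrow> 'a) \<Rightarrow> 'a" where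
      "Lg = (\<lambda>p y. \<Prod>(i, b)\<in>(SIGMA i:{..<d}. A - {p i}). y i - b)"
    define \<Phi> where "\<Phi> = (\<lambda>p. cut (\<lambda>x. Lg p (\<lambda>i. g i x)))"
    have Lg_poly: "Lg p \<in> polyfun" for p
      unfolding Lg_def case_prod_unfold by (intro polyfun_prod polyfun_minus polyfun.intros)
    have Lg_diag: "Lg p (restr {..<d} p) \<noteq> 0" if "p \<in> G" for p
      using A by (auto simp: Lg_def restr_def case_prod_unfold)
    have Lg_off: "Lg p (restr {..<d} q) = 0" if "p \<in> G" "q \<in> G" "p \<noteq> q" for p q
    proof -
      obtain i where i: "i < d" "p i \<noteq> q i" using \<open>p \<noteq> q\<close> \<open>p \<in> G\<close> \<open>q \<in> G\<close>
        unfolding G_def by (metis PiE_ext lessThan_iff)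
      have "q i \<in> A - {p i}" using that i unfolding G_def by auto
      then show ?thesis
        unfolding Lg_def using A i by (intro prod_zero) (auto simp: restr_def intro!: bexI[of _ "(i, q i)"])
    qed
    have \<Phi>_span: "\<Phi> p \<in> vs.span (M (d * (D * e)))" if "p \<in> G" for p
    proof -
      define S where "S = (SIGMA i:{..<d}. A - {p i})"
      have "bd e (\<lambda>x. g i x + (- b))" if "i < d" for i b
        using bd_add[OF e[OF that] bd_mono[OF bd_const[of "- b"]]] by simp
      then have "bd (card S * e) (\<lambda>x. \<Prod>ib\<in>S. g (fst ib) x - snd ib)"
        using A by (intro bd_prod) (auto simp: S_def)
      moreover have "card S \<le> card ({..<d} \<times> A)"
        using A by (intro card_mono) (auto simp: S_def)
      then have "card S * e \<le> d * (D * e)" using A by (simp add: card_cartesian_product mult.assoc[symmetric])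
      ultimately have "bd (d * (D * e)) (\<lambda>x. \<Prod>ib\<in>S. g (fst ib) x - snd ib)" using bd_mono by blast
      then show ?thesis by (simp add: bd_def \<Phi>_def Lg_def S_def case_prod_unfold)
    qed
    have lin: "c q = 0"
      if c: "(\<Sum>p\<in>G. scale (c p) (\<Phi> p)) = 0" and q: "q \<in> G" for c q
    proof -
      define P where "P = (\<lambda>y. \<Sum>p\<in>G. c p * Lg p y)"
      have P: "P \<in> polyfun"
        unfolding P_def by (intro polyfun_sum pf_mult pf_const Lg_poly)
      have Lr: "Lg p (restr {..<d} y) = Lg p y" for p y
        by (auto simp: Lg_def restr_def intro!: prod.cong)
      have "vanishes W (\<lambda>x. P (restr {..<d} (\<lambda>i. g i x)))"
        unfolding vanishes_def
      proof
        fix x assume "x \<in> W"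
        then have "x \<in> aff I" using I by blast
        have "0 = (\<Sum>p\<in>G. scale (c p) (\<Phi> p)) x" using c by simp
        also have "\<dots> = (\<Sum>p\<in>G. scale (c p) (\<Phi> p) x)" by (rule sum_fun_apply)
        also have "\<dots> = P (restr {..<d} (\<lambda>i. g i x))"
          using \<open>x \<in> aff I\<close> by (simp add: P_def Lr \<Phi>_def cut_def scale_def)
        finally show "P (restr {..<d} (\<lambda>i. g i x)) = 0" by simp
      qed
      then have "vanishes (aff {..<d}) P" using g(2) P unfolding indep_def by blast
      then have "P (restr {..<d} q) = 0" using restr_aff unfolding vanishes_def by blast
      moreover have "P (restr {..<d} q) = c q * Lg q (restr {..<d} q)"
      proof -
        have "P (restr {..<d} q) = (\<Sum>p\<in>{q}. c p * Lg p (restr {..<d} q))"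
          unfolding P_def using finG q Lg_off by (intro sum.mono_neutral_right) auto
        then show ?thesis by simp
      qed
      ultimately show "c q = 0" using Lg_diag[OF q] by simp
    qed
    have inj: "inj_on \<Phi> G"
    proof (rule inj_onI, rule ccontr)
      fix p q assume pq: "p \<in> G" "q \<in> G" "\<Phi> p = \<Phi> q" "p \<noteq> q"
      define c :: "(nat \<Rightarrow> 'a) \<Rightarrow> 'a" where "c = (\<lambda>r. if r = p then 1 else if r = q then - 1 else 0)"
      have "(\<Sum>r\<in>G. scale (c r) (\<Phi> r)) = (\<Sum>r\<in>{p,q}. scale (c r) (\<Phi> r))"
        using finG pq by (intro sum.mono_neutral_right) (auto simp: c_def scale_def fun_eq_iff)
      also have "\<dots> = 0" using pq by (auto simp: c_def scale_def fun_eq_iff)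
      finally have "c p = 0" using lin pq by blast
      then show False by (simp add: c_def)
    qed
    have "vs.independent (\<Phi> ` G)"
    proof
      assume "vs.dependent (\<Phi> ` G)"
      then obtain u x where u: "x \<in> \<Phi> ` G" "u x \<noteq> 0" "(\<Sum>x\<in>\<Phi> ` G. scale (u x) x) = 0"
        using vs.dependent_finite[of "\<Phi> ` G"] finG by blast
      then obtain p where p: "p \<in> G" "u (\<Phi> p) \<noteq> 0" by blast
      have "(\<Sum>p\<in>G. scale (u (\<Phi> p)) (\<Phi> p)) = (\<Sum>x\<in>\<Phi> ` G. scale (u x) x)"
        by (simp only: sum.reindex[OF inj] o_def)
      also note u(3)
      finally have "u (\<Phi> p) = 0" using p(1) by (rule lin)
      with p(2) show False by contradiction
    qed
    then have "card (\<Phi> ` G) \<le> card (M (d * (D * e)))"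
      using vs.independent_span_bound[OF finM, of "\<Phi> ` G"] \<Phi>_span by blast
    then show ?thesis using inj cardG cardM[of "d * (D * e)"] by (simp add: card_image)
  qed
  \<comment> \<open>As \<open>d\<close> exceeds \<open>card I\<close>, the left side of
    \<open>key\<close> has at least one factor \<open>D\<close> more than the right side can absorb;
    this \<open>D\<close> is larger than the constant \<open>Suc (d * e) ^ card I\<close> that
    remains.\<close>
  define D where "D = Suc (Suc (d * e) ^ card I)"
  have "D ^ Suc (card I) \<le> D ^ d" using dI by (intro power_increasing) (auto simp: D_def)
  also have "\<dots> \<le> Suc (d * (D * e)) ^ card I" by (rule key)
  also have "\<dots> \<le> (D * Suc (d * e)) ^ card I"
    by (intro power_mono) (auto simp: D_def algebra_simps)
  also have "\<dots> = D ^ card I * Suc (d * e) ^ card I" by (rule power_mult_distrib)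
  finally have "D * D ^ card I \<le> Suc (d * e) ^ card I * D ^ card I" by (simp add: mult.commute)
  moreover have "D ^ card I > 0" by (simp add: D_def)
  ultimately have "D \<le> Suc (d * e) ^ card I"
    using nat_mult_le_cancel_disj[of "D ^ card I" D "Suc (d * e) ^ card I"] by (simp only: mult.commute) simp
  then show False by (simp add: D_def)
qed

section \<open>Chains of irreducible closed sets\<close>

text \<open>A supremum in \<open>enat\<close> that is at least \<open>c\<close> is reached by a
  chain of length exactly \<open>c\<close>, because longer chains can be cut off; the constant chain
  covers \<open>c = 0\<close>.\<close>

lemma enat_le_codim_irr:
  assumes V: "zar_irreducible I V"
  shows "enat c \<le> codim_irr I V \<longleftrightarrow> (\<exists>ch. ch 0 = V \<and> (\<forall>i\<le>c. zar_irreducible I (ch i)) \<and>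
     (\<forall>i<c. ch i \<subset> ch (Suc i)))" (is "?L \<longleftrightarrow> ?P c")
proof
  assume "?P c"
  then show ?L unfolding codim_irr_def by (intro SUP_upper) simp
next
  assume L: ?L
  show "?P c"
  proof (rule ccontr)
    assume n: "\<not> ?P c"
    have "?P 0" by (rule exI[of _ "\<lambda>_. V"]) (simp add: V)
    with n have "c > 0" by (metis neq0_conv)
    have "c' \<le> c - 1" if "?P c'" for c'
    proof (rule ccontr)
      assume "\<not> c' \<le> c - 1"
      then have "c \<le> c'" by simp
      from that obtain ch where "ch 0 = V" "\<forall>i\<le>c'. zar_irreducible I (ch i)" "\<forall>i<c'. ch i \<subset> ch (Suc i)"
        by blast
      with \<open>c \<le> c'\<close> have "?P c" by (intro exI[of _ ch]) auto
      with n show False by blast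
    qed
    then have "codim_irr I V \<le> enat (c - 1)"
      unfolding codim_irr_def by (intro SUP_least) auto
    with L have "enat c \<le> enat (c - 1)" by (rule order_trans)
    with \<open>c > 0\<close> show False by simp
  qed
qed

lemma codim_irr_Suc:
  assumes "zar_irreducible I V" "zar_irreducible I W" "V \<subset> W" "enat c \<le> codim_irr I W"
  shows "enat (Suc c) \<le> codim_irr I V"
proof -
  obtain ch where ch: "ch 0 = W" "\<forall>i\<le>c. zar_irreducible I (ch i)" "\<forall>i<c. ch i \<subset> ch (Suc i)"
    using assms(4) unfolding enat_le_codim_irr[OF assms(2)] by blast
  show ?thesis
    unfolding enat_le_codim_irr[OF assms(1)]
    by (rule exI[of _ "case_nat V ch"]) (use ch assms in \<open>auto split: nat.split\<close>)
qed

text \<open>The chain starts at \<open>V\<close>, so the functions gained on the way up are added to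
  the \<open>d\<close> functions on \<open>V\<close>; the top still lies in \<open>aff I\<close>,
  where \<open>dim_ge_le_card\<close> bounds the total.\<close>

lemma codim_irr_le:
  fixes V :: "('v \<Rightarrow> 'a::field) set"
  assumes inf: "infinite (UNIV :: 'a set)" and I: "finite I"
    and V: "zar_irreducible I V" and d: "dim_ge V d" and c: "enat c \<le> codim_irr I V"
  shows "c + d \<le> card I"
proof -
  obtain ch where ch: "ch 0 = V" "\<forall>i\<le>c. zar_irreducible I (ch i)" "\<forall>i<c. ch i \<subset> ch (Suc i)"
    using c unfolding enat_le_codim_irr[OF V] by blast
  have "i \<le> c \<longrightarrow> dim_ge (ch i) (i + d)" for i
  proof (induction i)
    case 0
    then show ?case using ch d by simp
  next
    case (Suc i)
    show ?case
    proof
      assume i: "Suc i \<le> c"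
      then have irr: "zar_irreducible I (ch i)" "zar_irreducible I (ch (Suc i))" and sub: "ch i \<subset> ch (Suc i)"
        using ch by auto
      have sI: "ch (Suc i) \<subseteq> aff I" using irr zar_irreducible_iff zar_closed_sub by blast
      obtain x where x: "x \<in> ch (Suc i)" "x \<notin> ch i" using sub by blast
      then have "x \<notin> zcl I (ch i)" using irr zar_irreducible_iff zcl_closed by blast
      then obtain f where f: "f \<in> polyfun" "vanishes (ch i) f" "f x \<noteq> 0"
        using x sI unfolding zcl_def by blast
      have "dim_ge (ch (Suc i)) (Suc (i + d))"
      proof (rule dim_ge_Suc[of "ch i" _ _ f])
        show "dim_ge (ch i) (i + d)" using Suc i by simp
        show "irred (ch (Suc i))" using irr zar_irreducible_iff by blast
        show "\<not> vanishes (ch (Suc i)) f" using x f by (auto simp: vanishes_def)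
      qed (use sub f in auto)
      then show "dim_ge (ch (Suc i)) (Suc i + d)" by simp
    qed
  qed
  then have "dim_ge (ch c) (c + d)" by simp
  moreover have "ch c \<subseteq> aff I" using ch zar_irreducible_iff zar_closed_sub by blast
  ultimately show ?thesis using dim_ge_le_card[OF inf I] by blast
qed

section \<open>Cylinders over coordinate projections\<close>

text \<open>The preimage in \<open>aff I\<close> of the projection of \<open>V\<close> to the
  coordinates in \<open>L\<close>. For nonempty \<open>V\<close> inside \<open>aff I\<close> it
  interpolates between \<open>aff I\<close> (\<open>L\<close> empty) and \<open>V\<close>
  (\<open>L = I\<close>).\<close>

definition cyl :: "'v set \<Rightarrow> 'v set \<Rightarrow> ('v \<Rightarrow> 'a::field) set \<Rightarrow> ('v \<Rightarrow> 'a) set" where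
  "cyl I L V = {w \<in> aff I. \<exists>x\<in>V. \<forall>v\<in>L. w v = x v}"

text \<open>The coordinate \<open>v\<close> is algebraic on \<open>W\<close> over the coordinates in
  \<open>L\<close>. Nontriviality is asked at a point of \<open>W\<close>: a relation whose
  coefficients all vanish on \<open>W\<close> would say nothing about \<open>v\<close>.\<close>

definition alg_over :: "('v \<Rightarrow> 'a::field) set \<Rightarrow> 'v set \<Rightarrow> 'v \<Rightarrow> bool" where
  "alg_over W L v \<longleftrightarrow> (\<exists>n p. (\<forall>k. p k \<in> polyfun) \<and>
     (\<forall>k x y. (\<forall>u\<in>L. x u = y u) \<longrightarrow> p k x = p k y) \<and>
     (\<forall>x\<in>W. (\<Sum>k\<le>n. p k x * x v ^ k) = 0) \<and> (\<exists>x\<in>W. \<exists>k\<le>n. p k x \<noteq> 0))"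

lemma alg_over_mono: "alg_over W L v \<Longrightarrow> L \<subseteq> M \<Longrightarrow> alg_over W M v"
  unfolding alg_over_def by (elim exE conjE, intro exI conjI) (assumption | blast)+

lemma cyl_sub: "cyl I L V \<subseteq> aff I"
  by (auto simp: cyl_def)

lemma cyl_self:
  assumes "V \<subseteq> aff I"
  shows "cyl I I V = V"
proof -
  have "w = x" if "w \<in> aff I" "x \<in> V" "\<forall>v\<in>I. w v = x v" for w x
  proof (rule ext)
    fix v
    show "w v = x v" using that assms by (cases "v \<in> I") (auto simp: aff_def)
  qed
  then show ?thesis using assms by (auto simp: cyl_def)
qed

text \<open>A cylinder arises from \<open>aff I \<times> V\<close> by overwriting the coordinates in
  \<open>L\<close>, hence is a polynomial image of an irreducible product.\<close>

lemma irred_cyl: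
  fixes V :: "('v \<Rightarrow> 'a::field) set"
  assumes "infinite (UNIV :: 'a set)" "irred V" "V \<subseteq> aff I"
  shows "irred (cyl I L V)"
proof -
  define \<phi> :: "('v + 'v \<Rightarrow> 'a) \<Rightarrow> 'v \<Rightarrow> 'a" where
    "\<phi> = (\<lambda>z v. if v \<in> L then z (Inr v) else z (Inl v))"
  have "cyl I L V = \<phi> ` ((\<lambda>(x, y). case_sum x y) ` (aff I \<times> V))" (is "_ = ?R")
  proof
    show "cyl I L V \<subseteq> ?R"
    proof
      fix w assume "w \<in> cyl I L V"
      then obtain x where x: "w \<in> aff I" "x \<in> V" "\<forall>v\<in>L. w v = x v" by (auto simp: cyl_def)
      then have "w = \<phi> (case_sum w x)" by (auto simp: \<phi>_def fun_eq_iff)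
      with x show "w \<in> ?R" by auto
    qed
    show "?R \<subseteq> cyl I L V"
      using assms(3) by (auto simp: cyl_def \<phi>_def aff_def)
  qed
  moreover have "irred ?R"
  proof (rule irred_image)
    show "irred ((\<lambda>(x, y). case_sum x y) ` (aff I \<times> V))"
      by (intro irred_prod irred_aff assms)
    show "(\<lambda>z. \<phi> z v) \<in> polyfun" for v
      unfolding \<phi>_def by (intro polyfun_if pf_var)
  qed
  ultimately show ?thesis by simp
qed

text \<open>The relation for \<open>v\<close> vanishes on the cylinder that fixes \<open>v\<close>,
  but not on the one where \<open>v\<close> moves freely: at a point with a nonzero coefficient some
  value of \<open>v\<close> is not a root. So the smaller closure is a proper subset, and the chain
  grows at its bottom.\<close>

lemma codim_cyl_step:
  fixes V :: "('v \<Rightarrow> 'a::field) set"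
  assumes inf: "infinite (UNIV :: 'a set)" and V: "irred V" "V \<subseteq> aff I"
    and v: "v \<in> I" "v \<notin> L" and alg: "alg_over V L v"
    and c: "enat c \<le> codim_irr I (zcl I (cyl I L V))"
  shows "enat (Suc c) \<le> codim_irr I (zcl I (cyl I (insert v L) V))"
proof (rule codim_irr_Suc[OF _ _ _ c])
  have zi: "zar_irreducible I (zcl I (cyl I L V))" for L
    by (simp add: zar_irreducible_iff zar_closed_zcl irred_zcl[OF cyl_sub] irred_cyl[OF inf V])
  show "zar_irreducible I (zcl I (cyl I (insert v L) V))" "zar_irreducible I (zcl I (cyl I L V))"
    by (rule zi)+
  obtain n p where "\<forall>k. p k \<in> polyfun" "\<forall>k x y. (\<forall>u\<in>L. x u = y u) \<longrightarrow> p k x = p k y"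
     "\<forall>x\<in>V. (\<Sum>k\<le>n. p k x * x v ^ k) = 0" and ex: "\<exists>x\<in>V. \<exists>k\<le>n. p k x \<noteq> 0"
    using alg unfolding alg_over_def by (elim exE conjE)
  then have p: "\<And>k. p k \<in> polyfun"
     "\<And>k x y. (\<forall>u\<in>L. x u = y u) \<Longrightarrow> p k x = p k y"
     "\<And>x. x \<in> V \<Longrightarrow> (\<Sum>k\<le>n. p k x * x v ^ k) = 0" by simp_all
  define f where "f = (\<lambda>x. \<Sum>k\<le>n. p k x * x v ^ k)"
  have f: "f \<in> polyfun"
    unfolding f_def by (intro polyfun_sum pf_mult p polyfun_power pf_var)
  have "vanishes (cyl I (insert v L) V) f"
    unfolding vanishes_def
  proof
    fix w assume "w \<in> cyl I (insert v L) V"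
    then obtain x where x: "x \<in> V" "\<forall>u\<in>insert v L. w u = x u" by (auto simp: cyl_def)
    then have "p k w = p k x" for k by (intro p(2)) auto
    then show "f w = 0" using p(3)[OF x(1)] x(2) by (simp add: f_def)
  qed
  moreover have "\<not> vanishes (cyl I L V) f"
  proof -
    obtain x k where x: "x \<in> V" "k \<le> n" "p k x \<noteq> 0" using ex by blast
    obtain z where z: "(\<Sum>k\<le>n. p k x * z ^ k) \<noteq> 0"
      using ex_poly_nonzero[OF inf, of "\<lambda>k. p k x" k n] x by blast
    have "p k (x(v := z)) = p k x" for k
      using v(2) by (intro p(2)) auto
    then have "f (x(v := z)) \<noteq> 0" using z by (simp add: f_def)
    moreover have "x(v := z) \<in> cyl I L V"
      using x V v by (auto simp: cyl_def aff_def intro!: bexI[of _ x])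
    ultimately show ?thesis by (auto simp: vanishes_def)
  qed
  ultimately have "zcl I (cyl I (insert v L) V) \<noteq> zcl I (cyl I L V)"
    using vanishes_zcl[OF f cyl_sub] by metis
  moreover have "zcl I (cyl I (insert v L) V) \<subseteq> zcl I (cyl I L V)"
    by (rule zcl_least[OF zar_closed_zcl])
      (rule order_trans[OF _ zcl_superset[OF cyl_sub]], auto simp: cyl_def)
  ultimately show "zcl I (cyl I (insert v L) V) \<subset> zcl I (cyl I L V)" by blast
qed

lemma codim_cyl:
  fixes V :: "('v \<Rightarrow> 'a::field) set"
  assumes inf: "infinite (UNIV :: 'a set)" and V: "irred V" "V \<subseteq> aff I"
    and "finite A" "A \<subseteq> I" "A \<inter> L = {}" and alg: "\<And>v. v \<in> A \<Longrightarrow> alg_over V L v"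
    and c: "enat c \<le> codim_irr I (zcl I (cyl I L V))"
  shows "enat (card A + c) \<le> codim_irr I (zcl I (cyl I (A \<union> L) V))"
  using assms(4-7)
proof (induction A rule: finite_induct)
  case empty
  then show ?case using c by simp
next
  case (insert v A)
  have "enat (Suc (card A + c)) \<le> codim_irr I (zcl I (cyl I (insert v (A \<union> L)) V))"
  proof (rule codim_cyl_step[OF inf V])
    show "alg_over V (A \<union> L) v" using insert.prems alg_over_mono[of V L v "A \<union> L"] by auto
    show "enat (card A + c) \<le> codim_irr I (zcl I (cyl I (A \<union> L) V))"
      using insert by auto
  qed (use insert in auto)
  then show ?case using insert by simp
qed

text \<open>\<open>J\<close> is a maximal independent set of coordinates. Adding \<open>v\<close>
  destroys independence and so gives a relation; its expansion in powers of \<open>v\<close> has a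
  coefficient nonzero on \<open>aff J\<close>, and independence of \<open>J\<close> prevents that
  coefficient from vanishing on \<open>V\<close>.\<close>

lemma ex_coordinate_basis:
  fixes V :: "('v \<Rightarrow> 'a::field) set"
  assumes "V \<noteq> {}" "finite I"
  shows "\<exists>J\<subseteq>I. indep J (\<lambda>v x. x v) V \<and> (\<forall>v\<in>I - J. alg_over V J v)"
proof -
  define \<J> where "\<J> = {J. J \<subseteq> I \<and> indep J (\<lambda>v x. x v) V}"
  have "aff {} = {\<lambda>_. 0 :: 'a}" by (auto simp: aff_def)
  then have "indep {} (\<lambda>v x. x v) V"
    using assms(1) by (auto simp: indep_def vanishes_def restr_def)
  then have "{} \<in> \<J>" unfolding \<J>_def by simp
  moreover have "finite \<J>" unfolding \<J>_def using assms(2) by simp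
  ultimately obtain J where J: "J \<in> \<J>" and max: "\<And>J'. J' \<in> \<J> \<Longrightarrow> J \<subseteq> J' \<Longrightarrow> J = J'"
    using finite_has_maximal[of \<J>] by blast
  have "alg_over V J v" if v: "v \<in> I - J" for v
  proof -
    have "insert v J \<notin> \<J>" using max v by blast
    then have "\<not> indep (insert v J) (\<lambda>v x. x v) V" using J v unfolding \<J>_def by blast
    then obtain P where P: "P \<in> polyfun" "vanishes V (\<lambda>x. P (restr (insert v J) (\<lambda>u. x u)))"
      "\<not> vanishes (aff (insert v J)) P"
      unfolding indep_def by blast
    obtain n p where p: "\<And>k. p k \<in> polyfun" "\<And>k x z. p k (x(v := z)) = p k x"
      "\<And>x. P x = (\<Sum>k\<le>n. p k x * x v ^ k)"
      using polyfun_expand[OF P(1), of v] by blast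
    have p_restr: "p k (restr (insert v J) y) = p k (restr J y)" for k y
    proof -
      have "(restr (insert v J) y)(v := 0) = restr J y"
        using v by (auto simp: restr_def fun_eq_iff)
      then show ?thesis using p(2)[of k "restr (insert v J) y" 0] by simp
    qed
    obtain y where y: "y \<in> aff (insert v J)" "P y \<noteq> 0" using P(3) by (auto simp: vanishes_def)
    then obtain k where k: "k \<le> n" "p k y \<noteq> 0"
      by (metis (no_types, lifting) atMost_iff mult_zero_left p(3) sum.neutral)
    then have "p k (restr J y) \<noteq> 0" using p_restr[of k y] restr_id[OF y(1)] by simp
    then have "\<not> vanishes (aff J) (p k)" using restr_aff by (auto simp: vanishes_def)
    then have nv: "\<not> vanishes V (\<lambda>x. p k (restr J (\<lambda>u. x u)))"
      using J p(1) unfolding \<J>_def indep_def by blast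
    define q where "q = (\<lambda>k x. p k (restr J x))"
    show ?thesis
      unfolding alg_over_def
    proof (intro exI conjI allI ballI impI)
      show "q k \<in> polyfun" for k unfolding q_def by (rule polyfun_restr[OF p(1)])
      show "q k x = q k y" if "\<forall>u\<in>J. x u = y u" for k x y
        using that by (auto simp: q_def restr_def intro!: arg_cong[of _ _ "p k"])
      show "(\<Sum>k\<le>n. q k x * x v ^ k) = 0" if "x \<in> V" for x
        using P(2) that unfolding vanishes_def p(3) q_def p_restr by (simp add: restr_def)
      show "\<exists>x\<in>V. \<exists>k\<le>n. q k x \<noteq> 0" using nv k unfolding vanishes_def q_def by blast
    qed
  qed
  then show ?thesis using J unfolding \<J>_def by blast
qed

section \<open>Irreducible components and the codimension criterion\<close>

text \<open>The upper bound of a chain is the closure of its union. The union is irreducible: if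
  \<open>f\<close> and \<open>g\<close> do not vanish on two members of the chain, neither vanishes
  on the larger one.\<close>

lemma ex_irr_component:
  assumes Z: "zar_closed I Z" and V: "zar_irreducible I V" "V \<subseteq> Z"
  shows "\<exists>W\<in>irr_components I Z. V \<subseteq> W"
proof -
  define \<A> where "\<A> = {W. zar_irreducible I W \<and> V \<subseteq> W \<and> W \<subseteq> Z}"
  have "\<exists>M\<in>\<A>. \<forall>X\<in>\<A>. M \<subseteq> X \<longrightarrow> X = M"
  proof (rule subset_Zorn)
    fix \<C> assume chain: "subset.chain \<A> \<C>"
    show "\<exists>U\<in>\<A>. \<forall>X\<in>\<C>. X \<subseteq> U"
    proof (cases "\<C> = {}")
      case True
      then show ?thesis using V unfolding \<A>_def by blast
    next
      case False
      then have C: "\<C> \<noteq> {}" "subset.chain \<A> \<C>" using chain by simp_all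
      then have CA: "\<And>X. X \<in> \<C> \<Longrightarrow> X \<in> \<A>" and lin: "\<And>X Y. X \<in> \<C> \<Longrightarrow> Y \<in> \<C> \<Longrightarrow> X \<subseteq> Y \<or> Y \<subseteq> X"
        by (auto simp: subset.chain_def)
      have sub: "\<Union>\<C> \<subseteq> aff I" "\<Union>\<C> \<subseteq> Z"
        using CA Z zar_closed_sub unfolding \<A>_def by blast+
      have "irred (\<Union>\<C>)"
        unfolding irred_def
      proof (intro conjI ballI impI)
        show "\<Union>\<C> \<noteq> {}"
          using C(1) CA unfolding \<A>_def zar_irreducible_def by blast
        fix f g assume fg: "f \<in> polyfun" "g \<in> polyfun" "vanishes (\<Union>\<C>) (\<lambda>x. f x * g x)"
        have pr: "vanishes X f \<or> vanishes X g" if "X \<in> \<C>" for X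
          using irredD[of X f g] CA[OF that] fg that unfolding \<A>_def zar_irreducible_iff
          by (auto simp: vanishes_def)
        show "vanishes (\<Union>\<C>) f \<or> vanishes (\<Union>\<C>) g"
        proof (rule ccontr)
          assume "\<not> ?thesis"
          then obtain X Y where XY: "X \<in> \<C>" "Y \<in> \<C>" "\<not> vanishes X f" "\<not> vanishes Y g"
            by (auto simp: vanishes_def)
          then show False using lin[OF XY(1,2)] pr[OF XY(1)] pr[OF XY(2)]
            by (auto simp: vanishes_def)
        qed
      qed
      then have "zcl I (\<Union>\<C>) \<in> \<A>"
        unfolding \<A>_def using irred_zcl[OF sub(1)] zar_closed_zcl zcl_least[OF Z sub(2)] zcl_superset[OF sub(1)]
          C(1) CA unfolding \<A>_def zar_irreducible_iff by blast
      then show ?thesis using zcl_superset[OF sub(1)] by blast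
    qed
  qed
  then obtain M where M: "M \<in> \<A>" "\<forall>X\<in>\<A>. M \<subseteq> X \<longrightarrow> X = M" by blast
  then have "M \<in> irr_components I Z" unfolding irr_components_def \<A>_def by blast
  with M show ?thesis unfolding \<A>_def by blast
qed

text \<open>From left to right \<open>V\<close> is a component and \<open>d\<close> the size of a
  coordinate basis; from right to left the closure of \<open>V\<close> is enlarged to a component.
  An empty \<open>Z\<close> fits in, as the infimum over no components is infinite.\<close>

theorem codim_le_iff:
  fixes Z :: "('v \<Rightarrow> 'a::field) set"
  assumes inf: "infinite (UNIV :: 'a set)" and I: "finite I" and Z: "zar_closed I Z"
  shows "codim I Z \<le> enat c \<longleftrightarrow> (\<exists>V d. V \<subseteq> Z \<and> irred V \<and> dim_ge V d \<and> card I \<le> d + c)"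
proof
  assume L: "codim I Z \<le> enat c"
  \<comment> \<open>Codimensions lie in the well-ordered \<open>enat\<close>: if each of them
    exceeded \<open>c\<close>, so would the infimum.\<close>
  have "\<exists>V\<in>irr_components I Z. codim_irr I V \<le> enat c"
  proof (rule ccontr)
    assume "\<not> ?thesis"
    then have "codim_irr I V \<ge> enat (Suc c)" if "V \<in> irr_components I Z" for V
      using that by (metis Suc_ile_eq not_le)
    then have "enat (Suc c) \<le> codim I Z" unfolding codim_def by (rule INF_greatest)
    with L have "enat (Suc c) \<le> enat c" by (rule order_trans[rotated])
    then show False by simp
  qed
  then obtain V where V: "V \<subseteq> Z" "zar_irreducible I V" "codim_irr I V \<le> enat c"
    unfolding irr_components_def by blast
  then have irr: "irred V" and sub: "V \<subseteq> aff I" and cl: "zcl I V = V"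
    using zar_irreducible_iff zar_closed_sub zcl_closed by blast+
  obtain J where J: "J \<subseteq> I" "indep J (\<lambda>v x. x v) V" "\<forall>v\<in>I - J. alg_over V J v"
    using ex_coordinate_basis[of V I] irr I unfolding irred_def by blast
  have d: "dim_ge V (card J)"
    using J I finite_subset by (intro dim_geI[of J "\<lambda>v x. x v"] pf_var) auto
  \<comment> \<open>Starting from the trivial bound 0 for the cylinder over \<open>J\<close>, the
    remaining coordinates are added until the cylinder is \<open>V\<close> itself.\<close>
  have "enat (card (I - J) + 0) \<le> codim_irr I (zcl I (cyl I ((I - J) \<union> J) V))"
    using J I by (intro codim_cyl[OF inf irr sub]) (auto simp: zero_enat_def[symmetric])
  then have "enat (card (I - J)) \<le> codim_irr I V"
    using J(1) by (simp add: Un_absorb2 cyl_self[OF sub] cl)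
  then have "enat (card (I - J)) \<le> enat c" using V(3) by (rule order_trans)
  then have "card I \<le> card J + c"
    using J(1) I by (simp add: card_Diff_subset finite_subset)
  with V irr d show "\<exists>V d. V \<subseteq> Z \<and> irred V \<and> dim_ge V d \<and> card I \<le> d + c" by blast
next
  assume "\<exists>V d. V \<subseteq> Z \<and> irred V \<and> dim_ge V d \<and> card I \<le> d + c"
  then obtain V d where V: "V \<subseteq> Z" "irred V" "dim_ge V d" "card I \<le> d + c" by blast
  have sub: "V \<subseteq> aff I" using V(1) Z zar_closed_sub by blast
  obtain W where W: "W \<in> irr_components I Z" "zcl I V \<subseteq> W"
    using ex_irr_component[OF Z, of "zcl I V"] irred_zcl[OF sub] V zar_closed_zcl zcl_least[OF Z V(1)]
    unfolding zar_irreducible_iff by blast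
  then have Wirr: "zar_irreducible I W" unfolding irr_components_def by blast
  have "dim_ge W d" using dim_ge_mono[OF V(3)] W(2) zcl_superset[OF sub] by blast
  have "codim_irr I W \<le> enat c"
  proof (rule ccontr)
    assume "\<not> ?thesis"
    then have "enat (Suc c) \<le> codim_irr I W" by (metis Suc_ile_eq not_le)
    from codim_irr_le[OF inf I Wirr \<open>dim_ge W d\<close> this] V(4) show False by simp
  qed
  then show "codim I Z \<le> enat c"
    unfolding codim_def using W(1) by (meson INF_lower order_trans)
qed

section \<open>Dimension of images and of fibrations\<close>

lemma alg_over_vimage:
  fixes \<theta> :: "('v \<Rightarrow> 'a::field) \<Rightarrow> 'w \<Rightarrow> 'a"
  assumes "alg_over (\<theta> ` V) J u"
  shows "alg_over ((\<lambda>x. case_sum x (\<theta> x)) ` V) (Inr ` J) (Inr u)"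
proof -
  obtain n p where "\<forall>k. p k \<in> polyfun" "\<forall>k x y. (\<forall>u\<in>J. x u = y u) \<longrightarrow> p k x = p k y"
    and p': "\<forall>x\<in>\<theta> ` V. (\<Sum>k\<le>n. p k x * x u ^ k) = 0" "\<exists>x\<in>\<theta> ` V. \<exists>k\<le>n. p k x \<noteq> 0"
    using assms unfolding alg_over_def by (elim exE conjE)
  then have p: "\<And>k. p k \<in> polyfun" "\<And>k x y. (\<forall>u\<in>J. x u = y u) \<Longrightarrow> p k x = p k y"
    by simp_all
  show ?thesis
    unfolding alg_over_def
  proof (intro exI conjI allI impI)
    show "(\<lambda>z. p k (\<lambda>w. z (Inr w))) \<in> polyfun" for k
      by (rule polyfun_subst[OF p(1), of "\<lambda>z w. z (Inr w)"]) (rule pf_var)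
    show "p k (\<lambda>w. x (Inr w)) = p k (\<lambda>w. y (Inr w))" if "\<forall>u\<in>Inr ` J. x u = y u"
      for k and x y :: "'v + 'w \<Rightarrow> 'a"
      using that by (intro p(2)) auto
    show "\<forall>x\<in>(\<lambda>x. case_sum x (\<theta> x)) ` V. (\<Sum>k\<le>n. p k (\<lambda>w. x (Inr w)) * x (Inr u) ^ k) = 0"
      using p'(1) by simp
    show "\<exists>x\<in>(\<lambda>x. case_sum x (\<theta> x)) ` V. \<exists>k\<le>n. p k (\<lambda>w. x (Inr w)) \<noteq> 0"
      using p'(2) by simp
  qed
qed

text \<open>Membership of \<open>g\<close>, as a function on \<open>V\<close>, in the ring generated
  by the coordinates in \<open>K\<close> and the components of \<theta>, localized at
  \<open>q\<close>. Keeping the denominator as a factor on the left stays within polynomial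
  functions.\<close>

definition rat_fun :: "('v \<Rightarrow> 'a::field) set \<Rightarrow> (('v \<Rightarrow> 'a) \<Rightarrow> 'a) \<Rightarrow> 'v set \<Rightarrow> (('v \<Rightarrow> 'a) \<Rightarrow> 'w \<Rightarrow> 'a) \<Rightarrow>
    (('v \<Rightarrow> 'a) \<Rightarrow> 'a) \<Rightarrow> bool" where
  "rat_fun V q K \<theta> g \<longleftrightarrow>
     (\<exists>N f. f \<in> polyfun \<and> (\<forall>x\<in>V. q x ^ N * g x = f (case_sum (restr K x) (\<theta> x))))"

lemma rat_funI:
  "f \<in> polyfun \<Longrightarrow> (\<And>x. x \<in> V \<Longrightarrow> q x ^ N * g x = f (case_sum (restr K x) (\<theta> x))) \<Longrightarrow> rat_fun V q K \<theta> g"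
  unfolding rat_fun_def by blast

lemma rat_fun_cong: "rat_fun V q K \<theta> f \<Longrightarrow> (\<And>x. x \<in> V \<Longrightarrow> f x = g x) \<Longrightarrow> rat_fun V q K \<theta> g"
  unfolding rat_fun_def by simp

lemma rat_fun_const: "rat_fun V q K \<theta> (\<lambda>x. c)"
  by (rule rat_funI[OF pf_const[of c], where N = 0]) simp

lemma rat_fun_coord: "v \<in> K \<Longrightarrow> rat_fun V q K \<theta> (\<lambda>x. x v)"
  by (rule rat_funI[OF pf_var[of "Inl v"], where N = 0]) (simp add: restr_def)

lemma rat_fun_map: "rat_fun V q K \<theta> (\<lambda>x. \<theta> x w)"
  by (rule rat_funI[OF pf_var[of "Inr w"], where N = 0]) simp

lemma rat_fun_mult:
  assumes "rat_fun V q K \<theta> f" "rat_fun V q K \<theta> g"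
  shows "rat_fun V q K \<theta> (\<lambda>x. f x * g x)"
proof -
  obtain N h N' h' where h: "h \<in> polyfun" "\<forall>x\<in>V. q x ^ N * f x = h (case_sum (restr K x) (\<theta> x))"
    "h' \<in> polyfun" "\<forall>x\<in>V. q x ^ N' * g x = h' (case_sum (restr K x) (\<theta> x))"
    using assms unfolding rat_fun_def by (elim exE conjE)
  show ?thesis
  proof (rule rat_funI[OF pf_mult[OF h(1,3)], where N = "N + N'"])
    fix x assume "x \<in> V"
    then have "h (case_sum (restr K x) (\<theta> x)) * h' (case_sum (restr K x) (\<theta> x)) =
        (q x ^ N * f x) * (q x ^ N' * g x)" using h by simp
    then show "q x ^ (N + N') * (f x * g x) =
        h (case_sum (restr K x) (\<theta> x)) * h' (case_sum (restr K x) (\<theta> x))"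
      by (simp add: power_add algebra_simps)
  qed
qed

lemma rat_fun_cancel: "rat_fun V q K \<theta> (\<lambda>x. q x * g x) \<Longrightarrow> rat_fun V q K \<theta> g"
proof -
  assume "rat_fun V q K \<theta> (\<lambda>x. q x * g x)"
  then obtain N h where h: "h \<in> polyfun" "\<forall>x\<in>V. q x ^ N * (q x * g x) = h (case_sum (restr K x) (\<theta> x))"
    unfolding rat_fun_def by (elim exE conjE)
  show ?thesis
    by (rule rat_funI[OF h(1), where N = "Suc N"]) (use h in \<open>simp add: mult.left_commute mult.assoc\<close>)
qed

text \<open>A common denominator multiplies the numerators by powers of \<open>q\<close>; these are
  admissible because \<open>q\<close> involves the coordinates in \<open>K\<close> only.\<close>

lemma rat_fun_add:
  fixes \<theta> :: "('v \<Rightarrow> 'a::field) \<Rightarrow> 'w \<Rightarrow> 'a"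
  assumes q: "q \<in> polyfun" "\<And>x y. (\<forall>v\<in>K. x v = y v) \<Longrightarrow> q x = q y"
    and "rat_fun V q K \<theta> f" "rat_fun V q K \<theta> g"
  shows "rat_fun V q K \<theta> (\<lambda>x. f x + g x)"
proof -
  obtain N h N' h' where h: "h \<in> polyfun" "\<forall>x\<in>V. q x ^ N * f x = h (case_sum (restr K x) (\<theta> x))"
    "h' \<in> polyfun" "\<forall>x\<in>V. q x ^ N' * g x = h' (case_sum (restr K x) (\<theta> x))"
    using assms(3,4) unfolding rat_fun_def by (elim exE conjE)
  define qP where "qP = (\<lambda>w :: 'v + 'w \<Rightarrow> 'a. q (\<lambda>v. w (Inl v)))"
  have qP: "qP \<in> polyfun"
    unfolding qP_def by (rule polyfun_subst[OF q(1), of "\<lambda>w v. w (Inl v)"]) (rule pf_var)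
  have k: "(\<lambda>w. qP w ^ N' * h w + qP w ^ N * h' w) \<in> polyfun"
    by (intro pf_add pf_mult polyfun_power qP h)
  show ?thesis
  proof (rule rat_funI[OF k, where N = "N + N'"])
    fix x assume x: "x \<in> V"
    have "qP (case_sum (restr K x) (\<theta> x)) = q x"
      unfolding qP_def sum.case(1) by (rule q(2)) (simp add: restr_def)
    then have "qP (case_sum (restr K x) (\<theta> x)) ^ N' * h (case_sum (restr K x) (\<theta> x)) +
        qP (case_sum (restr K x) (\<theta> x)) ^ N * h' (case_sum (restr K x) (\<theta> x)) =
        q x ^ N' * (q x ^ N * f x) + q x ^ N * (q x ^ N' * g x)"
      using h x by simp
    then show "q x ^ (N + N') * (f x + g x) =
        qP (case_sum (restr K x) (\<theta> x)) ^ N' * h (case_sum (restr K x) (\<theta> x)) +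
        qP (case_sum (restr K x) (\<theta> x)) ^ N * h' (case_sum (restr K x) (\<theta> x))"
      by (simp add: power_add algebra_simps)
  qed
qed

lemma rat_fun_sum:
  assumes q: "q \<in> polyfun" "\<And>x y. (\<forall>v\<in>K. x v = y v) \<Longrightarrow> q x = q y"
    and "\<And>i. i \<in> A \<Longrightarrow> rat_fun V q K \<theta> (f i)"
  shows "rat_fun V q K \<theta> (\<lambda>x. \<Sum>i\<in>A. f i x)"
  using assms(3)
  by (induction A rule: infinite_finite_induct) (auto intro: rat_fun_const rat_fun_add[OF q])

lemma dim_ge_0:
  fixes V :: "('a \<Rightarrow> 'b::field) set"
  assumes "V \<noteq> {}"
  shows "dim_ge V 0"
proof -
  have "aff {} = {\<lambda>_. 0 :: 'b}" by (auto simp: aff_def)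
  then have "indep {} (\<lambda>i x. 0) V"
    using assms by (auto simp: indep_def vanishes_def restr_def)
  then show ?thesis
    unfolding dim_ge_def by (intro exI[of _ "\<lambda>i x. 0"]) (simp add: polyfun.intros)
qed

lemma dim_ge_open:
  fixes V :: "('a \<Rightarrow> 'b::field) set"
  assumes "irred V" "q \<in> polyfun" "\<not> vanishes V q" "dim_ge V d"
  shows "dim_ge {x \<in> V. q x \<noteq> 0} d"
proof -
  obtain g where g: "\<And>i. g i \<in> polyfun" "indep {..<d} g V"
    using assms(4) unfolding dim_ge_def by blast
  have "indep {..<d} g {x \<in> V. q x \<noteq> 0}"
    unfolding indep_def
  proof (intro ballI impI)
    fix P :: "(nat \<Rightarrow> 'b) \<Rightarrow> 'b"
    assume P: "P \<in> polyfun" "vanishes {x \<in> V. q x \<noteq> 0} (\<lambda>x. P (restr {..<d} (\<lambda>j. g j x)))"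
    have "(\<lambda>x. P (restr {..<d} (\<lambda>j. g j x))) \<in> polyfun"
      by (rule polyfun_subst[OF P(1)]) (intro polyfun_restr_family g)
    with P(2) have "vanishes V (\<lambda>x. P (restr {..<d} (\<lambda>j. g j x)))"
      using irred_open(2)[OF assms(1-3)] by simp
    then show "vanishes (aff {..<d}) P"
      using bspec[OF g(2)[unfolded indep_def] P(1)] by simp
  qed
  then show ?thesis unfolding dim_ge_def by (intro exI[of _ g]) (simp add: g)
qed

text \<open>Half of the fibre dimension theorem, for a map whose image point together with the
  coordinates in \<open>K\<close> determines \<open>x\<close> rationally. On the graph
  \<open>W\<close>, a chain of cylinders first adds the coordinates in \<open>I' - J\<close>,
  algebraic over the basis \<open>J\<close> of the image, then those in \<open>I - K\<close>,
  algebraic by the recovery formulas. With \<open>codim_irr_le\<close> its length gives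
  \<open>d \<le> card J + card K\<close>.\<close>

lemma dim_ge_image:
  fixes V :: "('v \<Rightarrow> 'a::field) set" and \<theta> :: "('v \<Rightarrow> 'a) \<Rightarrow> 'w \<Rightarrow> 'a"
  assumes inf: "infinite (UNIV :: 'a set)" and I: "finite I" "finite I'"
    and V: "irred V" "V \<subseteq> aff I"
    and \<theta>: "\<And>i. (\<lambda>x. \<theta> x i) \<in> polyfun" "\<And>x. x \<in> V \<Longrightarrow> \<theta> x \<in> aff I'"
    and K: "K \<subseteq> I" and q: "q \<in> polyfun" "\<And>x y. (\<forall>v\<in>K. x v = y v) \<Longrightarrow> q x = q y"
      "\<exists>x\<in>V. q x \<noteq> 0"
    and rat: "\<And>v. v \<in> I \<Longrightarrow> rat_fun V q K \<theta> (\<lambda>x. x v)"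
    and d: "dim_ge V d"
  shows "\<exists>d'. dim_ge (\<theta> ` V) d' \<and> d \<le> d' + card K"
proof -
  define \<Phi> where "\<Phi> = (\<lambda>x. case_sum x (\<theta> x))"
  define W where "W = \<Phi> ` V"
  define II :: "('v + 'w) set" where "II = Inl ` I \<union> Inr ` I'"
  have II: "finite II" using I by (simp add: II_def)
  have cardII: "card II = card I + card I'"
    unfolding II_def using I by (subst card_Un_disjoint) (auto simp: card_image)
  have WI: "W \<subseteq> aff II"
  proof -
    have "\<Phi> x \<in> aff II" if "x \<in> V" for x
      using V(2) \<theta>(2)[OF that] that by (auto simp: \<Phi>_def II_def aff_def split: sum.split)
    then show ?thesis by (auto simp: W_def)
  qed
  have \<Phi>: "(\<lambda>x. \<Phi> x i) \<in> polyfun" for i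
    unfolding \<Phi>_def using \<theta>(1) by (cases i) (simp_all add: pf_var)
  have irrW: "irred W" unfolding W_def by (rule irred_image[OF V(1) \<Phi>])
  have dW: "dim_ge W d"
  proof -
    obtain g where g: "\<And>i. g i \<in> polyfun" "indep {..<d} g V"
      using d unfolding dim_ge_def by blast
    define G where "G = (\<lambda>i z. g i (\<lambda>v. (z :: 'v + 'w \<Rightarrow> 'a) (Inl v)))"
    have "G i \<in> polyfun" for i
      unfolding G_def by (rule polyfun_subst[OF g(1), of "\<lambda>z v. z (Inl v)"]) (rule pf_var)
    moreover have "indep {..<d} G W"
    proof -
      have "G i (\<Phi> x) = g i x" for i x by (simp add: G_def \<Phi>_def)
      then have "vanishes W (\<lambda>z. P (restr {..<d} (\<lambda>i. G i z))) \<longleftrightarrow>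
          vanishes V (\<lambda>x. P (restr {..<d} (\<lambda>i. g i x)))" for P
        by (simp add: vanishes_def W_def)
      with g(2) show ?thesis by (simp add: indep_def)
    qed
    ultimately show ?thesis unfolding dim_ge_def by (intro exI[of _ G]) simp
  qed
  have ne: "\<theta> ` V \<noteq> {}" using V(1) by (auto simp: irred_def)
  then obtain J where J: "J \<subseteq> I'" "indep J (\<lambda>v x. x v) (\<theta> ` V)" "\<forall>v\<in>I' - J. alg_over (\<theta> ` V) J v"
    using ex_coordinate_basis[OF ne I(2)] by (elim exE conjE)
  have finJ: "finite J" using J I finite_subset by blast
  have dJ: "dim_ge (\<theta> ` V) (card J)"
    using J finJ by (intro dim_geI[of J "\<lambda>v x. x v"] pf_var) auto
  define L0 :: "('v + 'w) set" where "L0 = Inl ` K \<union> Inr ` J"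
  define L1 :: "('v + 'w) set" where "L1 = Inl ` K \<union> Inr ` I'"
  define A1 :: "('v + 'w) set" where "A1 = Inr ` (I' - J)"
  define A2 :: "('v + 'w) set" where "A2 = Inl ` (I - K)"
  have alg1: "alg_over W L0 v" if v: "v \<in> A1" for v
  proof -
    obtain u where u: "u \<in> I' - J" "v = Inr u" using v unfolding A1_def by blast
    then have "alg_over W (Inr ` J) v"
      unfolding W_def \<Phi>_def u(2) using J(3) by (intro alg_over_vimage) blast
    then show ?thesis by (rule alg_over_mono) (simp add: L0_def)
  qed
  have alg2: "alg_over W L1 v" if v: "v \<in> A2" for v
  proof -
    obtain u where u: "u \<in> I - K" "v = Inl u" using v unfolding A2_def by blast
    then obtain N f where f: "f \<in> polyfun"
      "\<And>x. x \<in> V \<Longrightarrow> q x ^ N * x u = f (case_sum (restr K x) (\<theta> x))"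
      using rat[of u] unfolding rat_fun_def by blast
    \<comment> \<open>\<open>f\<close> receives its arguments with everything outside
      \<open>K\<close> and \<open>I'\<close> set to zero, so that the coefficients see only the
      coordinates in \<open>L1\<close>; on the graph this gives the arguments of the recovery
      formula, as \<theta> maps into \<open>aff I'\<close>.\<close>
    define r where "r = (\<lambda>z :: 'v + 'w \<Rightarrow> 'a. case_sum (restr K (\<lambda>v. z (Inl v))) (restr I' (\<lambda>w. z (Inr w))))"
    have r: "(\<lambda>z. r z i) \<in> polyfun" for i
      unfolding r_def by (cases i) (simp_all add: polyfun_restr_family pf_var)
    \<comment> \<open>The recovery formula read as a relation of degree one in the coordinate
      \<open>u\<close>: constant term \<open>- f\<close>, leading coefficient
      \<open>q ^ N\<close>.\<close>
    define p where "p = (\<lambda>k z. if k = (0::nat) then (- 1) * f (r z) else q (\<lambda>v. z (Inl v)) ^ N)"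
    have r\<Phi>: "r (\<Phi> x) = case_sum (restr K x) (\<theta> x)" if "x \<in> V" for x
      using restr_id[OF \<theta>(2)[OF that]] by (simp add: r_def \<Phi>_def)
    show ?thesis
      unfolding alg_over_def
    proof (intro exI conjI allI impI)
      show "p k \<in> polyfun" for k
        unfolding p_def
        by (intro polyfun_if pf_mult pf_const polyfun_power polyfun_subst[OF f(1) r]
            polyfun_subst[OF q(1), of "\<lambda>z v. z (Inl v)"] pf_var)
      show "p k x = p k y" if *: "\<forall>u\<in>L1. x u = y u" for k x y
      proof -
        have "r x = r y" using * by (auto simp: r_def L1_def restr_def split: sum.split)
        moreover have "q (\<lambda>v. x (Inl v)) = q (\<lambda>v. y (Inl v))"
          using * by (intro q(2)) (auto simp: L1_def)
        ultimately show ?thesis by (simp add: p_def)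
      qed
      show "\<forall>x\<in>W. (\<Sum>k\<le>1. p k x * x v ^ k) = 0"
      proof
        fix w assume "w \<in> W"
        then obtain x where x: "x \<in> V" "w = \<Phi> x" unfolding W_def by blast
        then show "(\<Sum>k\<le>1. p k w * w v ^ k) = 0"
          using f(2)[OF x(1)] r\<Phi>[OF x(1)] u(2) by (simp add: p_def) (simp add: \<Phi>_def)
      qed
      obtain x where x: "x \<in> V" "q x \<noteq> 0" using q(3) by blast
      then have "p 1 (\<Phi> x) \<noteq> 0" by (simp add: p_def \<Phi>_def)
      then show "\<exists>x\<in>W. \<exists>k\<le>1. p k x \<noteq> 0" using x unfolding W_def by blast
    qed
  qed
  have c1: "enat (card A1 + 0) \<le> codim_irr II (zcl II (cyl II (A1 \<union> L0) W))"
    using alg1 I by (intro codim_cyl[OF inf irrW WI])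
      (auto simp: A1_def II_def L0_def zero_enat_def[symmetric])
  have "A1 \<union> L0 = L1" using J by (auto simp: A1_def L0_def L1_def)
  with c1 have "enat (card A2 + (card A1 + 0)) \<le> codim_irr II (zcl II (cyl II (A2 \<union> L1) W))"
    using alg2 I by (intro codim_cyl[OF inf irrW WI]) (auto simp: A2_def II_def L1_def)
  moreover have "A2 \<union> L1 = II" using K by (auto simp: A2_def L1_def II_def)
  ultimately have c2: "enat (card A2 + card A1) \<le> codim_irr II (zcl II W)"
    by (simp add: cyl_self[OF WI])
  have "zar_irreducible II (zcl II W)"
    unfolding zar_irreducible_iff using zar_closed_zcl irred_zcl[OF WI] irrW by blast
  from codim_irr_le[OF inf II this dim_ge_mono[OF dW zcl_superset[OF WI]] c2]
  have "card A2 + card A1 + d \<le> card II" .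
  moreover have "card A2 + card K = card I"
    using K I finite_subset[OF K I(1)]
    by (simp add: A2_def card_image card_Diff_subset card_mono)
  moreover have "card A1 + card J = card I'"
    using J I finJ by (simp add: A1_def card_image card_Diff_subset card_mono)
  ultimately have "d \<le> card J + card K" unfolding cardII by linarith
  with dJ show ?thesis by blast
qed

text \<open>The map \<open>x \<mapsto> (restr K x, \<theta> x)\<close> identifies \<open>V\<close>
  with the part of \<open>aff K \<times> V'\<close> where \<open>q\<close> is nonzero, with an
  inverse that is polynomial up to powers of \<open>q\<close>. Irreducibility comes from the
  product, and the coordinates in \<open>K\<close> join the independent functions pulled back from
  \<open>V'\<close>.\<close>

lemma irred_dim_ge_fibration:
  fixes V :: "('v \<Rightarrow> 'a::field) set" and \<theta> :: "('v \<Rightarrow> 'a) \<Rightarrow> 'w \<Rightarrow> 'a"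
  assumes inf: "infinite (UNIV :: 'a set)" and V: "V \<subseteq> aff I" and V': "irred V'"
    and \<theta>: "\<And>i. (\<lambda>x. \<theta> x i) \<in> polyfun"
    and K: "finite K" and q: "q \<in> polyfun" "\<And>x y. (\<forall>v\<in>K. x v = y v) \<Longrightarrow> q x = q y"
      "\<exists>z\<in>aff K. q z \<noteq> 0"
    and rat: "\<And>v. v \<in> I \<Longrightarrow> rat_fun V q K \<theta> (\<lambda>x. x v)"
    and into: "\<And>x. x \<in> V \<Longrightarrow> \<theta> x \<in> V' \<and> q x \<noteq> 0"
    and onto: "\<And>z T. z \<in> aff K \<Longrightarrow> q z \<noteq> 0 \<Longrightarrow> T \<in> V' \<Longrightarrow> \<exists>x\<in>V. \<theta> x = T \<and> restr K x = z"
  shows "irred V" and "dim_ge V' d \<Longrightarrow> dim_ge V (d + card K)"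
proof -
  define \<Psi> where "\<Psi> = (\<lambda>x. case_sum (restr K x) (\<theta> x))"
  define P where "P = (\<lambda>(x, y). case_sum x y) ` ((aff K :: ('v \<Rightarrow> 'a) set) \<times> V')"
  define qP where "qP = (\<lambda>w :: 'v + 'w \<Rightarrow> 'a. q (\<lambda>v. w (Inl v)))"
  have qr: "q (restr K x) = q x" for x by (rule q(2)) (simp add: restr_def)
  have qP: "qP \<in> polyfun"
    unfolding qP_def by (rule polyfun_subst[OF q(1), of "\<lambda>w v. w (Inl v)"]) (rule pf_var)
  have irrP: "irred P" unfolding P_def by (intro irred_prod irred_aff inf V')
  have nz: "\<not> vanishes P qP"
  proof -
    obtain z where "z \<in> aff K" "q z \<noteq> 0" using q(3) by blast
    moreover obtain T where "T \<in> V'" using V' by (auto simp: irred_def)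
    ultimately have "case_sum z T \<in> P" "qP (case_sum z T) \<noteq> 0" by (auto simp: P_def qP_def)
    then show ?thesis by (auto simp: vanishes_def)
  qed
  have img: "\<Psi> ` V = {w \<in> P. qP w \<noteq> 0}"
  proof
    show "\<Psi> ` V \<subseteq> {w \<in> P. qP w \<noteq> 0}"
    proof
      fix w assume "w \<in> \<Psi> ` V"
      then obtain x where x: "x \<in> V" "w = \<Psi> x" by blast
      then show "w \<in> {w \<in> P. qP w \<noteq> 0}"
        using into[OF x(1)] restr_aff[of K x] qr[of x] by (auto simp: P_def \<Psi>_def qP_def)
    qed
    show "{w \<in> P. qP w \<noteq> 0} \<subseteq> \<Psi> ` V"
    proof
      fix w assume "w \<in> {w \<in> P. qP w \<noteq> 0}"
      then obtain z T where zT: "w = case_sum z T" "z \<in> aff K" "T \<in> V'" "q z \<noteq> 0"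
        by (auto simp: P_def qP_def)
      then obtain x where "x \<in> V" "\<theta> x = T" "restr K x = z" using onto by blast
      then show "w \<in> \<Psi> ` V" using zT(1) by (auto simp: \<Psi>_def)
    qed
  qed
  have irrB: "irred (\<Psi> ` V)" unfolding img by (rule irred_open[OF irrP qP nz])
  have "rat_fun V q K \<theta> f" if "f \<in> polyfun" for f
    using that
  proof (induction f rule: polyfun.induct)
    case (pf_var v)
    show ?case
    proof (cases "v \<in> I")
      case False
      then have "x v = 0" if "x \<in> V" for x using V that by (auto simp: aff_def)
      then show ?thesis by (intro rat_fun_cong[OF rat_fun_const[of V q K \<theta> 0]]) simp
    qed (rule rat)
  qed (intro rat_fun_const rat_fun_mult rat_fun_add[OF q(1,2)]; assumption)+
  then have lift: "\<exists>N h. h \<in> polyfun \<and> (\<forall>x\<in>V. q x ^ N * f x = h (\<Psi> x))" if "f \<in> polyfun" for f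
    using that unfolding rat_fun_def \<Psi>_def by blast
  show "irred V"
    unfolding irred_def
  proof (intro conjI ballI impI)
    show "V \<noteq> {}" using irrB by (auto simp: irred_def)
    fix f g assume fg: "f \<in> polyfun" "g \<in> polyfun" "vanishes V (\<lambda>x. f x * g x)"
    obtain N h where h: "h \<in> polyfun" "\<forall>x\<in>V. q x ^ N * f x = h (\<Psi> x)" using lift fg(1) by blast
    obtain N' h' where h': "h' \<in> polyfun" "\<forall>x\<in>V. q x ^ N' * g x = h' (\<Psi> x)" using lift fg(2) by blast
    have "h (\<Psi> x) * h' (\<Psi> x) = 0" if "x \<in> V" for x
    proof -
      have "h (\<Psi> x) * h' (\<Psi> x) = (q x ^ N * f x) * (q x ^ N' * g x)" using h h' that by simp
      then show ?thesis using fg(3) that by (auto simp: vanishes_def)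
    qed
    then have "vanishes (\<Psi> ` V) (\<lambda>w. h w * h' w)" by (auto simp: vanishes_def)
    then have "vanishes (\<Psi> ` V) h \<or> vanishes (\<Psi> ` V) h'" using irredD[OF irrB h(1) h'(1)] by blast
    then show "vanishes V f \<or> vanishes V g"
    proof
      assume "vanishes (\<Psi> ` V) h"
      then have "q x ^ N * f x = 0" if "x \<in> V" for x using h that by (auto simp: vanishes_def)
      then show ?thesis using into by (auto simp: vanishes_def)
    next
      assume "vanishes (\<Psi> ` V) h'"
      then have "q x ^ N' * g x = 0" if "x \<in> V" for x using h' that by (auto simp: vanishes_def)
      then show ?thesis using into by (auto simp: vanishes_def)
    qed
  qed
  show "dim_ge V (d + card K)" if d: "dim_ge V' d"
  proof -
    obtain g where g: "\<And>i. g i \<in> polyfun" "indep {..<d} g V'"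
      using d unfolding dim_ge_def by blast
    define J :: "(nat + 'v) set" where "J = Inl ` {..<d} \<union> Inr ` K"
    define G where "G = (\<lambda>j x. case j of Inl i \<Rightarrow> g i (\<theta> x) | Inr v \<Rightarrow> x v)"
    have J: "finite J" "card J = d + card K"
      unfolding J_def using K by (simp, subst card_Un_disjoint) (auto simp: card_image)
    have G: "G j \<in> polyfun" for j
      unfolding G_def using polyfun_subst[OF g(1) \<theta>] by (cases j) (simp_all add: pf_var)
    have "indep J G V"
      unfolding indep_def
    proof (intro ballI impI)
      fix R :: "(nat + 'v \<Rightarrow> 'a) \<Rightarrow> 'a"
      assume R: "R \<in> polyfun" "vanishes V (\<lambda>x. R (restr J (\<lambda>j. G j x)))"
      have R1: "(\<lambda>y. R (case_sum y z)) \<in> polyfun" for z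
        by (rule polyfun_subst[OF R(1), of "\<lambda>y. case_sum y z"], case_tac i) (simp_all add: polyfun.intros)
      have R2: "(\<lambda>z. R (case_sum y z)) \<in> polyfun" for y
        by (rule polyfun_subst[OF R(1), of "\<lambda>z. case_sum y z"], case_tac i) (simp_all add: polyfun.intros)
      have 1: "R (case_sum y z) = 0" if z: "z \<in> aff K" "q z \<noteq> 0" and y: "y \<in> aff {..<d}" for y z
      proof -
        have "vanishes V' (\<lambda>T. R (case_sum (restr {..<d} (\<lambda>i. g i T)) z))"
          unfolding vanishes_def
        proof
          fix T assume "T \<in> V'"
          then obtain x where x: "x \<in> V" "\<theta> x = T" "restr K x = z" using onto z by blast
          have "restr J (\<lambda>j. G j x) = case_sum (restr {..<d} (\<lambda>i. g i T)) z"
            by (rule ext) (auto simp: J_def G_def restr_def x(2) x(3)[symmetric] split: sum.split)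
          then show "R (case_sum (restr {..<d} (\<lambda>i. g i T)) z) = 0"
            using R(2) x(1) by (auto simp: vanishes_def)
        qed
        then have "vanishes (aff {..<d}) (\<lambda>y. R (case_sum y z))"
          using bspec[OF g(2)[unfolded indep_def] R1[of z]] by simp
        then show ?thesis using y by (auto simp: vanishes_def)
      qed
      \<comment> \<open>The restriction to nonzero \<open>q z\<close> is lifted by irreducibility of
        \<open>aff K\<close>, since \<open>q\<close> is not identically zero there.\<close>
      have 2: "R (case_sum y z) = 0" if z: "z \<in> aff K" and y: "y \<in> aff {..<d}" for y z
      proof -
        have "vanishes (aff K) (\<lambda>z. q z * R (case_sum y z))"
          using 1[OF _ _ y] by (auto simp: vanishes_def)
        then have "vanishes (aff K) (\<lambda>z. R (case_sum y z))"
          using irredD[OF irred_aff[OF inf] q(1) R2[of y]] q(3) by (auto simp: vanishes_def)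
        then show ?thesis using z by (auto simp: vanishes_def)
      qed
      show "vanishes (aff J) R"
        unfolding vanishes_def
      proof
        fix y :: "nat + 'v \<Rightarrow> 'a" assume y: "y \<in> aff J"
        have "y = case_sum (\<lambda>i. y (Inl i)) (\<lambda>v. y (Inr v))"
          by (auto simp: fun_eq_iff split: sum.split)
        moreover have "(\<lambda>v. y (Inr v)) \<in> aff K" "(\<lambda>i. y (Inl i)) \<in> aff {..<d}"
          using y by (auto simp: aff_def J_def)
        ultimately show "R y = 0" using 2 by metis
      qed
    qed
    from dim_geI[OF J(1) G this] show ?thesis unfolding J(2) .
  qed
qed

section \<open>Divisibility of minors\<close>

definition minr :: "(nat \<Rightarrow> nat \<Rightarrow> 'b::comm_ring_1) \<Rightarrow> nat \<Rightarrow> (nat \<Rightarrow> nat) \<Rightarrow> (nat \<Rightarrow> nat) \<Rightarrow> 'b" where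
  "minr f r \<rho> \<kappa> = det (mat r r (\<lambda>(i, j). f (\<rho> i) (\<kappa> j)))"

text \<open>Rows and columns are selected by arbitrary maps; compared to increasing ones this only adds
  minors that vanish or differ by a sign, and it makes reindexing trivial.\<close>
definition minors_dvd :: "'b::comm_ring_1 \<Rightarrow> nat \<Rightarrow> nat \<Rightarrow> nat \<Rightarrow> (nat \<Rightarrow> nat \<Rightarrow> 'b) \<Rightarrow> bool" where
  "minors_dvd T m n r f \<longleftrightarrow> (\<forall>\<rho> \<kappa>. (\<forall>i<r. \<rho> i \<in> {1..m}) \<longrightarrow> (\<forall>i<r. \<kappa> i \<in> {1..n}) \<longrightarrow> T dvd minr f r \<rho> \<kappa>)"

lemma minr_cong:
  assumes "\<And>i j. i < r \<Longrightarrow> j < r \<Longrightarrow> f (\<rho> i) (\<kappa> j) = g (\<rho>' i) (\<kappa>' j)"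
  shows "minr f r \<rho> \<kappa> = minr g r \<rho>' \<kappa>'"
  unfolding minr_def by (rule arg_cong[of _ _ det]) (auto simp: assms)

lemma minr_altdef:
  "minr f r \<rho> \<kappa> = (\<Sum>p | p permutes {0..<r}. of_int (sign p) * (\<Prod>i<r. f (\<rho> i) (\<kappa> (p i))))"
proof -
  have "minr f r \<rho> \<kappa> = (\<Sum>p | p permutes {0..<r}. of_int (sign p) *
      (\<Prod>i = 0..<r. mat r r (\<lambda>(i, j). f (\<rho> i) (\<kappa> j)) $$ (i, p i)))"
    unfolding minr_def by (rule det_def') simp
  also have "\<dots> = (\<Sum>p | p permutes {0..<r}. of_int (sign p) * (\<Prod>i<r. f (\<rho> i) (\<kappa> (p i))))"
  proof (rule sum.cong[OF refl])
    fix p assume "p \<in> {p. p permutes {0..<r}}"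
    then have "p i < r" if "i < r" for i using that permutes_in_image[of p "{0..<r}" i] by simp
    then have "(\<Prod>i = 0..<r. mat r r (\<lambda>(i, j). f (\<rho> i) (\<kappa> j)) $$ (i, p i)) =
        (\<Prod>i<r. f (\<rho> i) (\<kappa> (p i)))"
      unfolding lessThan_atLeast0 by (intro prod.cong) auto
    then show "of_int (sign p) * (\<Prod>i = 0..<r. mat r r (\<lambda>(i, j). f (\<rho> i) (\<kappa> j)) $$ (i, p i)) =
        of_int (sign p) * (\<Prod>i<r. f (\<rho> i) (\<kappa> (p i)))" by simp
  qed
  finally show ?thesis .
qed

lemma minr_transpose: "minr (\<lambda>i j. f j i) r \<kappa> \<rho> = minr f r \<rho> \<kappa>"
proof -
  have "mat r r (\<lambda>(i, j). f (\<rho> j) (\<kappa> i)) = transpose_mat (mat r r (\<lambda>(i, j). f (\<rho> i) (\<kappa> j)))"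
    by (rule eq_matI) auto
  then show ?thesis
    unfolding minr_def by (simp add: det_transpose[of _ r])
qed

lemma minr_not_inj:
  assumes "\<not> inj_on \<rho> {..<r}"
  shows "minr f r \<rho> \<kappa> = 0"
proof -
  obtain i j where ij: "i < r" "j < r" "i \<noteq> j" "\<rho> i = \<rho> j"
    using assms by (auto simp: inj_on_def)
  show ?thesis
    unfolding minr_def by (rule det_identical_rows[of _ r i j]) (use ij in auto)
qed

lemma minr_zero_row:
  assumes "i < r" "\<And>j. j < r \<Longrightarrow> f (\<rho> i) (\<kappa> j) = 0"
  shows "minr f r \<rho> \<kappa> = 0"
  unfolding minr_altdef
proof (rule sum.neutral, rule ballI)
  fix p assume "p \<in> {p. p permutes {0..<r}}"
  then have "p i < r" using assms(1) permutes_in_image[of p "{0..<r}" i] by simp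
  then have "(\<Prod>i<r. f (\<rho> i) (\<kappa> (p i))) = 0"
    using assms by (intro prod_zero) auto
  then show "of_int (sign p) * (\<Prod>i<r. f (\<rho> i) (\<kappa> (p i))) = 0" by simp
qed

lemma minr_scale: "minr (\<lambda>i j. u * f i j) r \<rho> \<kappa> = u ^ r * minr f r \<rho> \<kappa>"
proof -
  have "mat r r (\<lambda>(i, j). u * f (\<rho> i) (\<kappa> j)) = u \<cdot>\<^sub>m mat r r (\<lambda>(i, j). f (\<rho> i) (\<kappa> j))"
    by (rule eq_matI) auto
  then show ?thesis unfolding minr_def by simp
qed

lemma dvd_prod_diff:
  fixes f g :: "'i \<Rightarrow> 'b::comm_ring_1"
  assumes "\<And>i. i \<in> A \<Longrightarrow> T dvd f i - g i"
  shows "T dvd prod f A - prod g A"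
  using assms
proof (induction A rule: infinite_finite_induct)
  case (insert i A)
  have "prod f (insert i A) - prod g (insert i A) =
      (f i - g i) * prod f A + g i * (prod f A - prod g A)"
    using insert by (simp add: algebra_simps)
  then show ?case using insert by (auto intro!: dvd_add dvd_mult dvd_mult2)
qed auto

text \<open>Determinants are polynomials in the entries, so congruent entries give congruent minors.
  This is what allows entries to be truncated.\<close>

lemma minors_dvd_cong:
  assumes "\<And>i j. i \<in> {1..m} \<Longrightarrow> j \<in> {1..n} \<Longrightarrow> T dvd f i j - g i j"
  shows "minors_dvd T m n r f \<longleftrightarrow> minors_dvd T m n r g"
proof -
  have "T dvd minr f r \<rho> \<kappa> - minr g r \<rho> \<kappa>"
    if "\<forall>i<r. \<rho> i \<in> {1..m}" "\<forall>i<r. \<kappa> i \<in> {1..n}" for \<rho> \<kappa>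
    unfolding minr_altdef sum_subtractf[symmetric] right_diff_distrib[symmetric]
  proof (intro dvd_sum dvd_mult dvd_prod_diff)
    fix p i assume p: "p \<in> {p. p permutes {0..<r}}" and i: "i \<in> {..<r}"
    then have "p i < r" using permutes_in_image[of p "{0..<r}" i] by simp
    then show "T dvd f (\<rho> i) (\<kappa> (p i)) - g (\<rho> i) (\<kappa> (p i))" using assms that i by simp
  qed
  then have "T dvd minr f r \<rho> \<kappa> \<longleftrightarrow> T dvd minr g r \<rho> \<kappa>"
    if "\<forall>i<r. \<rho> i \<in> {1..m}" "\<forall>i<r. \<kappa> i \<in> {1..n}" for \<rho> \<kappa>
    using dvd_add_right_iff[of T "minr f r \<rho> \<kappa> - minr g r \<rho> \<kappa>" "minr g r \<rho> \<kappa>"] that by simp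
  then show ?thesis unfolding minors_dvd_def by blast
qed

lemma minr_sort_rows:
  assumes "inj_on \<rho> {..<r}" and "T dvd minr f r ((!) (sorted_list_of_set (\<rho> ` {..<r}))) \<kappa>"
  shows "T dvd minr f r \<rho> \<kappa>"
proof -
  define sl where "sl = sorted_list_of_set (\<rho> ` {..<r})"
  have len: "length sl = r" and set: "set sl = \<rho> ` {..<r}" and dist: "distinct sl"
    unfolding sl_def using assms(1) by (auto simp: card_image)
  have bij: "bij_betw ((!) sl) {..<r} (\<rho> ` {..<r})"
    using bij_betw_nth[OF dist, of "{..<r}" "\<rho> ` {..<r}"] len set by simp
  define p where "p = (\<lambda>i. if i < r then the_inv_into {..<r} ((!) sl) (\<rho> i) else i)"
  have pe: "sl ! p i = \<rho> i" "p i < r" if "i < r" for i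
    using that f_the_inv_into_f_bij_betw[OF bij, of "\<rho> i"] bij_betw_the_inv_into[OF bij]
    by (auto simp: p_def dest: bij_betwE)
  have "inj_on p {0..<r}"
  proof (rule inj_onI)
    fix i j assume ij: "i \<in> {0..<r}" "j \<in> {0..<r}" "p i = p j"
    then have "\<rho> i = \<rho> j" using pe(1)[of i] pe(1)[of j] by simp
    then show "i = j" using assms(1) ij by (auto simp: inj_on_def)
  qed
  moreover have "p ` {0..<r} \<subseteq> {0..<r}" using pe by auto
  ultimately have "bij_betw p {0..<r} {0..<r}"
    by (simp add: bij_betw_def endo_inj_surj)
  then have perm: "p permutes {0..<r}" by (rule bij_imp_permutes) (simp add: p_def)
  have "mat r r (\<lambda>(i, j). f (\<rho> i) (\<kappa> j)) =
      mat r r (\<lambda>(i, j). mat r r (\<lambda>(i, j). f (sl ! i) (\<kappa> j)) $$ (p i, j))"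
    by (rule eq_matI) (auto simp: pe)
  then have "minr f r \<rho> \<kappa> = of_int (sign p) * minr f r ((!) sl) \<kappa>"
    unfolding minr_def using det_permute_rows[OF _ perm, of "mat r r (\<lambda>(i, j). f (sl ! i) (\<kappa> j))"] by simp
  then show ?thesis using assms(2) by (simp add: sl_def)
qed

lemma minors_dvd_iff_sorted:
  "minors_dvd T m n r f \<longleftrightarrow> (\<forall>R C. R \<subseteq> {1..m} \<longrightarrow> C \<subseteq> {1..n} \<longrightarrow> card R = r \<longrightarrow> card C = r \<longrightarrow>
     T dvd minr f r ((!) (sorted_list_of_set R)) ((!) (sorted_list_of_set C)))" (is "_ \<longleftrightarrow> ?R")
proof
  assume L: "minors_dvd T m n r f"
  show ?R
  proof (intro allI impI)
    fix R C assume RC: "R \<subseteq> {1..m}" "C \<subseteq> {1..n}" "card R = r" "card C = r"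
    have "sorted_list_of_set X ! i \<in> X" if "X \<subseteq> {1..l}" "card X = r" "i < r" for X and l i :: nat
    proof -
      have "finite X" using finite_subset[OF that(1)] by simp
      then show ?thesis using that nth_mem[of i "sorted_list_of_set X"] by simp
    qed
    then have "sorted_list_of_set R ! i \<in> {1..m}" "sorted_list_of_set C ! i \<in> {1..n}" if "i < r" for i
      using RC that by blast+
    then show "T dvd minr f r ((!) (sorted_list_of_set R)) ((!) (sorted_list_of_set C))"
      using L unfolding minors_dvd_def by simp
  qed
next
  assume R: ?R
  show "minors_dvd T m n r f"
    unfolding minors_dvd_def
  proof (intro allI impI)
    fix \<rho> \<kappa> assume rk: "\<forall>i<r. \<rho> i \<in> {1..m}" "\<forall>i<r. \<kappa> i \<in> {1..n}"
    show "T dvd minr f r \<rho> \<kappa>"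
    proof (cases "inj_on \<rho> {..<r} \<and> inj_on \<kappa> {..<r}")
      case True
      have "T dvd minr f r ((!) (sorted_list_of_set (\<rho> ` {..<r}))) ((!) (sorted_list_of_set (\<kappa> ` {..<r})))"
        using rk True by (intro R[rule_format]) (auto simp: card_image)
      then have "T dvd minr f r ((!) (sorted_list_of_set (\<rho> ` {..<r}))) \<kappa>"
        using minr_sort_rows[of \<kappa> r T "\<lambda>i j. f j i"] True
        unfolding minr_transpose[of f r] by blast
      then show ?thesis using minr_sort_rows True by blast
    next
      case False
      then have "minr f r \<rho> \<kappa> = 0"
        using minr_not_inj[of \<rho> r f] minr_not_inj[of \<kappa> r "\<lambda>i j. f j i" \<rho>]
        unfolding minr_transpose[of f r] by blast
      then show ?thesis by simp
    qed
  qed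
qed

section \<open>Pivoting on an entry\<close>

text \<open>Chio's condensation: a lower triangular matrix of determinant \<open>a ^ q\<close>,
  multiplied from the left, scales all rows but the first by the pivot \<open>a\<close> and clears
  the first column below it. Powers of \<open>a\<close> are kept on both sides, since
  \<open>a\<close> may be a zero divisor.\<close>

lemma chio:
  fixes f :: "nat \<Rightarrow> nat \<Rightarrow> 'b::comm_ring_1"
  shows "f i0 j0 ^ q * minr f (Suc q) (case_nat i0 \<rho>) (case_nat j0 \<kappa>) =
     f i0 j0 * minr (\<lambda>i j. f i0 j0 * f i j - f i j0 * f i0 j) q \<rho> \<kappa>"
proof -
  define a where "a = f i0 j0"
  define \<theta> where "\<theta> = (\<lambda>i j. a * f i j - f i j0 * f i0 j)"
  define M where "M = mat (Suc q) (Suc q) (\<lambda>(i, j). f (case_nat i0 \<rho> i) (case_nat j0 \<kappa> j))"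
  define L where "L = mat (Suc q) (Suc q) (\<lambda>(i, j). if i = 0 then (if j = 0 then 1 else 0)
      else if j = 0 then - f (\<rho> (i - 1)) j0 else if i = j then a else 0)"
  have carr: "L \<in> carrier_mat (Suc q) (Suc q)" "M \<in> carrier_mat (Suc q) (Suc q)"
    by (auto simp: L_def M_def)
  have "det L = prod_list (diag_mat L)"
    by (rule det_lower_triangular[OF _ carr(1)]) (auto simp: L_def)
  also have "\<dots> = (\<Prod>i = 0..<Suc q. L $$ (i, i))"
    using carr by (simp add: prod_list_diag_prod)
  also have "\<dots> = a ^ q"
    unfolding prod.atLeast0_lessThan_Suc_shift by (simp add: L_def)
  finally have detL: "det L = a ^ q" .
  have LM: "(L * M) $$ (i, j) = (if i = 0 then M $$ (0, j) else a * M $$ (i, j) - f (\<rho> (i - 1)) j0 * M $$ (0, j))"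
    if "i < Suc q" "j < Suc q" for i j
  proof -
    have "(L * M) $$ (i, j) = (\<Sum>l = 0..<Suc q. L $$ (i, l) * M $$ (l, j))"
      using that carr by (simp add: scalar_prod_def)
    also have "\<dots> = L $$ (i, 0) * M $$ (0, j) + (\<Sum>l = 0..<q. L $$ (i, Suc l) * M $$ (Suc l, j))"
      by (simp only: sum.atLeast0_lessThan_Suc_shift o_def)
    also have "(\<Sum>l = 0..<q. L $$ (i, Suc l) * M $$ (Suc l, j)) =
        (\<Sum>l = 0..<q. if Suc l = i then a * M $$ (i, j) else 0)"
      using that by (intro sum.cong) (auto simp: L_def)
    also have "\<dots> = (if i = 0 then 0 else a * M $$ (i, j))"
      using that by (cases i) simp_all
    finally show ?thesis using that by (simp add: L_def)
  qed
  have carrLM: "L * M \<in> carrier_mat (Suc q) (Suc q)" using carr by simp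
  have "det (L * M) = (\<Sum>i<Suc q. (L * M) $$ (i, 0) * cofactor (L * M) i 0)"
    by (rule laplace_expansion_column[OF carrLM]) simp
  also have "\<dots> = (\<Sum>i\<in>{0}. (L * M) $$ (i, 0) * cofactor (L * M) i 0)"
  proof (rule sum.mono_neutral_right)
    have "(L * M) $$ (i, 0) = 0" if "i \<noteq> 0" "i < Suc q" for i
      using that LM[of i 0] by (cases i) (auto simp: M_def a_def)
    then show "\<forall>i\<in>{..<Suc q} - {0}. (L * M) $$ (i, 0) * cofactor (L * M) i 0 = 0" by simp
  qed auto
  also have "\<dots> = a * det (mat_delete (L * M) 0 0)"
    using LM[of 0 0] by (simp add: cofactor_def M_def a_def)
  also have "mat_delete (L * M) 0 0 = mat q q (\<lambda>(i, j). \<theta> (\<rho> i) (\<kappa> j))"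
  proof (rule eq_matI)
    fix i j assume "i < dim_row (mat q q (\<lambda>(i, j). \<theta> (\<rho> i) (\<kappa> j)))"
      "j < dim_col (mat q q (\<lambda>(i, j). \<theta> (\<rho> i) (\<kappa> j)))"
    then have ij: "i < q" "j < q" by auto
    define N where "N = L * M"
    have N: "dim_row N = Suc q" "dim_col N = Suc q" using carr by (simp_all add: N_def)
    have "mat_delete N 0 0 $$ (i, j) = N $$ (Suc i, Suc j)"
      using ij by (simp add: mat_delete_def N)
    also have "\<dots> = \<theta> (\<rho> i) (\<kappa> j)"
      unfolding N_def using LM[of "Suc i" "Suc j"] ij by (simp add: M_def \<theta>_def)
    finally show "mat_delete (L * M) 0 0 $$ (i, j) = mat q q (\<lambda>(i, j). \<theta> (\<rho> i) (\<kappa> j)) $$ (i, j)"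
      using ij by (simp add: N_def)
  qed (use carr in \<open>auto simp: mat_delete_def\<close>)
  finally have "a ^ q * det M = a * minr \<theta> q \<rho> \<kappa>"
    using det_mult[OF carr] detL by (simp add: minr_def)
  then show ?thesis by (simp add: minr_def M_def a_def \<theta>_def)
qed

text \<open>Laplace expansion along row 0 and then along the first remaining column removes the
  whole border, so that only minors of size \<open>q\<close> of the inner block, with indices
  \<open>1\<close> to \<open>Suc q\<close>, are left.\<close>

lemma dvd_det_bordered:
  fixes b :: "nat \<Rightarrow> nat \<Rightarrow> 'b::comm_ring_1"
  assumes "minors_dvd T (Suc q) (Suc q) q b"
  shows "T dvd minr b (Suc (Suc q)) id id"
proof -
  define B where "B = mat (Suc (Suc q)) (Suc (Suc q)) (\<lambda>(i, j). b i j)"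
  have T1: "T dvd det (mat_delete B 0 j)" if j: "j < Suc (Suc q)" for j
  proof -
    define C where "C = mat_delete B 0 j"
    have C: "C \<in> carrier_mat (Suc q) (Suc q)" by (simp add: C_def B_def mat_delete_def)
    have "T dvd det (mat_delete C i 0)" if i: "i < Suc q" for i
    proof -
      have "mat_delete C i 0 = mat q q (\<lambda>(i', j'). b (Suc (if i' < i then i' else Suc i'))
          (if Suc j' < j then Suc j' else Suc (Suc j')))"
        using i j by (intro eq_matI) (auto simp: C_def B_def mat_delete_def)
      then have "det (mat_delete C i 0) = minr b q (\<lambda>i'. Suc (if i' < i then i' else Suc i'))
          (\<lambda>j'. if Suc j' < j then Suc j' else Suc (Suc j'))"
        by (simp add: minr_def)
      then show ?thesis using assms i j unfolding minors_dvd_def by simp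
    qed
    then have "T dvd det C"
      unfolding laplace_expansion_column[OF C zero_less_Suc] cofactor_def
      by (intro dvd_sum dvd_mult) simp
    then show ?thesis by (simp add: C_def)
  qed
  have B: "B \<in> carrier_mat (Suc (Suc q)) (Suc (Suc q))" by (simp add: B_def)
  have "T dvd det B"
    unfolding laplace_expansion_row[OF B zero_less_Suc] cofactor_def
    using T1 by (intro dvd_sum dvd_mult) simp
  then show ?thesis by (simp add: minr_def B_def)
qed

definition skip :: "nat \<Rightarrow> nat \<Rightarrow> nat" where
  "skip i0 i = (if i < i0 then i else Suc i)"

lemma skip_image: "i0 \<in> {1..m} \<Longrightarrow> skip i0 ` {1..m - 1} = {1..m} - {i0}"
proof
  assume i0: "i0 \<in> {1..m}"
  show "skip i0 ` {1..m - 1} \<subseteq> {1..m} - {i0}" using i0 by (auto simp: skip_def)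
  show "{1..m} - {i0} \<subseteq> skip i0 ` {1..m - 1}"
  proof
    fix i assume "i \<in> {1..m} - {i0}"
    then have "i = skip i0 (if i < i0 then i else i - 1)" "(if i < i0 then i else i - 1) \<in> {1..m - 1}"
      using i0 by (auto simp: skip_def)
    then show "i \<in> skip i0 ` {1..m - 1}" by blast
  qed
qed

text \<open>The converse direction writes a times f as the sum of the pivoted matrix and a matrix of rank one,
  whose determinant is that of a bordered matrix.\<close>
lemma minors_dvd_pivot:
  fixes f :: "nat \<Rightarrow> nat \<Rightarrow> 'b::comm_ring_1"
  assumes i0: "i0 \<in> {1..m}" and j0: "j0 \<in> {1..n}" and q: "q > 0"
    and cancel: "\<And>p. T dvd f i0 j0 * p \<Longrightarrow> T dvd p"
  shows "minors_dvd T m n (Suc q) f \<longleftrightarrow> minors_dvd T (m - 1) (n - 1) q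
     (\<lambda>i j. f i0 j0 * f (skip i0 i) (skip j0 j) - f (skip i0 i) j0 * f i0 (skip j0 j))"
proof -
  define a where "a = f i0 j0"
  define \<theta> where "\<theta> = (\<lambda>i j. a * f i j - f i j0 * f i0 j)"
  have cancel': "T dvd a ^ k * p \<Longrightarrow> T dvd p" for k p
    by (induction k) (auto simp: a_def mult.assoc dest: cancel)
  have skip_in: "skip i0 i \<in> {1..m} - {i0}" if "i \<in> {1..m - 1}" for i
    using that skip_image[OF i0] by blast
  have skip_in': "skip j0 i \<in> {1..n} - {j0}" if "i \<in> {1..n - 1}" for i
    using that skip_image[OF j0] by blast
  have "minors_dvd T m n (Suc q) f \<longleftrightarrow> minors_dvd T (m - 1) (n - 1) q (\<lambda>i j. \<theta> (skip i0 i) (skip j0 j))"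
  proof
    assume L: "minors_dvd T m n (Suc q) f"
    show "minors_dvd T (m - 1) (n - 1) q (\<lambda>i j. \<theta> (skip i0 i) (skip j0 j))"
      unfolding minors_dvd_def
    proof (intro allI impI)
      fix \<rho> \<kappa> assume rk: "\<forall>i<q. \<rho> i \<in> {1..m - 1}" "\<forall>i<q. \<kappa> i \<in> {1..n - 1}"
      have "T dvd minr f (Suc q) (case_nat i0 (\<lambda>i. skip i0 (\<rho> i))) (case_nat j0 (\<lambda>i. skip j0 (\<kappa> i)))"
        using L[unfolded minors_dvd_def] rk skip_in skip_in' i0 j0
        by (auto split: nat.split simp: less_Suc_eq_0_disj)
      then have "T dvd a ^ q * minr f (Suc q) (case_nat i0 (\<lambda>i. skip i0 (\<rho> i))) (case_nat j0 (\<lambda>i. skip j0 (\<kappa> i)))"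
        by (rule dvd_mult)
      then have "T dvd a * minr \<theta> q (\<lambda>i. skip i0 (\<rho> i)) (\<lambda>i. skip j0 (\<kappa> i))"
        unfolding a_def \<theta>_def chio .
      then have "T dvd minr \<theta> q (\<lambda>i. skip i0 (\<rho> i)) (\<lambda>i. skip j0 (\<kappa> i))"
        unfolding a_def by (rule cancel)
      then show "T dvd minr (\<lambda>i j. \<theta> (skip i0 i) (skip j0 j)) q \<rho> \<kappa>"
        by (simp add: minr_def)
    qed
  next
    assume R: "minors_dvd T (m - 1) (n - 1) q (\<lambda>i j. \<theta> (skip i0 i) (skip j0 j))"
    \<comment> \<open>Row \<open>i0\<close> and column \<open>j0\<close> of \<theta> are zero, so
      minors meeting them vanish, and all others come from the matrix with both removed.\<close>
    have all: "minors_dvd T m n q \<theta>"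
      unfolding minors_dvd_def
    proof (intro allI impI)
      fix \<rho> \<kappa> assume rk: "\<forall>i<q. \<rho> i \<in> {1..m}" "\<forall>i<q. \<kappa> i \<in> {1..n}"
      consider i where "i < q" "\<rho> i = i0" | i where "i < q" "\<kappa> i = j0"
        | "\<forall>i<q. \<rho> i \<noteq> i0" "\<forall>i<q. \<kappa> i \<noteq> j0" by blast
      then show "T dvd minr \<theta> q \<rho> \<kappa>"
      proof cases
        case (1 i)
        then have "minr \<theta> q \<rho> \<kappa> = 0"
          by (intro minr_zero_row[of i]) (auto simp: \<theta>_def a_def)
        then show ?thesis by simp
      next
        case (2 i)
        then have "minr (\<lambda>i j. \<theta> j i) q \<kappa> \<rho> = 0"
          by (intro minr_zero_row[of i]) (auto simp: \<theta>_def a_def)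
        then show ?thesis by (simp add: minr_transpose[of \<theta> q \<kappa> \<rho>])
      next
        case 3
        have "\<forall>i. \<exists>i'. i < q \<longrightarrow> i' \<in> {1..m - 1} \<and> \<rho> i = skip i0 i'"
          using 3 rk skip_image[OF i0] by (metis Diff_iff imageE singletonD)
        then obtain \<rho>' where \<rho>': "\<And>i. i < q \<Longrightarrow> \<rho>' i \<in> {1..m - 1} \<and> \<rho> i = skip i0 (\<rho>' i)" by metis
        have "\<forall>i. \<exists>i'. i < q \<longrightarrow> i' \<in> {1..n - 1} \<and> \<kappa> i = skip j0 i'"
          using 3 rk skip_image[OF j0] by (metis Diff_iff imageE singletonD)
        then obtain \<kappa>' where \<kappa>': "\<And>i. i < q \<Longrightarrow> \<kappa>' i \<in> {1..n - 1} \<and> \<kappa> i = skip j0 (\<kappa>' i)" by metis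
        have "T dvd minr (\<lambda>i j. \<theta> (skip i0 i) (skip j0 j)) q \<rho>' \<kappa>'"
          using R \<rho>' \<kappa>' unfolding minors_dvd_def by blast
        then show ?thesis
          using minr_cong[of q "\<lambda>i j. \<theta> (skip i0 i) (skip j0 j)" \<rho>' \<kappa>' \<theta> \<rho> \<kappa>] \<rho>' \<kappa>' by simp
      qed
    qed
    show "minors_dvd T m n (Suc q) f"
      unfolding minors_dvd_def
    proof (intro allI impI)
      fix \<rho> \<kappa> assume rk: "\<forall>i<Suc q. \<rho> i \<in> {1..m}" "\<forall>i<Suc q. \<kappa> i \<in> {1..n}"
      \<comment> \<open>The signs of the border are such that pivoting on the corner entry 1 adds
        the product \<open>f i j0 * f i0 j\<close> back to \<theta> and leaves \<open>a * f\<close>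
        in the selected rows and columns.\<close>
      define b where "b = (\<lambda>i j. case i of 0 \<Rightarrow> (case j of 0 \<Rightarrow> 1 | Suc j \<Rightarrow> f i0 (\<kappa> j))
          | Suc i \<Rightarrow> (case j of 0 \<Rightarrow> - f (\<rho> i) j0 | Suc j \<Rightarrow> \<theta> (\<rho> i) (\<kappa> j)))"
      have "minors_dvd T (Suc q) (Suc q) q b"
        unfolding minors_dvd_def
      proof (intro allI impI)
        fix \<rho>' \<kappa>' assume rk': "\<forall>i<q. \<rho>' i \<in> {1..Suc q}" "\<forall>i<q. \<kappa>' i \<in> {1..Suc q}"
        have "\<rho>' i - 1 < Suc q" "\<kappa>' i - 1 < Suc q" if "i < q" for i
          using rk' that by fastforce+
        then have "T dvd minr \<theta> q (\<lambda>i. \<rho> (\<rho>' i - 1)) (\<lambda>i. \<kappa> (\<kappa>' i - 1))"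
          using rk by (intro all[unfolded minors_dvd_def, rule_format]) simp_all
        also have "minr \<theta> q (\<lambda>i. \<rho> (\<rho>' i - 1)) (\<lambda>i. \<kappa> (\<kappa>' i - 1)) = minr b q \<rho>' \<kappa>'"
        proof (rule minr_cong)
          fix i j assume "i < q" "j < q"
          then have "\<rho>' i = Suc (\<rho>' i - 1)" "\<kappa>' j = Suc (\<kappa>' j - 1)" using rk' by auto
          then show "\<theta> (\<rho> (\<rho>' i - 1)) (\<kappa> (\<kappa>' j - 1)) = b (\<rho>' i) (\<kappa>' j)"
            by (cases "\<rho>' i"; cases "\<kappa>' j") (simp_all add: b_def)
        qed
        finally show "T dvd minr b q \<rho>' \<kappa>'" .
      qed
      then have "T dvd minr b (Suc (Suc q)) id id" by (rule dvd_det_bordered)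
      also have "minr b (Suc (Suc q)) id id = minr b (Suc (Suc q)) (case_nat 0 Suc) (case_nat 0 Suc)"
        by (rule minr_cong) (auto split: nat.split)
      also have "\<dots> = minr (\<lambda>i j. b i j - b i 0 * b 0 j) (Suc q) Suc Suc"
        using chio[of b 0 0 "Suc q" Suc Suc] by (simp add: b_def)
      also have "\<dots> = minr (\<lambda>i j. a * f i j) (Suc q) \<rho> \<kappa>"
        by (rule minr_cong) (simp add: b_def \<theta>_def)
      also have "\<dots> = a ^ Suc q * minr f (Suc q) \<rho> \<kappa>" by (rule minr_scale)
      finally show "T dvd minr f (Suc q) \<rho> \<kappa>" by (rule cancel')
    qed
  qed
  then show ?thesis by (simp add: a_def \<theta>_def)
qed

section \<open>Strata of the determinantal jet varieties\<close>

lemma coeff_jet_entry: "coeff (jet_entry x k i j) l = (if l < k then x (i, j, l) else 0)"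
  by (simp add: jet_entry_def coeff_sum if_distrib cong: if_cong)

lemma jet_minor_conv_minr:
  "jet_minor x k r R C = minr (jet_entry x k) r ((!) (sorted_list_of_set R)) ((!) (sorted_list_of_set C))"
  by (simp add: jet_minor_def Let_def minr_altdef)

lemma jetZ_iff:
  "x \<in> jetZ m n r k \<longleftrightarrow> x \<in> aff (jet_index m n k) \<and> minors_dvd (monom 1 k) m n r (jet_entry x k)"
  unfolding jetZ_def minors_dvd_iff_sorted by (simp add: jet_minor_conv_minr monom_1_dvd_iff')

lemma jetZ_sub: "jetZ m n r k \<subseteq> aff (jet_index m n k)"
  by (auto simp: jetZ_def)

lemma finite_jet_index: "finite (jet_index m n k)"
  by (simp add: jet_index_def)

lemma card_jet_index: "card (jet_index m n k) = m * n * k"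
  by (simp add: jet_index_def card_cartesian_product)

lemma polyfun_coeff_prod:
  "(\<And>i l. i \<in> A \<Longrightarrow> (\<lambda>x. coeff (p i x) l) \<in> polyfun) \<Longrightarrow> (\<lambda>x. coeff (\<Prod>i\<in>A. p i x) l) \<in> polyfun"
proof (induction A arbitrary: l rule: infinite_finite_induct)
  case (insert i A)
  then show ?case by (auto simp: coeff_mult intro!: polyfun_sum pf_mult)
qed (auto simp: pf_const)

lemma polyfun_coeff_minr:
  "(\<lambda>x. coeff (minr (jet_entry x k) r \<rho> \<kappa>) l) \<in> (polyfun :: ((nat \<times> nat \<times> nat \<Rightarrow> 'a::field) \<Rightarrow> 'a) set)"
proof -
  have "(\<lambda>x :: nat \<times> nat \<times> nat \<Rightarrow> 'a. coeff (\<Prod>i<r. jet_entry x k (\<rho> i) (\<kappa> (p i))) l) \<in> polyfun" for p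
    by (intro polyfun_coeff_prod) (auto simp: coeff_jet_entry intro!: polyfun_if pf_var pf_const)
  moreover have "coeff (of_int a * p) l = of_int a * coeff p l" for a and p :: "'a poly"
    by (simp add: of_int_poly)
  ultimately show ?thesis
    unfolding minr_altdef coeff_sum by (simp add: polyfun_sum pf_mult pf_const)
qed

lemma zar_closed_jetZ: "zar_closed (jet_index m n k) (jetZ m n r k :: (nat \<times> nat \<times> nat \<Rightarrow> 'a::field) set)"
  unfolding zar_closed_def
proof (intro exI conjI)
  let ?A = "{(\<rho>, \<kappa>, l). l < k \<and> (\<forall>i<r. \<rho> i \<in> {1..m}) \<and> (\<forall>i<r. \<kappa> i \<in> {1..n})}"
  let ?S = "(\<lambda>(\<rho>, \<kappa>, l) (x :: nat \<times> nat \<times> nat \<Rightarrow> 'a). coeff (minr (jet_entry x k) r \<rho> \<kappa>) l) ` ?A"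
  show "?S \<subseteq> polyfun" using polyfun_coeff_minr by auto
  have "minors_dvd (monom 1 k) m n r (jet_entry x k) \<longleftrightarrow> (\<forall>f\<in>?S. f x = 0)"
    for x :: "nat \<times> nat \<times> nat \<Rightarrow> 'a"
    unfolding minors_dvd_def monom_1_dvd_iff' ball_simps
    by (simp only: Ball_def split_paired_All mem_Collect_eq case_prod_conv) blast
  then show "jetZ m n r k = {x \<in> aff (jet_index m n k). \<forall>f\<in>?S. f x = 0}"
    by (simp only: jetZ_iff set_eq_iff mem_Collect_eq) simp
qed

section \<open>Dividing by a power of t, and pivoting over truncated power series\<close>

text \<open>The matrix \<open>Y\<close> in \<open>X = t ^ s * Y\<close>, for \<open>X\<close>
  divisible by \<open>t ^ s\<close>; its coefficients are known only below order
  \<open>k - s\<close>.\<close>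

definition jet_tail :: "(nat \<times> nat \<times> nat \<Rightarrow> 'a::field) \<Rightarrow> nat \<Rightarrow> nat \<Rightarrow> nat \<Rightarrow> nat \<Rightarrow> 'a poly" where
  "jet_tail x k s i j = jet_entry (\<lambda>(i, j, l). x (i, j, s + l)) (k - s) i j"

lemma coeff_jet_tail: "coeff (jet_tail x k s i j) l = (if l < k - s then x (i, j, s + l) else 0)"
  by (simp add: jet_tail_def coeff_jet_entry)

text \<open>Dividing the matrix by \<open>t ^ s\<close> divides every minor of size \<open>r\<close>
  by \<open>t ^ (s * r)\<close>, so a condition modulo \<open>t ^ k\<close> becomes one modulo
  \<open>t ^ (k - s * r)\<close>. This is the origin of the exponents \<open>k - r * s\<close> and
  \<open>mu\<close> in the result.\<close>

lemma minors_dvd_jet_tail: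
  assumes "\<forall>i j l. l < s \<longrightarrow> x (i, j, l) = 0" and "k = s * r + k'"
  shows "minors_dvd (monom 1 k) m n r (jet_entry x k) \<longleftrightarrow> minors_dvd (monom 1 k') m n r (jet_tail x k s)"
proof -
  have "jet_entry x k i j = monom 1 s * jet_tail x k s i j" for i j
    by (rule poly_eqI) (use assms(1) in \<open>auto simp: coeff_jet_entry coeff_monom_mult coeff_jet_tail\<close>)
  then have eq: "minr (jet_entry x k) r \<rho> \<kappa> = monom 1 (s * r) * minr (jet_tail x k s) r \<rho> \<kappa>" for \<rho> \<kappa>
    using minr_scale[of "monom 1 s" "jet_tail x k s" r \<rho> \<kappa>]
    by (simp add: monom_power) (metis (no_types, lifting) minr_cong)
  have "monom 1 k = monom 1 (s * r) * (monom 1 k' :: 'a poly)"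
    by (simp add: assms(2) mult_monom)
  then show ?thesis
    by (simp add: minors_dvd_def eq monom_eq_0_iff)
qed

text \<open>A polynomial with nonzero constant coefficient is a unit modulo \<open>t ^ k\<close>;
  concretely, the coefficients of \<open>p\<close> are shown to vanish one order after the
  other.\<close>

lemma monom_dvd_cancel:
  fixes a p :: "'a::field poly"
  assumes "coeff a 0 \<noteq> 0" "monom 1 k dvd a * p"
  shows "monom 1 k dvd p"
  unfolding monom_1_dvd_iff'
proof (intro allI impI)
  fix l assume "l < k"
  then show "coeff p l = 0"
  proof (induction l rule: less_induct)
    case (less l)
    have "0 = coeff (a * p) l" using assms(2) less.prems by (simp add: monom_1_dvd_iff')
    also have "\<dots> = (\<Sum>i\<in>{0}. coeff a i * coeff p (l - i))"
      unfolding coeff_mult using less by (intro sum.mono_neutral_right) auto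
    finally show ?case using assms(1) by simp
  qed
qed

text \<open>The part of \<open>Y\<close> that a condition modulo \<open>t ^ \<mu>\<close> can
  see.\<close>

definition shift_map :: "nat \<Rightarrow> nat \<Rightarrow> nat \<Rightarrow> nat \<Rightarrow> (nat \<times> nat \<times> nat \<Rightarrow> 'a::field) \<Rightarrow> nat \<times> nat \<times> nat \<Rightarrow> 'a" where
  "shift_map m n s \<mu> x = (\<lambda>(i, j, l). if (i, j, l) \<in> jet_index m n \<mu> then x (i, j, s + l) else 0)"

text \<open>The coefficients of the pivoted matrix \<open>y\<^sub>i\<^sub>0\<^sub>j\<^sub>0 y\<^sub>i\<^sub>j - y\<^sub>i\<^sub>j\<^sub>0 y\<^sub>i\<^sub>0\<^sub>j\<close>, where X = t^s Y.\<close>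
definition pivot_map :: "nat \<Rightarrow> nat \<Rightarrow> nat \<Rightarrow> nat \<Rightarrow> nat \<Rightarrow> nat \<Rightarrow> (nat \<times> nat \<times> nat \<Rightarrow> 'a::field) \<Rightarrow>
    nat \<times> nat \<times> nat \<Rightarrow> 'a" where
  "pivot_map m n s k' i0 j0 x = (\<lambda>(i, j, l). if (i, j, l) \<in> jet_index (m - 1) (n - 1) k' then
     \<Sum>u\<le>l. x (i0, j0, s + u) * x (skip i0 i, skip j0 j, s + (l - u)) -
        x (skip i0 i, j0, s + u) * x (i0, skip j0 j, s + (l - u)) else 0)"

lemma polyfun_shift_map: "(\<lambda>x. shift_map m n s \<mu> x v) \<in> polyfun"
  by (cases v) (auto simp: shift_map_def intro!: polyfun_if pf_var pf_const)

lemma polyfun_pivot_map: "(\<lambda>x. pivot_map m n s k' i0 j0 x v) \<in> polyfun"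
  by (cases v) (auto simp: pivot_map_def intro!: polyfun_if polyfun_sum polyfun_minus pf_mult pf_var pf_const)

lemma shift_map_aff: "shift_map m n s \<mu> x \<in> aff (jet_index m n \<mu>)"
  by (auto simp: shift_map_def aff_def)

lemma pivot_map_aff: "pivot_map m n s k' i0 j0 x \<in> aff (jet_index (m - 1) (n - 1) k')"
  by (auto simp: pivot_map_def aff_def)

lemma jetZ_iff_shift:
  assumes "x \<in> aff (jet_index m n k)" "\<forall>i j l. l < s \<longrightarrow> x (i, j, l) = 0" "k = s * r + \<mu>" "r > 0"
  shows "x \<in> jetZ m n r k \<longleftrightarrow> shift_map m n s \<mu> x \<in> jetZ m n r \<mu>"
proof -
  have sk: "s + \<mu> \<le> k" using assms(3,4) by (cases r) auto
  have "minors_dvd (monom 1 \<mu>) m n r (jet_tail x k s) \<longleftrightarrow>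
      minors_dvd (monom 1 \<mu>) m n r (jet_entry (shift_map m n s \<mu> x) \<mu>)"
    by (rule minors_dvd_cong)
      (use sk in \<open>auto simp: monom_1_dvd_iff' coeff_jet_tail coeff_jet_entry shift_map_def jet_index_def\<close>)
  then show ?thesis
    using minors_dvd_jet_tail[OF assms(2,3)] assms(1) shift_map_aff[of m n s \<mu> x]
    by (simp add: jetZ_iff)
qed

lemma jetZ_iff_pivot:
  assumes "x \<in> aff (jet_index m n k)" "\<forall>i j l. l < s \<longrightarrow> x (i, j, l) = 0"
    and k: "k = s * Suc q + k'" and "k' > 0" "q > 0" and ij: "i0 \<in> {1..m}" "j0 \<in> {1..n}" and a0: "x (i0, j0, s) \<noteq> 0"
  shows "x \<in> jetZ m n (Suc q) k \<longleftrightarrow> pivot_map m n s k' i0 j0 x \<in> jetZ (m - 1) (n - 1) q k'"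
proof -
  have sk: "s + k' \<le> k" using k by auto
  have "s < k" using sk \<open>k' > 0\<close> by linarith
  define y where "y = jet_tail x k s"
  have "minors_dvd (monom 1 k') m n (Suc q) y \<longleftrightarrow> minors_dvd (monom 1 k') (m - 1) (n - 1) q
     (\<lambda>i j. y i0 j0 * y (skip i0 i) (skip j0 j) - y (skip i0 i) j0 * y i0 (skip j0 j))"
  proof (rule minors_dvd_pivot[OF ij \<open>q > 0\<close>])
    fix p assume "monom 1 k' dvd y i0 j0 * p"
    then show "monom 1 k' dvd p"
      by (rule monom_dvd_cancel[rotated]) (use a0 \<open>s < k\<close> in \<open>simp add: y_def coeff_jet_tail\<close>)
  qed
  also have "\<dots> \<longleftrightarrow> minors_dvd (monom 1 k') (m - 1) (n - 1) q (jet_entry (pivot_map m n s k' i0 j0 x) k')"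
  proof (rule minors_dvd_cong)
    fix i j assume i: "i \<in> {1..m - 1}" and j: "j \<in> {1..n - 1}"
    have "coeff (y i0 j0 * y (skip i0 i) (skip j0 j) - y (skip i0 i) j0 * y i0 (skip j0 j)) l =
        pivot_map m n s k' i0 j0 x (i, j, l)" if "l < k'" for l
    proof -
      have mem: "(i, j, l) \<in> jet_index (m - 1) (n - 1) k'" using i j that by (simp add: jet_index_def)
      have "coeff (y i0 j0 * y (skip i0 i) (skip j0 j) - y (skip i0 i) j0 * y i0 (skip j0 j)) l =
          (\<Sum>u\<le>l. coeff (y i0 j0) u * coeff (y (skip i0 i) (skip j0 j)) (l - u) -
            coeff (y (skip i0 i) j0) u * coeff (y i0 (skip j0 j)) (l - u))"
        by (simp add: coeff_mult sum_subtractf)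
      also have "\<dots> = (\<Sum>u\<le>l. x (i0, j0, s + u) * x (skip i0 i, skip j0 j, s + (l - u)) -
            x (skip i0 i, j0, s + u) * x (i0, skip j0 j, s + (l - u)))"
      proof (rule sum.cong[OF refl])
        fix u assume "u \<in> {..l}"
        \<comment> \<open>All orders entering a coefficient below \<open>k'\<close> lie below the
          truncation order of \<open>Y\<close>.\<close>
        then have "u < k - s" "l - u < k - s" using sk \<open>l < k'\<close> by auto
        then show "coeff (y i0 j0) u * coeff (y (skip i0 i) (skip j0 j)) (l - u) -
            coeff (y (skip i0 i) j0) u * coeff (y i0 (skip j0 j)) (l - u) =
            x (i0, j0, s + u) * x (skip i0 i, skip j0 j, s + (l - u)) -
            x (skip i0 i, j0, s + u) * x (i0, skip j0 j, s + (l - u))"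
          by (simp add: y_def coeff_jet_tail)
      qed
      finally show ?thesis using mem by (simp add: pivot_map_def)
    qed
    then show "monom 1 k' dvd y i0 j0 * y (skip i0 i) (skip j0 j) - y (skip i0 i) j0 * y i0 (skip j0 j) -
        jet_entry (pivot_map m n s k' i0 j0 x) k' i j"
      by (simp add: monom_1_dvd_iff' coeff_jet_entry)
  qed
  finally show ?thesis
    using minors_dvd_jet_tail[OF assms(2) k] assms(1) pivot_map_aff[of m n s k' i0 j0 x]
    by (simp add: jetZ_iff y_def)
qed

text \<open>The orders from \<open>s + \<mu>\<close> on, which a condition on \<open>Y\<close>
  modulo \<open>t ^ \<mu>\<close> leaves unconstrained.\<close>

definition shift_free :: "nat \<Rightarrow> nat \<Rightarrow> nat \<Rightarrow> nat \<Rightarrow> nat \<Rightarrow> (nat \<times> nat \<times> nat) set" where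
  "shift_free m n k s \<mu> = {1..m} \<times> {1..n} \<times> {s + \<mu>..<k}"

text \<open>What the pivoted matrix does not determine: the pivot row and column in all orders from
  \<open>s\<close> on, and the other entries from order \<open>s + k'\<close> on.\<close>

definition pivot_free :: "nat \<Rightarrow> nat \<Rightarrow> nat \<Rightarrow> nat \<Rightarrow> nat \<Rightarrow> nat \<Rightarrow> nat \<Rightarrow> (nat \<times> nat \<times> nat) set" where
  "pivot_free m n k s k' i0 j0 = {1..m} \<times> {1..n} \<times> {s..<k} -
     ({1..m} - {i0}) \<times> ({1..n} - {j0}) \<times> {s..<s + k'}"

lemma card_shift_free:
  "s + \<mu> \<le> k \<Longrightarrow> card (shift_free m n k s \<mu>) + m * n * \<mu> + m * n * s = m * n * k"
proof -
  assume "s + \<mu> \<le> k"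
  then obtain e where "k = s + \<mu> + e" using le_Suc_ex by blast
  then show ?thesis by (simp add: shift_free_def card_cartesian_product algebra_simps)
qed

text \<open>The coordinates split into the free ones, those traded for coefficients of the pivoted
  matrix, and the \<open>m * n * s\<close> that vanish on the stratum. The last group is the source
  of the summand \<open>s * m * n\<close> in the formula.\<close>

lemma card_pivot_free:
  assumes "s + k' \<le> k" "i0 \<in> {1..m}" "j0 \<in> {1..n}"
  shows "card (pivot_free m n k s k' i0 j0) + (m - 1) * (n - 1) * k' + m * n * s = m * n * k"
proof -
  have "card (pivot_free m n k s k' i0 j0) = card ({1..m} \<times> {1..n} \<times> {s..<k}) -
      card (({1..m} - {i0}) \<times> ({1..n} - {j0}) \<times> {s..<s + k'})"
    unfolding pivot_free_def using assms by (intro card_Diff_subset) auto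
  moreover have "card (({1..m} - {i0}) \<times> ({1..n} - {j0}) \<times> {s..<s + k'}) \<le> card ({1..m} \<times> {1..n} \<times> {s..<k})"
    using assms by (intro card_mono) auto
  moreover have "card (({1..m} - {i0}) \<times> ({1..n} - {j0}) \<times> {s..<s + k'}) = (m - 1) * (n - 1) * k'"
    using assms by (simp add: card_cartesian_product)
  moreover have "card ({1..m} \<times> {1..n} \<times> {s..<k}) + m * n * s = m * n * k"
  proof -
    obtain e where "k = s + e" using assms(1) le_Suc_ex add_leD1 by blast
    then show ?thesis by (simp add: card_cartesian_product algebra_simps)
  qed
  ultimately show ?thesis by linarith
qed

lemma shift_rat_fun:
  assumes V: "V \<subseteq> aff (jet_index m n k)" "\<And>x i j l. x \<in> V \<Longrightarrow> l < s \<Longrightarrow> x (i, j, l) = 0"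
    and v: "v \<in> jet_index m n k"
  shows "rat_fun V q (shift_free m n k s \<mu>) (shift_map m n s \<mu>) (\<lambda>x. x v)"
proof -
  obtain i j l where ijl: "v = (i, j, l)" by (cases v)
  consider "l < s" | "v \<in> shift_free m n k s \<mu>" | "s \<le> l" "(i, j, l - s) \<in> jet_index m n \<mu>"
    using v unfolding ijl jet_index_def shift_free_def by fastforce
  then show ?thesis
  proof cases
    case 1
    show ?thesis
      by (rule rat_fun_cong[OF rat_fun_const[of _ _ _ _ 0]]) (use V(2) 1 ijl in simp)
  next
    case 2
    then show ?thesis by (rule rat_fun_coord)
  next
    case 3
    show ?thesis
      by (rule rat_fun_cong[OF rat_fun_map[of _ _ _ _ "(i, j, l - s)"]])
        (use 3 ijl in \<open>simp add: shift_map_def\<close>)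
  qed
qed

text \<open>A coefficient of order \<open>l\<close> of the pivoted matrix is the pivot coefficient
  times an unknown of order \<open>s + l\<close>, plus products of free coordinates with each other
  or with unknowns of lower order. This triangular system is solved by recursion on
  \<open>l\<close>, with one division by the pivot coefficient at each step.\<close>

lemma pivot_rat_fun:
  fixes V :: "(nat \<times> nat \<times> nat \<Rightarrow> 'a::field) set"
  assumes V: "V \<subseteq> aff (jet_index m n k)" "\<And>x i j l. x \<in> V \<Longrightarrow> l < s \<Longrightarrow> x (i, j, l) = 0"
    and sk: "s + k' \<le> k" "k' > 0" and ij0: "i0 \<in> {1..m}" "j0 \<in> {1..n}" and v: "v \<in> jet_index m n k"
  shows "rat_fun V (\<lambda>x. x (i0, j0, s)) (pivot_free m n k s k' i0 j0) (pivot_map m n s k' i0 j0) (\<lambda>x. x v)"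
proof -
  define K where "K = pivot_free m n k s k' i0 j0"
  define R where "R = rat_fun V (\<lambda>x. x (i0, j0, s)) K (pivot_map m n s k' i0 j0)"
  have qK: "(i0, j0, s) \<in> K" using ij0 sk by (auto simp: K_def pivot_free_def)
  have add: "R (\<lambda>x. f x + g x)" if "R f" "R g" for f g
    unfolding R_def by (rule rat_fun_add) (use that qK in \<open>auto simp: R_def pf_var\<close>)
  have mult: "R (\<lambda>x. f x * g x)" if "R f" "R g" for f g
    using that unfolding R_def by (rule rat_fun_mult)
  have sum: "R (\<lambda>x. \<Sum>i\<in>A. f i x)" if "\<And>i. i \<in> A \<Longrightarrow> R (f i)" for A :: "nat set" and f
    unfolding R_def by (rule rat_fun_sum) (use that qK in \<open>auto simp: R_def pf_var\<close>)
  have const: "R (\<lambda>x. c)" for c unfolding R_def by (rule rat_fun_const)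
  have coord: "R (\<lambda>x. x v)" if "v \<in> K" for v using that unfolding R_def by (rule rat_fun_coord)
  have main: "s + l < s + k' \<Longrightarrow> R (\<lambda>x. x (skip i0 i, skip j0 j, s + l))"
    if i: "i \<in> {1..m - 1}" and j: "j \<in> {1..n - 1}" for i j l
  proof (induction l rule: less_induct)
    case (less l)
    have sk0: "skip i0 i \<in> {1..m} - {i0}" "skip j0 j \<in> {1..n} - {j0}"
      using skip_image[OF ij0(1)] skip_image[OF ij0(2)] i j by blast+
    have inK: "(i0, j0, s + u) \<in> K" "(skip i0 i, j0, s + u) \<in> K" "(i0, skip j0 j, s + u) \<in> K"
      if "u \<le> l" for u
      using that less.prems ij0 sk sk0 by (auto simp: K_def pivot_free_def)
    have eq: "pivot_map m n s k' i0 j0 x (i, j, l) +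
        (\<Sum>u\<in>{1..l}. (- 1) * (x (i0, j0, s + u) * x (skip i0 i, skip j0 j, s + (l - u)))) +
        (\<Sum>u\<le>l. x (skip i0 i, j0, s + u) * x (i0, skip j0 j, s + (l - u))) =
        x (i0, j0, s) * x (skip i0 i, skip j0 j, s + l)" for x :: "nat \<times> nat \<times> nat \<Rightarrow> 'a"
    proof -
      have "{..l} = insert 0 {1..l}" by auto
      then have "(\<Sum>u\<le>l. x (i0, j0, s + u) * x (skip i0 i, skip j0 j, s + (l - u))) =
          x (i0, j0, s) * x (skip i0 i, skip j0 j, s + l) +
          (\<Sum>u\<in>{1..l}. x (i0, j0, s + u) * x (skip i0 i, skip j0 j, s + (l - u)))" by simp
      then show ?thesis
        using less.prems i j
        by (simp add: pivot_map_def jet_index_def sum_subtractf sum_negf)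
    qed
    have "R (\<lambda>x. pivot_map m n s k' i0 j0 x (i, j, l) +
        (\<Sum>u\<in>{1..l}. (- 1) * (x (i0, j0, s + u) * x (skip i0 i, skip j0 j, s + (l - u)))) +
        (\<Sum>u\<le>l. x (skip i0 i, j0, s + u) * x (i0, skip j0 j, s + (l - u))))"
    proof (intro add sum mult const)
      show "R (\<lambda>x. pivot_map m n s k' i0 j0 x (i, j, l))" unfolding R_def by (rule rat_fun_map)
    next
      fix u assume u: "u \<in> {1..l}"
      show "R (\<lambda>x. x (i0, j0, s + u))" using u inK by (intro coord) simp
      show "R (\<lambda>x. x (skip i0 i, skip j0 j, s + (l - u)))" using u less by (intro less.IH) auto
    next
      fix u assume u: "u \<in> {..l}"
      show "R (\<lambda>x. x (skip i0 i, j0, s + u))" using u inK by (intro coord) simp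
      show "R (\<lambda>x. x (i0, skip j0 j, s + (l - u)))" by (rule coord, rule inK(3)) simp
    qed
    then show ?case unfolding eq unfolding R_def by (rule rat_fun_cancel)
  qed
  obtain i j l where ijl: "v = (i, j, l)" by (cases v)
  consider "l < s" | "v \<in> K" | "s \<le> l" "l < s + k'" "i \<in> {1..m} - {i0}" "j \<in> {1..n} - {j0}"
    using v unfolding ijl jet_index_def K_def pivot_free_def by fastforce
  then have "R (\<lambda>x. x v)"
  proof cases
    case 1
    show ?thesis
      unfolding R_def by (rule rat_fun_cong[OF rat_fun_const[of _ _ _ _ 0]]) (use V(2) 1 ijl in simp)
  next
    case 2
    then show ?thesis by (rule coord)
  next
    case 3
    obtain i' where i': "i' \<in> {1..m - 1}" "i = skip i0 i'" using 3 skip_image[OF ij0(1)] by blast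
    obtain j' where j': "j' \<in> {1..n - 1}" "j = skip j0 j'" using 3 skip_image[OF ij0(2)] by blast
    show ?thesis using main[OF i'(1) j'(1), of "l - s"] 3 by (simp add: ijl i' j')
  qed
  then show ?thesis by (simp add: R_def K_def)
qed

section \<open>Codimension bounds from the single strata\<close>

lemma codimZ_le_iff:
  assumes "infinite (UNIV :: 'a::field set)"
  shows "codimZ (F :: 'a itself) m n r k \<le> enat c \<longleftrightarrow>
    (\<exists>V :: (nat \<times> nat \<times> nat \<Rightarrow> 'a) set. \<exists>d. V \<subseteq> jetZ m n r k \<and> irred V \<and> dim_ge V d \<and> m * n * k \<le> d + c)"
  unfolding codimZ_def codim_le_iff[OF assms finite_jet_index zar_closed_jetZ] card_jet_index ..

text \<open>The affine space is a point here. This merges the two cases in the definition of the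
  last constant of the formula: its value 0 for \<open>mu = 0\<close> is a codimension as
  well.\<close>

lemma codimZ_0: 
  assumes "infinite (UNIV :: 'a::field set)"
  shows "codimZ (F :: 'a itself) m n r 0 = 0"
proof -
  have "jetZ m n r 0 = (aff {} :: (nat \<times> nat \<times> nat \<Rightarrow> 'a) set)"
    by (simp add: jetZ_def jet_index_def)
  moreover have irr: "irred (aff {} :: (nat \<times> nat \<times> nat \<Rightarrow> 'a) set)" by (rule irred_aff[OF assms])
  moreover have "dim_ge (aff {} :: (nat \<times> nat \<times> nat \<Rightarrow> 'a) set) 0"
    using irr by (intro dim_ge_0) (simp add: irred_def)
  ultimately have "codimZ F m n r 0 \<le> enat 0"
    unfolding codimZ_le_iff[OF assms] by (intro exI[of _ "aff {}"] exI[of _ 0]) simp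
  then show ?thesis by (simp add: zero_enat_def[symmetric])
qed

text \<open>Order at least \<open>s\<close>, a closed condition. Order exactly \<open>s\<close> is
  expressed separately, by a nonvanishing pivot coefficient, and is not imposed on the last
  stratum.\<close>

definition jet_stratum :: "nat \<Rightarrow> nat \<Rightarrow> nat \<Rightarrow> nat \<Rightarrow> (nat \<times> nat \<times> nat \<Rightarrow> 'a::field) set" where
  "jet_stratum m n k s = {x \<in> aff (jet_index m n k). \<forall>i j l. l < s \<longrightarrow> x (i, j, l) = 0}"

text \<open>The matrices of order at least \<open>s\<close> whose shift lies in \<open>V'\<close>
  form a product of \<open>V'\<close> with the space of free coordinates, so the fibration lemma
  applies with the constant 1 as denominator.\<close>

lemma codimZ_le_shift:
  assumes inf: "infinite (UNIV :: 'a::field set)" and k: "k = s * r + \<mu>" "r > 0"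
    and c: "codimZ (F :: 'a itself) m n r \<mu> \<le> enat c"
  shows "codimZ F m n r k \<le> enat (c + s * m * n)"
proof -
  obtain V' :: "(nat \<times> nat \<times> nat \<Rightarrow> 'a) set" and d where V': "V' \<subseteq> jetZ m n r \<mu>" "irred V'" "dim_ge V' d" "m * n * \<mu> \<le> d + c"
    using c unfolding codimZ_le_iff[OF inf] by blast
  define K where "K = shift_free m n k s \<mu>"
  have sk: "s + \<mu> \<le> k" using k by (cases r) auto
  define V where "V = {x \<in> jet_stratum m n k s. shift_map m n s \<mu> x \<in> V'}"
  have finK: "finite K" by (simp add: K_def shift_free_def)
  have onto: "\<exists>x\<in>V. shift_map m n s \<mu> x = T \<and> restr K x = z" if z: "z \<in> aff K" and T: "T \<in> V'" for z T
  proof -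
    define x where "x = (\<lambda>(i, j, l). if (i, j, l) \<in> K then z (i, j, l)
      else if s \<le> l \<and> (i, j, l - s) \<in> jet_index m n \<mu> then T (i, j, l - s) else 0)"
    have TI: "T \<in> aff (jet_index m n \<mu>)" using T V'(1) jetZ_sub by blast
    have "x \<in> aff (jet_index m n k)"
      using sk by (auto simp: x_def aff_def K_def shift_free_def jet_index_def)
    then have "x \<in> jet_stratum m n k s"
      using sk by (auto simp: jet_stratum_def x_def K_def shift_free_def)
    moreover have "shift_map m n s \<mu> x = T"
    proof (rule ext)
      fix v :: "nat \<times> nat \<times> nat"
      obtain i j l where v: "v = (i, j, l)" by (cases v)
      show "shift_map m n s \<mu> x v = T v"
        using TI by (auto simp: v shift_map_def x_def K_def shift_free_def aff_def jet_index_def)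
    qed
    moreover have "restr K x = z"
      using z by (auto simp: restr_def x_def aff_def fun_eq_iff)
    ultimately show ?thesis using T by (auto simp: V_def)
  qed
  have *: "irred V \<and> dim_ge V (d + card K)"
  proof -
    have VI: "V \<subseteq> aff (jet_index m n k)" by (auto simp: V_def jet_stratum_def)
    have rat: "rat_fun V (\<lambda>_. 1) K (shift_map m n s \<mu>) (\<lambda>x. x v)" if "v \<in> jet_index m n k" for v
      unfolding K_def by (rule shift_rat_fun[OF VI _ that]) (auto simp: V_def jet_stratum_def)
    have ex: "\<exists>z\<in>aff K. (1 :: 'a) \<noteq> 0" by (auto simp: aff_def intro: exI[of _ "\<lambda>_. 0"])
    have into: "shift_map m n s \<mu> x \<in> V' \<and> (1 :: 'a) \<noteq> 0" if "x \<in> V" for x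
      using that by (simp add: V_def)
    show ?thesis
      using irred_dim_ge_fibration[OF inf VI V'(2) polyfun_shift_map finK pf_const refl ex rat into onto] V'(3)
      by blast
  qed
  moreover have "V \<subseteq> jetZ m n r k"
    using jetZ_iff_shift[OF _ _ k] V'(1) by (auto simp: V_def jet_stratum_def)
  moreover have "m * n * k \<le> (d + card K) + (c + s * m * n)"
    using card_shift_free[OF sk, of m n] V'(4) by (simp add: K_def algebra_simps)
  ultimately show ?thesis unfolding codimZ_le_iff[OF inf] by blast
qed

text \<open>An upper bound asks for a single irreducible subset, so the pivot can be placed at (1,
  1). Its points are built from a point of \<open>V'\<close> and free coordinates with nonzero
  pivot.\<close>

lemma codimZ_le_pivot:
  assumes inf: "infinite (UNIV :: 'a::field set)" and k: "k = s * Suc q + k'" "q > 0" "k' > 0"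
    and mn: "m > 0" "n > 0"
    and c: "codimZ (F :: 'a itself) (m - 1) (n - 1) q k' \<le> enat c"
  shows "codimZ F m n (Suc q) k \<le> enat (c + s * m * n)"
proof -
  obtain V' :: "(nat \<times> nat \<times> nat \<Rightarrow> 'a) set" and d where V': "V' \<subseteq> jetZ (m - 1) (n - 1) q k'" "irred V'" "dim_ge V' d"
      "(m - 1) * (n - 1) * k' \<le> d + c"
    using c unfolding codimZ_le_iff[OF inf] by blast
  define K where "K = pivot_free m n k s k' 1 1"
  define \<theta> where "\<theta> = (pivot_map m n s k' 1 1 :: (nat \<times> nat \<times> nat \<Rightarrow> 'a) \<Rightarrow> nat \<times> nat \<times> nat \<Rightarrow> 'a)"
  define p :: "(nat \<times> nat \<times> nat \<Rightarrow> 'a) \<Rightarrow> 'a" where "p = (\<lambda>x. x (1, 1, s))"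
  have sk: "s + k' \<le> k" using k by auto
  have one: "1 \<in> {1..m}" "1 \<in> {1..n}" using mn by auto
  define V where "V = {x \<in> jet_stratum m n k s. p x \<noteq> 0 \<and> \<theta> x \<in> V'}"
  have finK: "finite K" by (simp add: K_def pivot_free_def)
  have pK: "(1, 1, s) \<in> K" using one sk k by (auto simp: K_def pivot_free_def)
  have onto: "\<exists>x\<in>V. \<theta> x = T \<and> restr K x = z" if z: "z \<in> aff K" "p z \<noteq> 0" and T: "T \<in> V'" for z T
  proof -
    \<comment> \<open>As a formal power series the pivot entry is invertible without any truncation.
      \<open>D\<close> solves \<open>A 1 1 * D i j - A i 1 * A 1 j = T\<close>, where the indices of
      \<open>T\<close> are lowered by one because the first row and column are left out.\<close>
    define A where "A = (\<lambda>i j. Abs_fps (\<lambda>l. z (i, j, s + l)))"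
    define D where "D = (\<lambda>i j. (Abs_fps (\<lambda>l. T (i - 1, j - 1, l)) + A i 1 * A 1 j) * inverse (A 1 1))"
    define x where "x = (\<lambda>(i, j, l). if (i, j, l) \<in> K then z (i, j, l)
      else if (i, j, l) \<in> jet_index m n k \<and> s \<le> l then fps_nth (D i j) (l - s) else 0)"
    have TI: "T \<in> aff (jet_index (m - 1) (n - 1) k')" using T V'(1) jetZ_sub by blast
    have "fps_nth (A 1 1) 0 \<noteq> 0" using z(2) by (simp add: A_def p_def)
    then have AD: "A 1 1 * D i j = Abs_fps (\<lambda>l. T (i - 1, j - 1, l)) + A i 1 * A 1 j" for i j
      using inverse_mult_eq_1[of "A 1 1"] unfolding D_def
      by (metis (no_types, lifting) mult.assoc mult.commute mult_1_right)
    have "x \<in> aff (jet_index m n k)"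
      by (auto simp: x_def aff_def K_def pivot_free_def jet_index_def)
    then have "x \<in> jet_stratum m n k s"
      by (auto simp: jet_stratum_def x_def K_def pivot_free_def)
    moreover have "p x \<noteq> 0" using z(2) pK by (simp add: p_def x_def)
    moreover have "restr K x = z"
      using z by (auto simp: restr_def x_def aff_def fun_eq_iff)
    moreover have "\<theta> x = T"
    proof (rule ext)
      fix v :: "nat \<times> nat \<times> nat"
      obtain i j l where v: "v = (i, j, l)" by (cases v)
      show "\<theta> x v = T v"
      proof (cases "v \<in> jet_index (m - 1) (n - 1) k'")
        case False
        then show ?thesis using TI by (auto simp: v \<theta>_def pivot_map_def aff_def)
      next
        case True
        then have i: "i \<in> {1..m - 1}" and j: "j \<in> {1..n - 1}" and l: "l < k'"
          by (auto simp: v jet_index_def)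
        have sk1: "skip 1 i = Suc i" "skip 1 j = Suc j" using i j by (auto simp: skip_def)
        have xK: "x (1, 1, s + u) = z (1, 1, s + u)" "x (Suc i, 1, s + u) = z (Suc i, 1, s + u)"
          "x (1, Suc j, s + u) = z (1, Suc j, s + u)" if "u \<le> l" for u
          using i j l that sk mn by (auto simp: x_def K_def pivot_free_def)
        have xD: "x (Suc i, Suc j, s + u) = fps_nth (D (Suc i) (Suc j)) u" if "u \<le> l" for u
          using i j l that sk by (auto simp: x_def K_def pivot_free_def jet_index_def)
        have "\<theta> x v = (\<Sum>u\<le>l. x (1, 1, s + u) * x (Suc i, Suc j, s + (l - u)) -
            x (Suc i, 1, s + u) * x (1, Suc j, s + (l - u)))"
          using True by (simp add: v \<theta>_def pivot_map_def sk1[unfolded One_nat_def])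
        also have "\<dots> = (\<Sum>u\<le>l. z (1, 1, s + u) * fps_nth (D (Suc i) (Suc j)) (l - u) -
            z (Suc i, 1, s + u) * z (1, Suc j, s + (l - u)))"
          using xK xD[OF diff_le_self] xK(3)[OF diff_le_self]
          by (intro sum.cong) (simp_all del: One_nat_def add_diff_assoc)
        also have "\<dots> = fps_nth (A 1 1 * D (Suc i) (Suc j)) l - fps_nth (A (Suc i) 1 * A 1 (Suc j)) l"
          by (simp add: fps_mult_nth sum_subtractf A_def atLeast0AtMost)
        also have "\<dots> = T v" unfolding AD by (simp add: v)
        finally show ?thesis .
      qed
    qed
    ultimately show ?thesis using T by (auto simp: V_def)
  qed
  have *: "irred V \<and> dim_ge V (d + card K)"
  proof -
    have VI: "V \<subseteq> aff (jet_index m n k)" by (auto simp: V_def jet_stratum_def)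
    have rat: "rat_fun V p K \<theta> (\<lambda>x. x v)" if "v \<in> jet_index m n k" for v
      unfolding K_def p_def \<theta>_def
      by (rule pivot_rat_fun[OF VI _ sk k(3) one that]) (auto simp: V_def jet_stratum_def)
    have p: "p \<in> polyfun" unfolding p_def by (rule pf_var)
    have ploc: "p x = p y" if "\<forall>v\<in>K. x v = y v" for x y using that pK by (simp add: p_def)
    have ex: "\<exists>z\<in>aff K. p z \<noteq> 0"
      using pK by (intro bexI[of _ "\<lambda>v. if v \<in> K then 1 else 0"]) (auto simp: p_def aff_def)
    have into: "\<theta> x \<in> V' \<and> p x \<noteq> 0" if "x \<in> V" for x
      using that by (simp add: V_def)
    have \<theta>: "(\<lambda>x. \<theta> x i) \<in> polyfun" for i unfolding \<theta>_def by (rule polyfun_pivot_map)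
    show ?thesis
      using irred_dim_ge_fibration[OF inf VI V'(2) \<theta> finK p ploc ex rat into onto] V'(3) by blast
  qed
  moreover have "V \<subseteq> jetZ m n (Suc q) k"
  proof
    fix x assume x: "x \<in> V"
    then have "\<theta> x \<in> jetZ (m - 1) (n - 1) q k'" using V'(1) by (auto simp: V_def)
    then show "x \<in> jetZ m n (Suc q) k"
      using jetZ_iff_pivot[OF _ _ k(1,3,2) one, of x] x by (simp add: V_def jet_stratum_def \<theta>_def p_def)
  qed
  moreover have "m * n * k \<le> (d + card K) + (c + s * m * n)"
    using card_pivot_free[OF sk one] V'(4) by (simp add: K_def algebra_simps)
  ultimately show ?thesis unfolding codimZ_le_iff[OF inf] by blast
qed

text \<open>The witness is the image of \<open>V\<close> under \<open>shift_map\<close>, whose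
  dimension is smaller by at most the number of free coordinates.\<close>

lemma codimZ_shift_le:
  fixes V :: "(nat \<times> nat \<times> nat \<Rightarrow> 'a::field) set"
  assumes inf: "infinite (UNIV :: 'a set)" and k: "k = s * r + \<mu>" "r > 0"
    and V: "V \<subseteq> jetZ m n r k" "V \<subseteq> jet_stratum m n k s" "irred V" "dim_ge V d" "m * n * k \<le> d + c"
  shows "\<exists>c'. codimZ (F :: 'a itself) m n r \<mu> \<le> enat c' \<and> c' + s * m * n \<le> c"
proof -
  define K where "K = shift_free m n k s \<mu>"
  define W where "W = shift_map m n s \<mu> ` V"
  have sk: "s + \<mu> \<le> k" using k by (cases r) auto
  have VI: "V \<subseteq> aff (jet_index m n k)" using V(1) jetZ_sub by blast
  have K: "K \<subseteq> jet_index m n k" by (auto simp: K_def shift_free_def jet_index_def)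
  have ne: "\<exists>x\<in>V. (1 :: 'a) \<noteq> 0" using V(3) by (auto simp: irred_def)
  have rat: "rat_fun V (\<lambda>_. 1) K (shift_map m n s \<mu>) (\<lambda>x. x v)" if "v \<in> jet_index m n k" for v
    unfolding K_def by (rule shift_rat_fun[OF VI _ that]) (use V(2) in \<open>auto simp: jet_stratum_def\<close>)
  obtain d' where d': "dim_ge W d'" "d \<le> d' + card K"
    using dim_ge_image[OF inf finite_jet_index finite_jet_index V(3) VI polyfun_shift_map shift_map_aff
        K pf_const refl ne rat V(4)] unfolding W_def by blast
  have WZ: "W \<subseteq> jetZ m n r \<mu>"
  proof
    fix w assume "w \<in> W"
    then obtain x where x: "x \<in> V" "w = shift_map m n s \<mu> x" unfolding W_def by blast
    then show "w \<in> jetZ m n r \<mu>"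
      using jetZ_iff_shift[OF _ _ k, of x m n] subsetD[OF V(1) x(1)] subsetD[OF V(2) x(1)]
      by (simp add: jet_stratum_def)
  qed
  have Wirr: "irred W" unfolding W_def by (rule irred_image[OF V(3) polyfun_shift_map])
  \<comment> \<open>This bound forces \<open>s * m * n \<le> c\<close>, so the natural-number
    subtraction in the witness is exact.\<close>
  have "d' \<le> m * n * \<mu>"
    using dim_ge_le_card[OF inf finite_jet_index order_trans[OF WZ jetZ_sub] d'(1)]
    by (simp add: card_jet_index)
  then have c: "m * n * \<mu> \<le> d' + (c - s * m * n)" "s * m * n \<le> c"
    using card_shift_free[OF sk, of m n] V(5) d'(2) by (simp_all add: K_def algebra_simps)
  then have "codimZ F m n r \<mu> \<le> enat (c - s * m * n)"
    unfolding codimZ_le_iff[OF inf] using WZ Wirr d'(1) by (intro exI[of _ W] exI[of _ d']) simp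
  then show ?thesis using c(2) by (intro exI[of _ "c - s * m * n"]) simp
qed

text \<open>The pivot position depends on \<open>V\<close>: it is a place where the coefficient of
  order \<open>s\<close> is not identically zero. Passing to the open part where it is nonzero costs
  no dimension, and there every point can be pivoted.\<close>

lemma codimZ_pivot_le:
  fixes V :: "(nat \<times> nat \<times> nat \<Rightarrow> 'a::field) set"
  assumes inf: "infinite (UNIV :: 'a set)" and k: "k = s * Suc q + k'" "q > 0" "k' > 0"
    and ij: "i0 \<in> {1..m}" "j0 \<in> {1..n}"
    and V: "V \<subseteq> jetZ m n (Suc q) k" "V \<subseteq> jet_stratum m n k s" "irred V" "dim_ge V d" "m * n * k \<le> d + c"
    and nv: "\<not> vanishes V (\<lambda>x. x (i0, j0, s))"
  shows "\<exists>c'. codimZ (F :: 'a itself) (m - 1) (n - 1) q k' \<le> enat c' \<and> c' + s * m * n \<le> c"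
proof -
  define p :: "(nat \<times> nat \<times> nat \<Rightarrow> 'a) \<Rightarrow> 'a" where "p = (\<lambda>x. x (i0, j0, s))"
  define K where "K = pivot_free m n k s k' i0 j0"
  define \<theta> where "\<theta> = (pivot_map m n s k' i0 j0 :: (nat \<times> nat \<times> nat \<Rightarrow> 'a) \<Rightarrow> nat \<times> nat \<times> nat \<Rightarrow> 'a)"
  define V0 where "V0 = {x \<in> V. p x \<noteq> 0}"
  define W where "W = \<theta> ` V0"
  have p: "p \<in> polyfun" unfolding p_def by (rule pf_var)
  have nv': "\<not> vanishes V p" using nv by (simp add: p_def)
  have sk: "s + k' \<le> k" using k by auto
  have V0: "irred V0" "dim_ge V0 d"
    unfolding V0_def using irred_open(1)[OF V(3) p nv'] dim_ge_open[OF V(3) p nv' V(4)] by auto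
  have VI: "V0 \<subseteq> aff (jet_index m n k)" using V(1) jetZ_sub unfolding V0_def by blast
  have pK: "(i0, j0, s) \<in> K" using ij sk k by (auto simp: K_def pivot_free_def)
  have K: "K \<subseteq> jet_index m n k" by (auto simp: K_def pivot_free_def jet_index_def)
  have ne: "\<exists>x\<in>V0. p x \<noteq> 0" using V0(1) by (auto simp: irred_def V0_def)
  have ploc: "p x = p y" if "\<forall>v\<in>K. x v = y v" for x y using that pK by (simp add: p_def)
  have rat: "rat_fun V0 p K \<theta> (\<lambda>x. x v)" if "v \<in> jet_index m n k" for v
    unfolding K_def p_def \<theta>_def
    by (rule pivot_rat_fun[OF VI _ sk k(3) ij that]) (use V(2) in \<open>auto simp: jet_stratum_def V0_def\<close>)
  have \<theta>: "(\<lambda>x. \<theta> x i) \<in> polyfun" for i unfolding \<theta>_def by (rule polyfun_pivot_map)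
  have \<theta>aff: "\<theta> x \<in> aff (jet_index (m - 1) (n - 1) k')" for x unfolding \<theta>_def by (rule pivot_map_aff)
  obtain d' where d': "dim_ge W d'" "d \<le> d' + card K"
    using dim_ge_image[OF inf finite_jet_index finite_jet_index V0(1) VI \<theta> \<theta>aff
        K p ploc ne rat V0(2)] unfolding W_def by blast
  have WZ: "W \<subseteq> jetZ (m - 1) (n - 1) q k'"
  proof
    fix w assume "w \<in> W"
    then obtain x where x: "x \<in> V" "p x \<noteq> 0" "w = \<theta> x" unfolding W_def V0_def by blast
    then show "w \<in> jetZ (m - 1) (n - 1) q k'"
      using jetZ_iff_pivot[OF _ _ k(1,3,2) ij, of x] subsetD[OF V(1) x(1)] subsetD[OF V(2) x(1)]
      by (simp add: jet_stratum_def p_def \<theta>_def)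
  qed
  have Wirr: "irred W" unfolding W_def by (rule irred_image[OF V0(1) \<theta>])
  have "d' \<le> (m - 1) * (n - 1) * k'"
    using dim_ge_le_card[OF inf finite_jet_index order_trans[OF WZ jetZ_sub] d'(1)]
    by (simp add: card_jet_index)
  then have c: "(m - 1) * (n - 1) * k' \<le> d' + (c - s * m * n)" "s * m * n \<le> c"
    using card_pivot_free[OF sk ij] V(5) d'(2) unfolding K_def mult.commute[of s] mult.assoc[of m s n]
    by (simp_all add: mult.assoc mult.left_commute)
  then have "codimZ F (m - 1) (n - 1) q k' \<le> enat (c - s * m * n)"
    unfolding codimZ_le_iff[OF inf] using WZ Wirr d'(1) by (intro exI[of _ W] exI[of _ d']) simp
  then show ?thesis using c(2) by (intro exI[of _ "c - s * m * n"]) simp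
qed

lemma enat_eqI:
  assumes "\<And>e. x \<le> enat e \<longleftrightarrow> y \<le> enat e"
  shows "x = y"
proof (rule antisym)
  show "x \<le> y"
  proof (cases y)
    case (enat b)
    then show ?thesis using assms[of b] by simp
  qed simp
  show "y \<le> x"
  proof (cases x)
    case (enat b)
    then show ?thesis using assms[of b] by simp
  qed simp
qed

section \<open>The minimum over the strata\<close>

theorem theorem6p5:
  fixes F :: "'a::field itself" and m n r k lam mu :: nat and c :: "nat \<Rightarrow> enat"
  assumes "alg_closed F"
    and "2 \<le> r" and "r < m" and "m \<le> n" and "r \<le> k"
    and "k = lam * r + mu" and "1 \<le> lam" and "mu < r"
    and "\<And>s. s \<le> lam - 1 \<Longrightarrow> c s = codimZ F (m - 1) (n - 1) (r - 1) (k - r * s)"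
    and "c lam = (if mu = 0 then 0 else codimZ F m n r mu)"
  shows "codimZ F m n r k = Min ((\<lambda>s. c s + enat (s * m * n)) ` {0..lam})"
proof (rule enat_eqI)
  fix e
  have inf: "infinite (UNIV :: 'a set)" using assms(1) by (rule alg_closed_infinite)
  have clam: "c lam = codimZ F m n r mu" using assms(10) codimZ_0[OF inf] by simp
  define q where "q = r - 1"
  have q: "r = Suc q" "q > 0" using assms(2) by (auto simp: q_def)
  \<comment> \<open>For \<open>s < lam\<close> at least \<open>r\<close> orders remain, so the
    modulus after pivoting has positive exponent, as the pivoting bounds require.\<close>
  have split: "k = s * Suc q + (k - r * s) \<and> k - r * s > 0" if "s < lam" for s
  proof -
    have "Suc s * r \<le> lam * r" using that by (intro mult_le_mono1) simp
    then have "s * r + r \<le> k" using assms(6) by simp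
    then show ?thesis using q by (simp add: mult.commute)
  qed
  have cs: "c s = codimZ F (m - 1) (n - 1) q (k - r * s)" if "s < lam" for s
    using assms(9)[of s] that by (simp add: q_def)
  have plus: "x + enat N \<le> enat e \<longleftrightarrow> (\<exists>c'. x \<le> enat c' \<and> c' + N \<le> e)" for x N
  proof
    assume "x + enat N \<le> enat e"
    then show "\<exists>c'. x \<le> enat c' \<and> c' + N \<le> e" by (cases x) auto
  qed (cases x, auto)
  have "codimZ F m n r k \<le> enat e \<longleftrightarrow> (\<exists>s\<le>lam. c s + enat (s * m * n) \<le> enat e)"
  proof
    assume "codimZ F m n r k \<le> enat e"
    then obtain V :: "(nat \<times> nat \<times> nat \<Rightarrow> 'a) set" and d where
      V: "V \<subseteq> jetZ m n r k" "irred V" "dim_ge V d" "m * n * k \<le> d + e"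
      unfolding codimZ_le_iff[OF inf] by blast
    have VI: "V \<subseteq> aff (jet_index m n k)" using V(1) jetZ_sub by blast
    \<comment> \<open>\<open>lead s\<close>: some coefficient of order \<open>s\<close> is not
      identically zero on \<open>V\<close>. The least such order is the order of a generic point of
      the irreducible set \<open>V\<close>.\<close>
    define lead where "lead = (\<lambda>s. \<exists>i j. \<not> vanishes V (\<lambda>x. x (i, j, s)))"
    have stratum: "V \<subseteq> jet_stratum m n k s" if "\<And>l. l < s \<Longrightarrow> \<not> lead l" for s
      using VI that by (auto simp: jet_stratum_def lead_def vanishes_def)
    show "\<exists>s\<le>lam. c s + enat (s * m * n) \<le> enat e"
    proof (cases "\<exists>s<lam. lead s")
      case True
      define s where "s = (LEAST s. s < lam \<and> lead s)"
      have s: "s < lam" "lead s" using LeastI_ex[OF True] by (auto simp: s_def)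
      have "\<not> lead l" if "l < s" for l
        using not_less_Least[of l "\<lambda>s. s < lam \<and> lead s"] that s(1) by (auto simp: s_def)
      then have st: "V \<subseteq> jet_stratum m n k s" by (rule stratum)
      obtain i0 j0 where nv: "\<not> vanishes V (\<lambda>x. x (i0, j0, s))" using s(2) by (auto simp: lead_def)
      then obtain x where "x \<in> V" "x (i0, j0, s) \<noteq> 0" by (auto simp: vanishes_def)
      \<comment> \<open>Points of \<open>V\<close> are zero off the index set, so the position found
        lies inside the matrix.\<close>
      then have "(i0, j0, s) \<in> jet_index m n k" using VI by (auto simp: aff_def)
      then have ij: "i0 \<in> {1..m}" "j0 \<in> {1..n}" by (auto simp: jet_index_def)
      have "\<exists>c'. codimZ F (m - 1) (n - 1) q (k - r * s) \<le> enat c' \<and> c' + s * m * n \<le> e"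
        using split[OF s(1)] V st nv
        by (intro codimZ_pivot_le[OF inf _ q(2) _ ij, where V = V and d = d]) (auto simp: q(1))
      then show ?thesis using plus cs[OF s(1)] s(1) by (intro exI[of _ s]) simp
    next
      case False
      \<comment> \<open>No order below \<open>lam\<close> leads, so \<open>t ^ lam\<close> divides
        every point of \<open>V\<close>; whether order \<open>lam\<close> itself leads makes no
        difference to the condition left modulo \<open>t ^ mu\<close>.\<close>
      then have "V \<subseteq> jet_stratum m n k lam" by (intro stratum) blast
      then have "\<exists>c'. codimZ F m n r mu \<le> enat c' \<and> c' + lam * m * n \<le> e"
        using V assms(2) by (intro codimZ_shift_le[OF inf assms(6), where V = V and d = d]) auto
      then show ?thesis using plus clam by (intro exI[of _ lam]) simp
    qed
  next
    assume "\<exists>s\<le>lam. c s + enat (s * m * n) \<le> enat e"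
    then obtain s c' where s: "s \<le> lam" "c s \<le> enat c'" "c' + s * m * n \<le> e" using plus by blast
    have "codimZ F m n r k \<le> enat (c' + s * m * n)"
    proof (cases "s = lam")
      case True
      then show ?thesis using s(2) clam assms(2) by (intro codimZ_le_shift[OF inf, of _ _ _ mu]) (auto simp: assms(6))
    next
      case False
      then have "s < lam" using s(1) by simp
      then show ?thesis
        unfolding q(1) using s(2) cs split[of s] q(2) assms(3,4)
        by (intro codimZ_le_pivot[OF inf]) auto
    qed
    then show "codimZ F m n r k \<le> enat e" using s(3) by (meson enat_ord_simps(1) order_trans)
  qed
  also have "\<dots> \<longleftrightarrow> Min ((\<lambda>s. c s + enat (s * m * n)) ` {0..lam}) \<le> enat e"
    by (subst Min_le_iff) auto
  finally show "codimZ F m n r k \<le> enat e \<longleftrightarrow> Min ((\<lambda>s. c s + enat (s * m * n)) ` {0..lam}) \<le> enat e" .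
qed

end
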